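(* For $i=0,1$, let $g^i:\Delta\times\mathbb R^n\times\mathbb R^n\times\Omega\to\mathbb R^n$ be measurable, such that $s\mapsto g^i(t,s,y,z)$ is $\mathbb F$-progressively measurable, $(y,z)\mapsto g^i(t,s,y,z)$ is uniformly Lipschitz, and $(t,s)\mapsto g^i(t,s,0,0)$ is uniformly bounded. Suppose $\bar g:\Delta\times\mathbb R^n\times\mathbb R^n\times\Omega\to\mathbb R^n$ is measurable, $s\mapsto\bar g(t,s,y,z)$ is $\mathbb F$-progressively measurable, $(y,z)\mapsto\bar g(t,s,y,z)$ is uniformly Lipschitz, $y\mapsto\bar g(t,s,y,z)$ is nondecreasing, and $$g^0(t,s,y,z)\le\bar g(t,s,y,z)\le g^1(t,s,y,z),\qquad(t,s,y,z)\in\Delta\times\mathbb R^n\times\mathbb R^n,\ \text{a.s.}$$ Moreover, suppose $\bar g_z(t,s,y,z)$ exists and $$\bar g_z(t,s,y,z)\in\mathbb R^{n\times n}_d,\qquad(t,s,y,z)\in\Delta\times\mathbb R^n\times\mathbb R^n,\ \text{a.s.}$$ Then for any $\psi^0(\cdot),\psi^1(\cdot)\in C_{\mathcal F_T}([0,T];L^2(\Omega;\mathbb R^n))$ satisfying $$\psi^0(t)\le\psi^1(t),\qquad t\in[0,T],\ \text{a.s.},$$ the corresponding unique adapted solutions $(Y^i(\cdot),Z^i(\cdot,\cdot))\in\mathcal H^2_\Delta[0,T]$ of the backward stochastic Volterra integral equations $$Y^i(t)=\psi^i(t)+\int_t^Tg^i(t,s,Y^i(s),Z^i(t,s))ds-\int_t^TZ^i(t,s)dW(s),\qquad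 t\in[0,T],\quad i=0,1,$$ satisfy $$Y^0(t)\le Y^1(t),\qquad t\in[0,T],\ \text{a.s.}$$
   Context: $T>0$ and $n\ge1$ are fixed. $(\Omega,\mathcal F,\mathbb F,\mathbb P)$ is a complete filtered probability space carrying a one-dimensional standard Brownian motion $W(\cdot)$, and $\mathbb F=\{\mathcal F_t\}_{t\ge0}$ is the natural filtration of $W$ augmented by all $\mathbb P$-null sets. $\Delta=\{(t,s)\in[0,T]^2:t\le s\}$. Dependence on $\omega$ is suppressed. For $x,y\in\mathbb R^n$, $x\le y$ means componentwise inequality, and a map $f:\mathbb R^n\to\mathbb R^n$ is nondecreasing if $y\le y'$ implies $f(y)\le f(y')$. $\mathbb R^{n\times n}_d$ is the set of diagonal $n\times n$ real matrices; $\bar g_z$ is the Jacobian matrix in $z$. $C_{\mathcal F_T}([0,T];L^2(\Omega;\mathbb R^n))$ is the set of maps $\psi:[0,T]\to L^2_{\mathcal F_T}(\Omega;\mathbb R^n)$ that are continuous (each $\psi(t)$ is $\mathcal F_T$-measurable, not necessarily $\mathcal F_t$-measurable). $\mathcal H^2_\Delta[0,T]=L^2_{\mathbb F}(0,T;\mathbb R^n)\times L^2_{\mathbb F}(\Delta;\mathbb R^n)$, where $L^2_{\mathbb F}(0,T;\mathbb R^n)$ is the set of $\mathbb F$-adapted $Y$ with $\mathbb E\int_0^T|Y(t)|^2dt<\infty$, and $L^2_{\mathbb F}(\Delta;\mathbb R^n)$ is the set of $Z:\Delta\times\Omega\to\mathbb R^n$ such that $s\mapsto Z(t,s)$ is $\mathbb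 F$-progressively measurable on $[t,T]$ for every $t\in[0,T]$ and $\int_0^T\mathbb E\int_t^T|Z(t,s)|^2ds\,dt<\infty$. An adapted solution is a pair in $\mathcal H^2_\Delta[0,T]$ satisfying the equation in the Itô sense; under the stated hypotheses it exists and is unique. As $Y$ is an element of $L^2_{\mathbb F}(0,T;\mathbb R^n)$, inequalities for it are understood for a.e. $t$, a.s. *)

theory Defs
  imports "HOL-Probability.Probability"
begin

section \<open>Brownian motion and its augmented filtration\<close>

definition standard_brownian_motion :: "'w measure \<Rightarrow> (real \<Rightarrow> 'w \<Rightarrow> real) \<Rightarrow> bool" where
  "standard_brownian_motion M W \<longleftrightarrow>
    (\<forall>t\<ge>0. W t \<in> borel_measurable M) \<and>
    (AE \<omega> in M. W 0 \<omega> = 0) \<and>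
    (AE \<omega> in M. continuous_on {0..} (\<lambda>t. W t \<omega>)) \<and>
    (\<forall>\<tau>::nat \<Rightarrow> real. 0 \<le> \<tau> 0 \<and> mono \<tau> \<longrightarrow>
      prob_space.indep_vars M (\<lambda>_. borel) (\<lambda>i \<omega>. W (\<tau> (Suc i)) \<omega> - W (\<tau> i) \<omega>) UNIV) \<and>
    (\<forall>s t. 0 \<le> s \<and> s < t \<longrightarrow>
      distributed M lborel (\<lambda>\<omega>. W t \<omega> - W s \<omega>) (normal_density 0 (sqrt (t - s))))"

text \<open>Only the underlying \<open>\<sigma>\<close>-algebra of \<open>augmented_filtration M W t\<close> is meaningful; probabilities
  and expectations are always taken with respect to \<open>M\<close>.\<close>

definition augmented_filtration :: "'w measure \<Rightarrow> (real \<Rightarrow> 'w \<Rightarrow> real) \<Rightarrow> real \<Rightarrow> 'w measure" where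
  "augmented_filtration M W t =
    sigma (space M) ({W s -` A \<inter> space M | s A. s \<in> {0..t} \<and> A \<in> sets borel} \<union> null_sets M)"

definition progressive ::
  "(real \<Rightarrow> 'w measure) \<Rightarrow> real \<Rightarrow> real \<Rightarrow> (real \<Rightarrow> 'w \<Rightarrow> 'b::topological_space) \<Rightarrow> bool" where
  "progressive F a b X \<longleftrightarrow>
    (\<forall>u\<in>{a..b}. (\<lambda>(s, \<omega>). X s \<omega>) \<in> borel_measurable (restrict_space borel {a..u} \<Otimes>\<^sub>M F u))"


section \<open>The Ito integral of square-integrable processes\<close>

text \<open>A step process on \<open>(a, b]\<close> is given by a grid \<open>a = \<tau> 0 \<le> \<dots> \<le> \<tau> N = b\<close> and bounded
  coefficients \<open>\<xi> i\<close>, where \<open>\<xi> i\<close> is known at the left end point \<open>\<tau> i\<close>.\<close>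

definition adapted_step ::
  "'w measure \<Rightarrow> (real \<Rightarrow> 'w measure) \<Rightarrow> real \<Rightarrow> real \<Rightarrow>
    nat \<Rightarrow> (nat \<Rightarrow> real) \<Rightarrow> (nat \<Rightarrow> 'w \<Rightarrow> 'b::euclidean_space) \<Rightarrow> bool" where
  "adapted_step M F a b N \<tau> \<xi> \<longleftrightarrow>
    \<tau> 0 = a \<and> \<tau> N = b \<and> (\<forall>i<N. \<tau> i \<le> \<tau> (Suc i)) \<and>
    (\<forall>i<N. \<xi> i \<in> borel_measurable (F (\<tau> i)) \<and> bounded (\<xi> i ` space M))"

definition step_process ::
  "nat \<Rightarrow> (nat \<Rightarrow> real) \<Rightarrow> (nat \<Rightarrow> 'w \<Rightarrow> 'b::euclidean_space) \<Rightarrow> real \<Rightarrow> 'w \<Rightarrow> 'b" where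
  "step_process N \<tau> \<xi> s \<omega> = (\<Sum>i<N. indicator {\<tau> i<..\<tau> (Suc i)} s *\<^sub>R \<xi> i \<omega>)"

definition step_ito_integral ::
  "(real \<Rightarrow> 'w \<Rightarrow> real) \<Rightarrow> nat \<Rightarrow> (nat \<Rightarrow> real) \<Rightarrow> (nat \<Rightarrow> 'w \<Rightarrow> 'b::euclidean_space) \<Rightarrow> 'w \<Rightarrow> 'b" where
  "step_ito_integral W N \<tau> \<xi> \<omega> = (\<Sum>i<N. (W (\<tau> (Suc i)) \<omega> - W (\<tau> i) \<omega>) *\<^sub>R \<xi> i \<omega>)"

text \<open>\<open>I\<close> is a version of \<open>\<integral>\<^sub>a\<^sup>b H(s) dW(s)\<close>: step processes approximate \<open>H\<close> in
  \<open>L\<^sup>2([a,b] \<times> \<Omega>)\<close> while their elementary integrals converge to \<open>I\<close> in \<open>L\<^sup>2(\<Omega>)\<close>.\<close>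

definition has_ito_integral ::
  "'w measure \<Rightarrow> (real \<Rightarrow> 'w measure) \<Rightarrow> (real \<Rightarrow> 'w \<Rightarrow> real) \<Rightarrow> real \<Rightarrow> real \<Rightarrow>
    (real \<Rightarrow> 'w \<Rightarrow> 'b::euclidean_space) \<Rightarrow> ('w \<Rightarrow> 'b) \<Rightarrow> bool" where
  "has_ito_integral M F W a b H I \<longleftrightarrow>
    progressive F a b H \<and> I \<in> borel_measurable M \<and>
    (\<exists>N \<tau> \<xi>. (\<forall>k. adapted_step M F a b (N k) (\<tau> k) (\<xi> k)) \<and>
      (\<lambda>k. \<integral>\<^sup>+\<omega>. (\<integral>\<^sup>+s\<in>{a..b}. ennreal ((norm (step_process (N k) (\<tau> k) (\<xi> k) s \<omega> - H s \<omega>))\<^sup>2) \<partial>lborel) \<partial>M)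
        \<longlonglongrightarrow> 0 \<and>
      (\<lambda>k. \<integral>\<^sup>+\<omega>. ennreal ((norm (step_ito_integral W (N k) (\<tau> k) (\<xi> k) \<omega> - I \<omega>))\<^sup>2) \<partial>M)
        \<longlonglongrightarrow> 0)"


section \<open>Function spaces\<close>

definition time_triangle :: "real \<Rightarrow> (real \<times> real) set" where
  "time_triangle T = {(t, s). 0 \<le> t \<and> t \<le> s \<and> s \<le> T}"

text \<open>Continuous maps \<open>[0,T] \<rightarrow> L\<^sup>2(\<Omega>, \<F>\<^sub>T)\<close>; elements of \<open>L\<^sup>2\<close> are represented by functions on
  \<open>\<Omega>\<close>. As for all processes below, values at times outside the stated range are irrelevant.\<close>

definition C_L2 ::
  "'w measure \<Rightarrow> (real \<Rightarrow> 'w measure) \<Rightarrow> real \<Rightarrow> (real \<Rightarrow> 'w \<Rightarrow> 'b::euclidean_space) set" where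
  "C_L2 M F T = {\<psi>.
    (\<forall>t\<in>{0..T}. \<psi> t \<in> borel_measurable (F T) \<and> integrable M (\<lambda>\<omega>. (norm (\<psi> t \<omega>))\<^sup>2)) \<and>
    (\<forall>t\<in>{0..T}. ((\<lambda>r. \<integral>\<omega>. (norm (\<psi> r \<omega> - \<psi> t \<omega>))\<^sup>2 \<partial>M) \<longlongrightarrow> 0) (at t within {0..T}))}"

definition L2_adapted ::
  "'w measure \<Rightarrow> (real \<Rightarrow> 'w measure) \<Rightarrow> real \<Rightarrow> (real \<Rightarrow> 'w \<Rightarrow> 'b::euclidean_space) set" where
  "L2_adapted M F T = {Y.
    (\<lambda>(t, \<omega>). Y t \<omega>) \<in> borel_measurable (restrict_space borel {0..T} \<Otimes>\<^sub>M M) \<and>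
    (\<forall>t\<in>{0..T}. Y t \<in> borel_measurable (F t)) \<and>
    (\<integral>\<^sup>+\<omega>. (\<integral>\<^sup>+t\<in>{0..T}. ennreal ((norm (Y t \<omega>))\<^sup>2) \<partial>lborel) \<partial>M) < \<infinity>}"

definition L2_triangle ::
  "'w measure \<Rightarrow> (real \<Rightarrow> 'w measure) \<Rightarrow> real \<Rightarrow> (real \<Rightarrow> real \<Rightarrow> 'w \<Rightarrow> 'b::euclidean_space) set" where
  "L2_triangle M F T = {Z.
    (\<lambda>((t, s), \<omega>). Z t s \<omega>) \<in> borel_measurable (restrict_space borel (time_triangle T) \<Otimes>\<^sub>M M) \<and>
    (\<forall>t\<in>{0..T}. progressive F t T (Z t)) \<and>
    (\<integral>\<^sup>+t\<in>{0..T}. (\<integral>\<^sup>+\<omega>. (\<integral>\<^sup>+s\<in>{t..T}. ennreal ((norm (Z t s \<omega>))\<^sup>2) \<partial>lborel) \<partial>M) \<partial>lborel) < \<infinity>}"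

definition H2_triangle ::
  "'w measure \<Rightarrow> (real \<Rightarrow> 'w measure) \<Rightarrow> real \<Rightarrow>
    ((real \<Rightarrow> 'w \<Rightarrow> 'b::euclidean_space) \<times> (real \<Rightarrow> real \<Rightarrow> 'w \<Rightarrow> 'b)) set" where
  "H2_triangle M F T = L2_adapted M F T \<times> L2_triangle M F T"


section \<open>Backward stochastic Volterra integral equations\<close>

text \<open>A generator \<open>g(t,s,y,z,\<omega>)\<close>. The Lipschitz constant is uniform in \<open>(t,s,\<omega>)\<close>.\<close>

definition lipschitz_generator ::
  "'w measure \<Rightarrow> (real \<Rightarrow> 'w measure) \<Rightarrow> real \<Rightarrow>
    (real \<Rightarrow> real \<Rightarrow> real^'n \<Rightarrow> real^'n \<Rightarrow> 'w \<Rightarrow> real^'n) \<Rightarrow> bool" where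
  "lipschitz_generator M F T g \<longleftrightarrow>
    (\<lambda>((t, s), y, z, \<omega>). g t s y z \<omega>)
      \<in> borel_measurable (restrict_space borel (time_triangle T) \<Otimes>\<^sub>M borel \<Otimes>\<^sub>M borel \<Otimes>\<^sub>M M) \<and>
    (\<forall>t\<in>{0..T}. \<forall>y z. progressive F t T (\<lambda>s \<omega>. g t s y z \<omega>)) \<and>
    (\<exists>L. \<forall>(t, s)\<in>time_triangle T. AE \<omega> in M. L-lipschitz_on UNIV (\<lambda>(y, z). g t s y z \<omega>))"

definition bounded_at_zero ::
  "'w measure \<Rightarrow> real \<Rightarrow> (real \<Rightarrow> real \<Rightarrow> real^'n \<Rightarrow> real^'n \<Rightarrow> 'w \<Rightarrow> real^'n) \<Rightarrow> bool" where
  "bounded_at_zero M T g \<longleftrightarrow> (\<exists>C. \<forall>(t, s)\<in>time_triangle T. AE \<omega> in M. norm (g t s 0 0 \<omega>) \<le> C)"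

definition diagonal_matrices :: "(real^'n^'n) set" where
  "diagonal_matrices = {A. \<forall>i j. i \<noteq> j \<longrightarrow> A $ i $ j = 0}"

text \<open>Members of \<open>H2_triangle\<close> are determined only up to null sets in the time variable \<open>t\<close>, and
  \<open>Z t\<close> is square integrable only for almost every \<open>t\<close>; hence the equation is required for
  almost every \<open>t\<close>, almost surely.\<close>

definition bsvie_adapted_solution ::
  "'w measure \<Rightarrow> (real \<Rightarrow> 'w measure) \<Rightarrow> (real \<Rightarrow> 'w \<Rightarrow> real) \<Rightarrow> real \<Rightarrow>
    (real \<Rightarrow> real \<Rightarrow> real^'n \<Rightarrow> real^'n \<Rightarrow> 'w \<Rightarrow> real^'n) \<Rightarrow> (real \<Rightarrow> 'w \<Rightarrow> real^'n) \<Rightarrow>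
    (real \<Rightarrow> 'w \<Rightarrow> real^'n) \<Rightarrow> (real \<Rightarrow> real \<Rightarrow> 'w \<Rightarrow> real^'n) \<Rightarrow> bool" where
  "bsvie_adapted_solution M F W T g \<psi> Y Z \<longleftrightarrow>
    (Y, Z) \<in> H2_triangle M F T \<and>
    (AE t in lborel. t \<in> {0..T} \<longrightarrow>
      (\<exists>I. has_ito_integral M F W t T (Z t) I \<and>
        (AE \<omega> in M.
          set_integrable lborel {t..T} (\<lambda>s. g t s (Y s \<omega>) (Z t s \<omega>) \<omega>) \<and>
          Y t \<omega> = \<psi> t \<omega> + (LBINT s:{t..T}. g t s (Y s \<omega>) (Z t s \<omega>) \<omega>) - I \<omega>)))"

end

theory Submission
  imports Defs
begin

text \<open>Why the solutions are ordered. Fix \<open>t < T\<close> and a coordinate \<open>i\<close>, and put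
  \<open>U = Y\<^sup>0\<^sub>i(t) - Y\<^sup>1\<^sub>i(t)\<close>, \<open>\<zeta>(s) = Z\<^sup>0\<^sub>i(t,s) - Z\<^sup>1\<^sub>i(t,s)\<close> and \<open>P(s) = \<bar>(Y\<^sup>0(s) - Y\<^sup>1(s))\<^sup>+\<bar>\<close>.
  Passing from \<open>g\<^sup>0\<close> to \<open>g\<^sup>1\<close> through the intermediate generator costs, in the \<open>i\<close>-th coordinate, at
  most \<open>L P(s) + L \<bar>\<zeta>(s)\<bar>\<close>: monotonicity in \<open>y\<close> allows \<open>Y\<^sup>0\<close> to be raised to \<open>Y\<^sup>1 + (Y\<^sup>0 - Y\<^sup>1)\<^sup>+\<close>, and
  the diagonal Jacobian means that the \<open>i\<close>-th component sees only the \<open>i\<close>-th component of \<open>z\<close>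
  (lemma \<open>generator_comparison\<close>). Subtracting the two equations therefore gives the scalar inequality
  \<open>U \<le> L \<integral>\<^sub>t\<^sup>T P ds + L \<integral>\<^sub>t\<^sup>T \<bar>\<zeta>\<bar> ds - \<integral>\<^sub>t\<^sup>T \<zeta> dW\<close>.

  The last two terms disappear under a change of measure of Girsanov type with drift \<open>L sgn \<zeta>\<close>.
  This is carried out at the discrete level only. The definition of the stochastic integral provides
  step processes approximating \<open>\<zeta>\<close>; for a step process the drift is again a step process, and the
  density is an explicit finite product of exponentials of Brownian increments
  (\<open>step_density\<close>). It is a positive martingale, it makes
  \<open>L \<integral> \<bar>\<zeta>\<bar> ds - \<integral> \<zeta> dW\<close> centred (\<open>step_density_orthogonal\<close>), and its conditional second moment is
  \<open>exp (L\<^sup>2 (T - t))\<close>, independently of the approximation. The last point permits the passage to the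
  limit and yields \<open>E (U\<^sup>+)\<^sup>2 \<le> C E (\<integral>\<^sub>t\<^sup>T P ds)\<^sup>2\<close> (\<open>positive_part_estimate\<close>).

  Summing over the coordinates, \<open>u(t) = E P(t)\<^sup>2\<close> satisfies \<open>u(t) \<le> C' \<integral>\<^sub>t\<^sup>T u(s) ds\<close> for almost every
  \<open>t\<close>, and a Gronwall argument (\<open>volterra_inequality_imp_AE_zero\<close>) forces \<open>u = 0\<close>, that is,
  \<open>Y\<^sup>0 \<le> Y\<^sup>1\<close>.\<close>

section \<open>The Brownian filtration\<close>

locale brownian_space = prob_space M for M :: "'w measure" +
  fixes W :: "real \<Rightarrow> 'w \<Rightarrow> real"
  assumes brownian: "standard_brownian_motion M W"
begin

abbreviation "F \<equiv> augmented_filtration M W"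

lemma W_measurable: "0 \<le> t \<Longrightarrow> W t \<in> borel_measurable M"
  using brownian unfolding standard_brownian_motion_def by blast

lemma filtration_generator_subset:
  "{W s -` A \<inter> space M | s A. s \<in> {0..t} \<and> A \<in> sets borel} \<union> null_sets M \<subseteq> events"
  using W_measurable by (auto simp: null_sets_def intro: measurable_sets)

lemma filtration_generator_Pow:
  "{W s -` A \<inter> space M | s A. s \<in> {0..t} \<and> A \<in> sets borel} \<union> null_sets M \<subseteq> Pow (space M)"
  using filtration_generator_subset[of t] sets.space_closed by blast

lemma space_filtration [simp]: "space (F t) = space M"
  unfolding augmented_filtration_def by (rule space_measure_of[OF filtration_generator_Pow])

lemma sets_filtration:
  "sets (F t) = sigma_sets (space M)
     ({W s -` A \<inter> space M | s A. s \<in> {0..t} \<and> A \<in> sets borel} \<union> null_sets M)"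
  unfolding augmented_filtration_def by (rule sets_measure_of[OF filtration_generator_Pow])

lemma filtration_subset_events: "sets (F t) \<subseteq> events"
  unfolding sets_filtration by (rule sets.sigma_sets_subset[OF filtration_generator_subset])

lemma filtration_mono: "s \<le> t \<Longrightarrow> sets (F s) \<subseteq> sets (F t)"
  unfolding sets_filtration by (rule sigma_sets_mono') fastforce

lemma measurable_filtrationD: "f \<in> measurable (F t) N \<Longrightarrow> f \<in> measurable M N"
  using filtration_subset_events[of t] by (auto simp: measurable_def)

lemma measurable_filtration_mono: "f \<in> measurable (F s) N \<Longrightarrow> s \<le> t \<Longrightarrow> f \<in> measurable (F t) N"
  using filtration_mono[of s t] by (auto simp: measurable_def)

lemma W_adapted: "0 \<le> s \<Longrightarrow> s \<le> t \<Longrightarrow> W s \<in> borel_measurable (F t)"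
  by (rule measurableI) (auto simp: sets_filtration intro!: sigma_sets.Basic)

text \<open>A \<open>\<pi>\<close>-system on which independence from a later increment can be read off the definition of
  Brownian motion. The values are taken relative to \<open>W 0\<close> because only increments are controlled
  there; \<open>W 0 = 0\<close> holds merely almost surely.\<close>

definition cylinder_events :: "real \<Rightarrow> 'w set set" where
  "cylinder_events s = {{\<omega> \<in> space M. \<forall>r\<in>J. W r \<omega> - W 0 \<omega> \<in> A r} | J A.
     finite J \<and> J \<subseteq> {0..s} \<and> (\<forall>r. A r \<in> sets borel)}"

lemma cylinder_events_events: "cylinder_events s \<subseteq> events"
proof
  fix E assume "E \<in> cylinder_events s"
  then obtain J A where E: "E = {\<omega> \<in> space M. \<forall>r\<in>J. W r \<omega> - W 0 \<omega> \<in> A r}"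
    and J: "finite J" "J \<subseteq> {0..s}" and A: "\<And>r. A r \<in> sets borel"
    unfolding cylinder_events_def by blast
  have "(\<lambda>\<omega>. W r \<omega> - W 0 \<omega>) \<in> borel_measurable M" if "r \<in> J" for r
    using that J W_measurable by (intro borel_measurable_diff) auto
  with A have "{\<omega> \<in> space M. W r \<omega> - W 0 \<omega> \<in> A r} \<in> events" if "r \<in> J" for r
    using that by (auto intro!: measurable_sets_Collect)
  then show "E \<in> events"
    unfolding E using J(1) by (intro sets.sets_Collect_finite_All) auto
qed

lemma Int_stable_cylinder_events: "Int_stable (cylinder_events s)"
proof (rule Int_stableI)
  fix a b assume "a \<in> cylinder_events s" "b \<in> cylinder_events s"
  then obtain J A J' A' where a: "a = {\<omega> \<in> space M. \<forall>r\<in>J. W r \<omega> - W 0 \<omega> \<in> A r}"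
    and J: "finite J" "J \<subseteq> {0..s}" and A: "\<And>r. A r \<in> sets borel"
    and b: "b = {\<omega> \<in> space M. \<forall>r\<in>J'. W r \<omega> - W 0 \<omega> \<in> A' r}"
    and J': "finite J'" "J' \<subseteq> {0..s}" and A': "\<And>r. A' r \<in> sets borel"
    unfolding cylinder_events_def by blast
  define B where "B r = (if r \<in> J then A r else UNIV) \<inter> (if r \<in> J' then A' r else UNIV)" for r
  have "a \<inter> b = {\<omega> \<in> space M. \<forall>r\<in>J \<union> J'. W r \<omega> - W 0 \<omega> \<in> B r}"
    unfolding a b B_def by auto
  moreover have "\<And>r. B r \<in> sets borel"
    unfolding B_def using A A' by auto
  ultimately show "a \<inter> b \<in> cylinder_events s"
    unfolding cylinder_events_def using J J' by blast
qed

text \<open>The finitely many times of the cylinder, together with \<open>0\<close> and \<open>s\<close>, are sorted into a grid that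
  then jumps to \<open>u\<close>. Each \<open>W r - W 0\<close> is a sum of increments before \<open>s\<close>, so that the cylinder and
  the increment depend on disjoint sets of independent variables.\<close>

lemma cylinder_independent_of_increment:
  assumes "0 \<le> s" "s < u" "E \<in> cylinder_events s" and B: "B \<in> sets borel"
  shows "prob (E \<inter> ((\<lambda>\<omega>. W u \<omega> - W s \<omega>) -` B \<inter> space M)) =
    prob E * prob ((\<lambda>\<omega>. W u \<omega> - W s \<omega>) -` B \<inter> space M)"
proof -
  obtain J A where E: "E = {\<omega> \<in> space M. \<forall>r\<in>J. W r \<omega> - W 0 \<omega> \<in> A r}"
    and J: "finite J" "J \<subseteq> {0..s}" and A: "\<And>r. A r \<in> sets borel"
    using assms(3) unfolding cylinder_events_def by blast
  define xs where "xs = sorted_list_of_set (insert 0 (insert s J))"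
  define m where "m = length xs - 1"
  \<comment> \<open>All grid points after the last one are equal to \<open>u\<close>: an infinite monotone grid is required.\<close>
  define \<tau> where "\<tau> i = (if i < length xs then xs ! i else u)" for i
  have set_xs: "set xs = insert 0 (insert s J)" and sorted: "sorted xs"
    unfolding xs_def using J(1) by (auto simp del: sorted_list_of_set_insert_remove sorted_list_of_set.sorted_key_list_of_set_insert_remove)
  have xs_le: "x \<le> s" and xs_ge: "0 \<le> x" if "x \<in> set xs" for x
    using that set_xs J assms(1) by auto
  have len: "length xs = Suc m"
    using set_xs unfolding m_def by (cases xs) auto
  have \<tau>0: "\<tau> 0 = 0"
  proof -
    obtain k where "k < length xs" "xs ! k = 0"
      using set_xs by (metis in_set_conv_nth insertI1)
    with sorted have "xs ! 0 \<le> 0" using sorted_nth_mono by fastforce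
    moreover have "0 \<le> xs ! 0" using len by (intro xs_ge) auto
    ultimately show ?thesis unfolding \<tau>_def using len by auto
  qed
  have \<tau>m: "\<tau> m = s"
  proof -
    obtain k where "k < length xs" "xs ! k = s"
      using set_xs by (metis in_set_conv_nth insertI1 insertI2)
    with sorted have "s \<le> xs ! m" using sorted_nth_mono[of xs k m] len by fastforce
    moreover have "xs ! m \<le> s" using len by (intro xs_le) auto
    ultimately show ?thesis unfolding \<tau>_def using len by auto
  qed
  have "mono \<tau>"
  proof (rule monoI)
    fix i j :: nat assume "i \<le> j"
    then show "\<tau> i \<le> \<tau> j"
      using sorted_nth_mono[OF sorted] xs_le[OF nth_mem, of i] assms(2)
      unfolding \<tau>_def by (cases "j < length xs"; cases "i < length xs") fastforce+
  qed
  define D where "D i \<omega> = W (\<tau> (Suc i)) \<omega> - W (\<tau> i) \<omega>" for i \<omega>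
  have ind: "indep_vars (\<lambda>_. borel) D UNIV"
    using brownian \<open>mono \<tau>\<close> \<tau>0 unfolding standard_brownian_motion_def D_def by simp
  have Dm: "D m = (\<lambda>\<omega>. W u \<omega> - W s \<omega>)"
    unfolding D_def \<tau>m by (simp add: \<tau>_def len)
  have indep: "indep_var (PiM {..<m} (\<lambda>_. borel)) (\<lambda>\<omega>. restrict (\<lambda>i. D i \<omega>) {..<m})
     (PiM {m} (\<lambda>_. borel)) (\<lambda>\<omega>. restrict (\<lambda>i. D i \<omega>) {m})"
    by (rule indep_var_restrict[OF ind]) auto
  have "\<forall>r\<in>J. \<exists>j\<le>m. \<tau> j = r"
  proof
    fix r assume "r \<in> J"
    then have "r \<in> set xs" using set_xs by auto
    then obtain j where "j < length xs" "xs ! j = r" by (metis in_set_conv_nth)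
    then show "\<exists>j\<le>m. \<tau> j = r" using len by (intro exI[of _ j]) (auto simp: \<tau>_def)
  qed
  then obtain k where k: "\<And>r. r \<in> J \<Longrightarrow> k r \<le> m" "\<And>r. r \<in> J \<Longrightarrow> \<tau> (k r) = r" by metis
  define Q where "Q = {f \<in> space (PiM {..<m} (\<lambda>_. borel::real measure)). \<forall>r\<in>J. (\<Sum>i<k r. f i) \<in> A r}"
  have Q: "Q \<in> sets (PiM {..<m} (\<lambda>_. borel))"
    unfolding Q_def
  proof (intro sets.sets_Collect_finite_All[OF _ J(1)])
    fix r assume "r \<in> J"
    then have "(\<lambda>f. \<Sum>i<k r. f i) \<in> borel_measurable (PiM {..<m} (\<lambda>_. borel::real measure))"
      using k(1)[of r] by (intro borel_measurable_sum measurable_component_singleton) auto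
    from measurable_sets[OF this A[of r]]
    show "{f \<in> space (PiM {..<m} (\<lambda>_. borel)). (\<Sum>i<k r. f i) \<in> A r} \<in> sets (PiM {..<m} (\<lambda>_. borel))"
      by (simp add: vimage_def Int_def conj_commute)
  qed
  have EQ: "E = (\<lambda>\<omega>. restrict (\<lambda>i. D i \<omega>) {..<m}) -` Q \<inter> space M"
  proof -
    have "(\<Sum>i<k r. restrict (\<lambda>i. D i \<omega>) {..<m} i) = W r \<omega> - W 0 \<omega>" if "r \<in> J" for r \<omega>
    proof -
      have "(\<Sum>i<k r. restrict (\<lambda>i. D i \<omega>) {..<m} i) = (\<Sum>i<k r. D i \<omega>)"
        using k(1)[OF that] by (intro sum.cong) auto
      also have "\<dots> = W (\<tau> (k r)) \<omega> - W (\<tau> 0) \<omega>"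
        unfolding D_def by (rule sum_lessThan_telescope)
      finally show ?thesis using k(2)[OF that] \<tau>0 by simp
    qed
    then show ?thesis unfolding E Q_def by (auto simp: space_PiM)
  qed
  define B' where "B' = {f \<in> space (PiM {m} (\<lambda>_. borel::real measure)). f m \<in> B}"
  have B': "B' \<in> sets (PiM {m} (\<lambda>_. borel))"
    unfolding B'_def using B by (intro measurable_sets_Collect[OF measurable_component_singleton]) auto
  have XB: "(\<lambda>\<omega>. W u \<omega> - W s \<omega>) -` B \<inter> space M = (\<lambda>\<omega>. restrict (\<lambda>i. D i \<omega>) {m}) -` B' \<inter> space M"
    unfolding B'_def Dm[symmetric] by (auto simp: space_PiM)
  have "E \<inter> ((\<lambda>\<omega>. W u \<omega> - W s \<omega>) -` B \<inter> space M) =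
     (\<lambda>\<omega>. (restrict (\<lambda>i. D i \<omega>) {..<m}, restrict (\<lambda>i. D i \<omega>) {m})) -` (Q \<times> B') \<inter> space M"
    unfolding XB EQ by auto
  then show ?thesis
    using indep_varD[OF indep Q B'] unfolding EQ XB by simp
qed

text \<open>Both the null sets added by the augmentation and the replacement of \<open>W r\<close> by \<open>W r - W 0\<close> are
  invisible up to null sets, and the events with a cylinder version form a \<open>\<sigma>\<close>-algebra.\<close>

lemma filtration_event_ae_cylinder:
  assumes "A \<in> sets (F s)"
  shows "\<exists>A'\<in>sigma_sets (space M) (cylinder_events s). AE \<omega> in M. \<omega> \<in> A \<longleftrightarrow> \<omega> \<in> A'"
  using assms unfolding sets_filtration
proof (induction rule: sigma_sets.induct)
  case (Basic a)
  then show ?case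
  proof
    assume "a \<in> {W r -` B \<inter> space M | r B. r \<in> {0..s} \<and> B \<in> sets borel}"
    then obtain r B where a: "a = W r -` B \<inter> space M" and r: "r \<in> {0..s}" and B: "B \<in> sets borel"
      by blast
    define a' where "a' = {\<omega> \<in> space M. \<forall>r\<in>{r}. W r \<omega> - W 0 \<omega> \<in> B}"
    have "a' \<in> cylinder_events s"
      unfolding cylinder_events_def a'_def using r B
      by (intro CollectI exI[of _ "{r}"] exI[of _ "\<lambda>_. B"]) auto
    moreover have "AE \<omega> in M. W 0 \<omega> = 0"
      using brownian unfolding standard_brownian_motion_def by simp
    then have "AE \<omega> in M. \<omega> \<in> a \<longleftrightarrow> \<omega> \<in> a'"
      by eventually_elim (auto simp: a a'_def)
    ultimately show ?thesis by (blast intro: sigma_sets.Basic)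
  next
    assume "a \<in> null_sets M"
    then have "AE \<omega> in M. \<omega> \<in> a \<longleftrightarrow> \<omega> \<in> {}"
      using AE_not_in by fastforce
    then show ?thesis by (blast intro: sigma_sets.Empty)
  qed
next
  case Empty
  then show ?case by (auto intro!: bexI[of _ "{}"] sigma_sets.Empty)
next
  case (Compl a)
  then obtain a' where a': "a' \<in> sigma_sets (space M) (cylinder_events s)"
    and ae: "AE \<omega> in M. \<omega> \<in> a \<longleftrightarrow> \<omega> \<in> a'" by blast
  from ae have "AE \<omega> in M. \<omega> \<in> space M - a \<longleftrightarrow> \<omega> \<in> space M - a'"
    by eventually_elim auto
  with a' show ?case by (blast intro: sigma_sets.Compl)
next
  case (Union a)
  then obtain a' where a': "\<And>i. a' i \<in> sigma_sets (space M) (cylinder_events s)"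
    and ae: "\<And>i::nat. AE \<omega> in M. \<omega> \<in> a i \<longleftrightarrow> \<omega> \<in> a' i" by metis
  from ae have "AE \<omega> in M. \<forall>i. \<omega> \<in> a i \<longleftrightarrow> \<omega> \<in> a' i"
    unfolding AE_all_countable by blast
  then have "AE \<omega> in M. \<omega> \<in> (\<Union>i. a i) \<longleftrightarrow> \<omega> \<in> (\<Union>i. a' i)"
    by eventually_elim auto
  moreover have "(\<Union>i. a' i) \<in> sigma_sets (space M) (cylinder_events s)"
    using a' by (rule sigma_sets.Union)
  ultimately show ?case by blast
qed

lemma increment_measurable:
  "0 \<le> s \<Longrightarrow> s \<le> u \<Longrightarrow> (\<lambda>\<omega>. W u \<omega> - W s \<omega>) \<in> borel_measurable M"
  using W_measurable by (intro borel_measurable_diff) auto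

lemma increment_independent:
  assumes s: "0 \<le> s" "s < u" and f: "f \<in> measurable (F s) N"
  shows "indep_var N f borel (\<lambda>\<omega>. W u \<omega> - W s \<omega>)"
proof -
  define X where "X = (\<lambda>\<omega>. W u \<omega> - W s \<omega>)"
  have X: "X \<in> borel_measurable M"
    unfolding X_def using s by (intro increment_measurable) auto
  define \<B> where "\<B> = {X -` B \<inter> space M | B. B \<in> sets borel}"
  have \<B>: "\<B> \<subseteq> events"
    using X unfolding \<B>_def by (auto intro: measurable_sets)
  have "Int_stable \<B>"
  proof (rule Int_stableI)
    fix a b assume "a \<in> \<B>" "b \<in> \<B>"
    then obtain A B where AB: "a = X -` A \<inter> space M" "b = X -` B \<inter> space M" "A \<in> sets borel" "B \<in> sets borel"
      unfolding \<B>_def by blast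
    then have "a \<inter> b = X -` (A \<inter> B) \<inter> space M" by auto
    then show "a \<inter> b \<in> \<B>" unfolding \<B>_def using AB by blast
  qed
  moreover have "indep_set (cylinder_events s) \<B>"
    using cylinder_independent_of_increment[OF s] cylinder_events_events \<B>
    by (intro indep_setI) (auto simp: \<B>_def X_def)
  ultimately have ind: "indep_set (sigma_sets (space M) (cylinder_events s)) (sigma_sets (space M) \<B>)"
    using Int_stable_cylinder_events by (intro indep_set_sigma_sets)
  have "indep_set (sets (F s)) (sigma_sets (space M) \<B>)"
  proof (rule indep_setI)
    show "sets (F s) \<subseteq> events" by (rule filtration_subset_events)
    show \<B>': "sigma_sets (space M) \<B> \<subseteq> events" using \<B> by (rule sets.sigma_sets_subset)
    fix a b assume a: "a \<in> sets (F s)" and b: "b \<in> sigma_sets (space M) \<B>"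
    obtain a' where a': "a' \<in> sigma_sets (space M) (cylinder_events s)"
      and ae: "AE \<omega> in M. \<omega> \<in> a \<longleftrightarrow> \<omega> \<in> a'"
      using filtration_event_ae_cylinder[OF a] by blast
    have ev: "a \<in> events" "a' \<in> events" "b \<in> events"
      using a filtration_subset_events a' sets.sigma_sets_subset[OF cylinder_events_events] b \<B>' by auto
    have "prob (a \<inter> b) = prob (a' \<inter> b)"
      using ae ev by (intro measure_eq_AE) auto
    also have "\<dots> = prob a' * prob b"
      by (rule indep_setD[OF ind a' b])
    also have "prob a' = prob a"
      using ae ev by (intro measure_eq_AE) auto
    finally show "prob (a \<inter> b) = prob a * prob b" .
  qed
  moreover have "sigma_sets (space M) {f -` A \<inter> space M | A. A \<in> sets N} \<subseteq> sets (F s)"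
  proof -
    have "{f -` A \<inter> space M | A. A \<in> sets N} \<subseteq> sets (F s)"
      using measurable_sets[OF f] by auto
    then show ?thesis using sets.sigma_sets_subset[of _ "F s"] by simp
  qed
  ultimately have "indep_set (sigma_sets (space M) {f -` A \<inter> space M | A. A \<in> sets N}) (sigma_sets (space M) \<B>)"
    unfolding indep_sets2_eq by blast
  then show ?thesis
    using measurable_filtrationD[OF f] X
    unfolding indep_var_eq \<B>_def X_def by auto
qed

end

section \<open>A discrete change of measure\<close>

text \<open>Completing the square: exponential tilting of a centred normal law is a shift of its mean. All
  Gaussian integrals below are reduced to this.\<close>

lemma normal_density_shift:
  assumes "v > 0"
  shows "normal_density 0 (sqrt v) x * exp (b * x - b\<^sup>2 * v / 2) = normal_density (b * v) (sqrt v) x"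
proof -
  have "- (x - 0)\<^sup>2 / (2 * (sqrt v)\<^sup>2) + (b * x - b\<^sup>2 * v / 2) = - (x - b * v)\<^sup>2 / (2 * (sqrt v)\<^sup>2)"
    using assms by (simp add: field_simps power2_eq_square)
  then show ?thesis
    unfolding normal_density_def mult.assoc by (simp flip: exp_add)
qed

context brownian_space begin

lemma increment_distributed:
  "0 \<le> s \<Longrightarrow> s < u \<Longrightarrow>
    distributed M lborel (\<lambda>\<omega>. W u \<omega> - W s \<omega>) (normal_density 0 (sqrt (u - s)))"
  using brownian unfolding standard_brownian_motion_def by blast

lemma exponential_moments:
  assumes s: "0 \<le> s" "s < u"
  defines "X \<equiv> \<lambda>\<omega>. W u \<omega> - W s \<omega>" and "v \<equiv> u - s"
  shows "integrable M (\<lambda>\<omega>. exp (b * X \<omega> - b\<^sup>2 * v / 2))"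
    and "expectation (\<lambda>\<omega>. exp (b * X \<omega> - b\<^sup>2 * v / 2)) = 1"
    and "integrable M (\<lambda>\<omega>. exp (b * X \<omega> - b\<^sup>2 * v / 2) * (b * v - X \<omega>))"
    and "expectation (\<lambda>\<omega>. exp (b * X \<omega> - b\<^sup>2 * v / 2) * (b * v - X \<omega>)) = 0"
proof -
  have v: "v > 0" using s unfolding v_def by simp
  have X: "distributed M lborel X (normal_density 0 (sqrt v))"
    unfolding X_def v_def using s by (rule increment_distributed)
  have shift: "normal_density 0 (sqrt v) x * exp (b * x - b\<^sup>2 * v / 2) = normal_density (b * v) (sqrt v) x" for x
    using v by (rule normal_density_shift)
  have "0 < sqrt v" using v by simp
  note [simp] = integral_normal_density[OF this] integrable_normal_density[OF this]
  have 1: "normal_density 0 (sqrt v) x * (exp (b * x - b\<^sup>2 * v / 2) * (b * v - x))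
      = - (normal_density (b * v) (sqrt v) x * (x - b * v) ^ (2 * 0 + 1))" for x
    unfolding shift[symmetric] by (simp add: algebra_simps)
  have m: "(\<lambda>x. exp (b * x - b\<^sup>2 * v / 2)) \<in> borel_measurable lborel"
     "(\<lambda>x. exp (b * x - b\<^sup>2 * v / 2) * (b * v - x)) \<in> borel_measurable lborel"
    by measurable
  show "integrable M (\<lambda>\<omega>. exp (b * X \<omega> - b\<^sup>2 * v / 2))"
    using distributed_integrable[OF X m(1)] by (simp add: shift)
  show "expectation (\<lambda>\<omega>. exp (b * X \<omega> - b\<^sup>2 * v / 2)) = 1"
    using distributed_integral[OF X m(1)] by (simp add: shift)
  show "integrable M (\<lambda>\<omega>. exp (b * X \<omega> - b\<^sup>2 * v / 2) * (b * v - X \<omega>))"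
    using distributed_integrable[OF X m(2)] integrable_normal_moment[of "sqrt v" "b * v" "2*0+1"] v
    unfolding 1 by simp
  show "expectation (\<lambda>\<omega>. exp (b * X \<omega> - b\<^sup>2 * v / 2) * (b * v - X \<omega>)) = 0"
    using distributed_integral[OF X m(2)] integral_normal_moment_odd[of "sqrt v" "b * v" "0"] v
    unfolding 1 by simp
qed

text \<open>The square of the exponential with parameter \<open>b\<close> is, up to the factor \<open>exp (b\<^sup>2 v)\<close>, the
  exponential with parameter \<open>2 b\<close>, which has mean one.\<close>

lemma exponential_second_moment:
  assumes s: "0 \<le> s" "s < u"
  defines "X \<equiv> \<lambda>\<omega>. W u \<omega> - W s \<omega>" and "v \<equiv> u - s"
  shows "integrable M (\<lambda>\<omega>. (exp (b * X \<omega> - b\<^sup>2 * v / 2))\<^sup>2)"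
    and "expectation (\<lambda>\<omega>. (exp (b * X \<omega> - b\<^sup>2 * v / 2))\<^sup>2) = exp (b\<^sup>2 * v)"
proof -
  have "(exp (b * x - b\<^sup>2 * v / 2))\<^sup>2 = exp (b\<^sup>2 * v) * exp ((2 * b) * x - (2 * b)\<^sup>2 * v / 2)" for x
    by (simp add: field_simps flip: exp_add exp_of_nat_mult exp_double)
  with exponential_moments(1,2)[OF s, of "2 * b"]
  show "integrable M (\<lambda>\<omega>. (exp (b * X \<omega> - b\<^sup>2 * v / 2))\<^sup>2)"
    "expectation (\<lambda>\<omega>. (exp (b * X \<omega> - b\<^sup>2 * v / 2))\<^sup>2) = exp (b\<^sup>2 * v)"
    unfolding X_def v_def by simp_all
qed

lemma expectation_times_increment_function:
  assumes s: "0 \<le> s" "s < u"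
    and G: "G \<in> borel_measurable (F s)" "integrable M G"
    and h: "h \<in> borel_measurable borel" "integrable M (\<lambda>\<omega>. h (W u \<omega> - W s \<omega>))"
  shows "integrable M (\<lambda>\<omega>. G \<omega> * h (W u \<omega> - W s \<omega>) :: real)"
    and "expectation (\<lambda>\<omega>. G \<omega> * h (W u \<omega> - W s \<omega>)) = expectation G * expectation (\<lambda>\<omega>. h (W u \<omega> - W s \<omega>))"
proof -
  have "indep_var borel (id \<circ> G) borel (h \<circ> (\<lambda>\<omega>. W u \<omega> - W s \<omega>))"
    by (rule indep_var_compose[OF increment_independent[OF s G(1)] _ h(1)]) simp
  then have "indep_var borel G borel (\<lambda>\<omega>. h (W u \<omega> - W s \<omega>))"
    by (simp add: comp_def)
  from indep_var_integrable[OF this G(2) h(2)] indep_var_lebesgue_integral[OF this G(2) h(2)]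
  show "integrable M (\<lambda>\<omega>. G \<omega> * h (W u \<omega> - W s \<omega>))"
    "expectation (\<lambda>\<omega>. G \<omega> * h (W u \<omega> - W s \<omega>)) = expectation G * expectation (\<lambda>\<omega>. h (W u \<omega> - W s \<omega>))"
    by auto
qed

text \<open>The drift \<open>\<plusminus>L\<close> is random but known at time \<open>s\<close>. Splitting \<open>G\<close> according to its sign reduces
  the claim to a deterministic drift, where independence applies.\<close>

lemma expectation_times_signed_increment_function:
  fixes h :: "real \<Rightarrow> real \<Rightarrow> real" and \<zeta> :: "'w \<Rightarrow> real"
  assumes s: "0 \<le> s" "s < u"
    and G: "G \<in> borel_measurable (F s)" "integrable M G"
    and \<zeta>: "\<zeta> \<in> borel_measurable (F s)"
    and h: "\<And>b. h b \<in> borel_measurable borel" "\<And>b. integrable M (\<lambda>\<omega>. h b (W u \<omega> - W s \<omega>))"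
    and c: "\<And>b. b\<^sup>2 = L\<^sup>2 \<Longrightarrow> expectation (\<lambda>\<omega>. h b (W u \<omega> - W s \<omega>)) = c"
  shows "integrable M (\<lambda>\<omega>. G \<omega> * h (if 0 \<le> \<zeta> \<omega> then L else - L) (W u \<omega> - W s \<omega>))"
    and "expectation (\<lambda>\<omega>. G \<omega> * h (if 0 \<le> \<zeta> \<omega> then L else - L) (W u \<omega> - W s \<omega>)) = c * expectation G"
proof -
  define G1 where "G1 = (\<lambda>\<omega>. (if 0 \<le> \<zeta> \<omega> then G \<omega> else 0))"
  define G2 where "G2 = (\<lambda>\<omega>. (if 0 \<le> \<zeta> \<omega> then 0 else G \<omega>))"
  have m: "G1 \<in> borel_measurable (F s)" "G2 \<in> borel_measurable (F s)"
  proof -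
    have "{\<omega> \<in> space (F s). 0 \<le> \<zeta> \<omega>} \<in> sets (F s)"
      using measurable_sets[OF \<zeta>, of "{0..}"] by (simp add: vimage_def Int_def conj_commute)
    then show "G1 \<in> borel_measurable (F s)" "G2 \<in> borel_measurable (F s)"
      unfolding G1_def G2_def using G(1) by (auto intro!: measurable_If)
  qed
  have i: "integrable M G1" "integrable M G2"
    by (rule Bochner_Integration.integrable_bound[OF G(2)];
        use m measurable_filtrationD in \<open>auto simp: G1_def G2_def\<close>)+
  have eq: "G \<omega> * h (if 0 \<le> \<zeta> \<omega> then L else - L) (W u \<omega> - W s \<omega>) =
      G1 \<omega> * h L (W u \<omega> - W s \<omega>) + G2 \<omega> * h (- L) (W u \<omega> - W s \<omega>)" for \<omega>
    unfolding G1_def G2_def by simp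
  note a = expectation_times_increment_function[OF s m(1) i(1) h, of L]
  note b = expectation_times_increment_function[OF s m(2) i(2) h, of "- L"]
  show "integrable M (\<lambda>\<omega>. G \<omega> * h (if 0 \<le> \<zeta> \<omega> then L else - L) (W u \<omega> - W s \<omega>))"
    unfolding eq using a(1) b(1) by (rule Bochner_Integration.integrable_add)
  have "expectation G = expectation (\<lambda>\<omega>. G1 \<omega> + G2 \<omega>)"
    by (rule Bochner_Integration.integral_cong) (auto simp: G1_def G2_def)
  also have "\<dots> = expectation G1 + expectation G2"
    using i by (rule Bochner_Integration.integral_add)
  finally show "expectation (\<lambda>\<omega>. G \<omega> * h (if 0 \<le> \<zeta> \<omega> then L else - L) (W u \<omega> - W s \<omega>)) = c * expectation G"
    unfolding eq Bochner_Integration.integral_add[OF a(1) b(1)] a(2) b(2) c[OF refl] c[OF power2_minus]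
    by (simp add: algebra_simps)
qed

text \<open>The Girsanov density for the drift \<open>L sgn \<zeta>\<close>, with the convention \<open>sgn 0 = 1\<close>: the drift must
  have modulus \<open>L\<close> everywhere, so that the second moment of the density is known exactly.\<close>

definition step_density :: "real \<Rightarrow> (nat \<Rightarrow> real) \<Rightarrow> (nat \<Rightarrow> 'w \<Rightarrow> real) \<Rightarrow> nat \<Rightarrow> 'w \<Rightarrow> real" where
  "step_density L \<tau> \<zeta> n \<omega> = (\<Prod>j<n. exp ((if 0 \<le> \<zeta> j \<omega> then L else - L) * (W (\<tau> (Suc j)) \<omega> - W (\<tau> j) \<omega>)
      - (if 0 \<le> \<zeta> j \<omega> then L else - L)\<^sup>2 * (\<tau> (Suc j) - \<tau> j) / 2))"

lemma step_density_nonneg: "0 \<le> step_density L \<tau> \<zeta> n \<omega>"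
  unfolding step_density_def by (intro prod_nonneg) simp

context
  fixes L m :: real and N :: nat and \<tau> :: "nat \<Rightarrow> real" and \<zeta> :: "nat \<Rightarrow> 'w \<Rightarrow> real"
    and \<eta> :: "'w \<Rightarrow> real"
  assumes \<tau>0: "0 \<le> \<tau> 0" and \<tau>_less: "\<And>i. i < N \<Longrightarrow> \<tau> i < \<tau> (Suc i)"
    and \<zeta>: "\<And>i. i < N \<Longrightarrow> \<zeta> i \<in> borel_measurable (F (\<tau> i))"
    and \<zeta>_bounded: "\<And>i. i < N \<Longrightarrow> bounded (\<zeta> i ` space M)"
    and \<eta>: "\<eta> \<in> borel_measurable (F (\<tau> 0))" and \<eta>_bounded: "\<And>\<omega>. \<bar>\<eta> \<omega>\<bar> \<le> m"
begin

lemma grid_mono: "i \<le> j \<Longrightarrow> j \<le> N \<Longrightarrow> \<tau> i \<le> \<tau> j"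
proof (induction rule: dec_induct)
  case (step n)
  then show ?case using \<tau>_less[of n] by simp
qed simp

lemma grid_nonneg: "j \<le> N \<Longrightarrow> 0 \<le> \<tau> j"
  using grid_mono[of 0 j] \<tau>0 by simp

lemma step_density_measurable: "n \<le> N \<Longrightarrow> step_density L \<tau> \<zeta> n \<in> borel_measurable (F (\<tau> n))"
  unfolding step_density_def
proof (intro borel_measurable_prod)
  fix j assume "n \<le> N" "j \<in> {..<n}"
  then have "\<zeta> j \<in> borel_measurable (F (\<tau> n))" "W (\<tau> j) \<in> borel_measurable (F (\<tau> n))"
      "W (\<tau> (Suc j)) \<in> borel_measurable (F (\<tau> n))"
    using grid_mono[of j n] grid_mono[of "Suc j" n] grid_nonneg
    by (auto intro!: W_adapted measurable_filtration_mono[OF \<zeta>])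
  then show "(\<lambda>\<omega>. exp ((if 0 \<le> \<zeta> j \<omega> then L else - L) * (W (\<tau> (Suc j)) \<omega> - W (\<tau> j) \<omega>)
      - (if 0 \<le> \<zeta> j \<omega> then L else - L)\<^sup>2 * (\<tau> (Suc j) - \<tau> j) / 2)) \<in> borel_measurable (F (\<tau> n))"
    by measurable
qed

lemma \<eta>_measurable: "n \<le> N \<Longrightarrow> \<eta> \<in> borel_measurable (F (\<tau> n))"
  using measurable_filtration_mono[OF \<eta>] grid_mono[of 0 n] by simp

lemma step_density_integral:
  assumes "n \<le> N"
  shows "integrable M (\<lambda>\<omega>. \<eta> \<omega> * step_density L \<tau> \<zeta> n \<omega>) \<and>
    expectation (\<lambda>\<omega>. \<eta> \<omega> * step_density L \<tau> \<zeta> n \<omega>) = expectation \<eta>"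
  using assms
proof (induction n)
  case 0
  have "integrable M \<eta>"
    using measurable_filtrationD[OF \<eta>] \<eta>_bounded by (intro integrable_const_bound[of _ m]) auto
  then show ?case by (simp add: step_density_def)
next
  case (Suc n)
  define G where "G = (\<lambda>\<omega>. \<eta> \<omega> * step_density L \<tau> \<zeta> n \<omega>)"
  have s: "0 \<le> \<tau> n" "\<tau> n < \<tau> (Suc n)" using Suc.prems grid_nonneg \<tau>_less by auto
  have G: "G \<in> borel_measurable (F (\<tau> n))" "integrable M G"
    unfolding G_def using Suc step_density_measurable[of n] \<eta>_measurable[of n] by auto
  have eq: "\<eta> \<omega> * step_density L \<tau> \<zeta> (Suc n) \<omega> = G \<omega> * exp ((if 0 \<le> \<zeta> n \<omega> then L else - L) * (W (\<tau> (Suc n)) \<omega> - W (\<tau> n) \<omega>)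
      - (if 0 \<le> \<zeta> n \<omega> then L else - L)\<^sup>2 * (\<tau> (Suc n) - \<tau> n) / 2)" for \<omega>
    unfolding G_def step_density_def by (simp add: mult.assoc)
  have **: "expectation G = expectation \<eta>"
    using Suc by (simp add: G_def)
  show ?case
    unfolding eq
  proof (intro conjI)
    let ?h = "\<lambda>b x. exp (b * x - b\<^sup>2 * (\<tau> (Suc n) - \<tau> n) / 2)"
    note * = expectation_times_signed_increment_function[OF s G \<zeta>, of ?h L 1,
        OF _ _ exponential_moments(1,2)[OF s]]
    show "integrable M (\<lambda>\<omega>. G \<omega> * ?h (if 0 \<le> \<zeta> n \<omega> then L else - L) (W (\<tau> (Suc n)) \<omega> - W (\<tau> n) \<omega>))"
      by (rule *) (use Suc.prems in auto)
    have "expectation (\<lambda>\<omega>. G \<omega> * ?h (if 0 \<le> \<zeta> n \<omega> then L else - L) (W (\<tau> (Suc n)) \<omega> - W (\<tau> n) \<omega>)) = 1 * expectation G"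
      by (rule *) (use Suc.prems in auto)
    then show "expectation (\<lambda>\<omega>. G \<omega> * ?h (if 0 \<le> \<zeta> n \<omega> then L else - L) (W (\<tau> (Suc n)) \<omega> - W (\<tau> n) \<omega>)) = expectation \<eta>"
      unfolding ** by simp
  qed
qed

text \<open>The growth factor depends on \<open>L\<close> and on the length of the time interval, but not on the grid or
  on \<open>\<zeta>\<close>. This uniformity makes the approximation argument work.\<close>

lemma step_density_second_moment:
  assumes "n \<le> N"
  shows "integrable M (\<lambda>\<omega>. (\<eta> \<omega> * step_density L \<tau> \<zeta> n \<omega>)\<^sup>2) \<and>
    expectation (\<lambda>\<omega>. (\<eta> \<omega> * step_density L \<tau> \<zeta> n \<omega>)\<^sup>2) = exp (L\<^sup>2 * (\<tau> n - \<tau> 0)) * expectation (\<lambda>\<omega>. (\<eta> \<omega>)\<^sup>2)"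
  using assms
proof (induction n)
  case 0
  have "\<bar>(\<eta> \<omega>)\<^sup>2\<bar> \<le> m\<^sup>2" for \<omega>
    using power_mono[OF \<eta>_bounded[of \<omega>], of 2] by simp
  then have "integrable M (\<lambda>\<omega>. (\<eta> \<omega>)\<^sup>2)"
    using measurable_filtrationD[OF \<eta>] by (intro integrable_const_bound[of _ "m\<^sup>2"]) auto
  then show ?case by (simp add: step_density_def)
next
  case (Suc n)
  define G where "G = (\<lambda>\<omega>. (\<eta> \<omega> * step_density L \<tau> \<zeta> n \<omega>)\<^sup>2)"
  have s: "0 \<le> \<tau> n" "\<tau> n < \<tau> (Suc n)" using Suc.prems grid_nonneg \<tau>_less by auto
  have G: "G \<in> borel_measurable (F (\<tau> n))" "integrable M G"
    unfolding G_def using Suc step_density_measurable[of n] \<eta>_measurable[of n] by auto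
  have eq: "(\<eta> \<omega> * step_density L \<tau> \<zeta> (Suc n) \<omega>)\<^sup>2 = G \<omega> * (exp ((if 0 \<le> \<zeta> n \<omega> then L else - L) * (W (\<tau> (Suc n)) \<omega> - W (\<tau> n) \<omega>)
      - (if 0 \<le> \<zeta> n \<omega> then L else - L)\<^sup>2 * (\<tau> (Suc n) - \<tau> n) / 2))\<^sup>2" for \<omega>
    unfolding G_def step_density_def by (simp add: mult.assoc power_mult_distrib)
  have *: "exp (L\<^sup>2 * (\<tau> (Suc n) - \<tau> n)) * exp (L\<^sup>2 * (\<tau> n - \<tau> 0)) = exp (L\<^sup>2 * (\<tau> (Suc n) - \<tau> 0))"
    by (simp add: algebra_simps flip: exp_add)
  have **: "expectation G = exp (L\<^sup>2 * (\<tau> n - \<tau> 0)) * expectation (\<lambda>\<omega>. (\<eta> \<omega>)\<^sup>2)"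
    using Suc by (simp add: G_def)
  show ?case
    unfolding eq
  proof (intro conjI)
    let ?h = "\<lambda>b x. (exp (b * x - b\<^sup>2 * (\<tau> (Suc n) - \<tau> n) / 2))\<^sup>2"
    let ?c = "exp (L\<^sup>2 * (\<tau> (Suc n) - \<tau> n))"
    have "expectation (\<lambda>\<omega>. ?h b (W (\<tau> (Suc n)) \<omega> - W (\<tau> n) \<omega>)) = ?c" if "b\<^sup>2 = L\<^sup>2" for b
      using exponential_second_moment(2)[OF s, of b] unfolding that .
    note 1 = expectation_times_signed_increment_function[OF s G \<zeta>, of ?h L ?c,
        OF _ _ exponential_second_moment(1)[OF s] this]
    show "integrable M (\<lambda>\<omega>. G \<omega> * ?h (if 0 \<le> \<zeta> n \<omega> then L else - L) (W (\<tau> (Suc n)) \<omega> - W (\<tau> n) \<omega>))"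
      by (rule 1) (use Suc.prems in auto)
    have "expectation (\<lambda>\<omega>. G \<omega> * ?h (if 0 \<le> \<zeta> n \<omega> then L else - L) (W (\<tau> (Suc n)) \<omega> - W (\<tau> n) \<omega>)) = ?c * expectation G"
      by (rule 1) (use Suc.prems in auto)
    then show "expectation (\<lambda>\<omega>. G \<omega> * ?h (if 0 \<le> \<zeta> n \<omega> then L else - L) (W (\<tau> (Suc n)) \<omega> - W (\<tau> n) \<omega>)) =
        exp (L\<^sup>2 * (\<tau> (Suc n) - \<tau> 0)) * expectation (\<lambda>\<omega>. (\<eta> \<omega>)\<^sup>2)"
      unfolding ** *[symmetric] by simp
  qed
qed

text \<open>Under the new measure an increment has mean \<open>b v\<close>, where \<open>b = L sgn \<zeta>\<close>; since
  \<open>L \<bar>\<zeta>\<bar> = b \<zeta>\<close>, each summand \<open>L \<bar>\<zeta>\<bar> v - \<zeta> X = \<zeta> (b v - X)\<close> is centred given the past.\<close>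

lemma step_density_orthogonal:
  assumes "n \<le> N"
  shows "integrable M (\<lambda>\<omega>. \<eta> \<omega> * step_density L \<tau> \<zeta> n \<omega> *
      (\<Sum>j<n. L * \<bar>\<zeta> j \<omega>\<bar> * (\<tau> (Suc j) - \<tau> j) - \<zeta> j \<omega> * (W (\<tau> (Suc j)) \<omega> - W (\<tau> j) \<omega>))) \<and>
    expectation (\<lambda>\<omega>. \<eta> \<omega> * step_density L \<tau> \<zeta> n \<omega> *
      (\<Sum>j<n. L * \<bar>\<zeta> j \<omega>\<bar> * (\<tau> (Suc j) - \<tau> j) - \<zeta> j \<omega> * (W (\<tau> (Suc j)) \<omega> - W (\<tau> j) \<omega>))) = 0"
  using assms
proof (induction n)
  case 0
  then show ?case by simp
next
  case (Suc n)
  define S where "S n \<omega> = (\<Sum>j<n. L * \<bar>\<zeta> j \<omega>\<bar> * (\<tau> (Suc j) - \<tau> j) - \<zeta> j \<omega> * (W (\<tau> (Suc j)) \<omega> - W (\<tau> j) \<omega>))" for n \<omega>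
  define G where "G = (\<lambda>\<omega>. \<eta> \<omega> * step_density L \<tau> \<zeta> n \<omega> * S n \<omega>)"
  define H where "H = (\<lambda>\<omega>. \<eta> \<omega> * step_density L \<tau> \<zeta> n \<omega> * \<zeta> n \<omega>)"
  define v where "v = \<tau> (Suc n) - \<tau> n"
  define X where "X = (\<lambda>\<omega>. W (\<tau> (Suc n)) \<omega> - W (\<tau> n) \<omega>)"
  define b where "b = (\<lambda>\<omega>. (if 0 \<le> \<zeta> n \<omega> then L else - L))"
  have s: "0 \<le> \<tau> n" "\<tau> n < \<tau> (Suc n)" using Suc.prems grid_nonneg \<tau>_less by auto
  have n: "n \<le> N" "n < N" using Suc.prems by auto
  have "S n \<in> borel_measurable (F (\<tau> n))"
    unfolding S_def
  proof (intro borel_measurable_sum)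
    fix j assume "j \<in> {..<n}"
    then have "\<zeta> j \<in> borel_measurable (F (\<tau> n))" "W (\<tau> j) \<in> borel_measurable (F (\<tau> n))"
        "W (\<tau> (Suc j)) \<in> borel_measurable (F (\<tau> n))"
      using grid_mono[of j n] grid_mono[of "Suc j" n] grid_nonneg n
      by (auto intro!: W_adapted measurable_filtration_mono[OF \<zeta>])
    then show "(\<lambda>\<omega>. L * \<bar>\<zeta> j \<omega>\<bar> * (\<tau> (Suc j) - \<tau> j) - \<zeta> j \<omega> * (W (\<tau> (Suc j)) \<omega> - W (\<tau> j) \<omega>)) \<in> borel_measurable (F (\<tau> n))"
      by measurable
  qed
  then have G: "G \<in> borel_measurable (F (\<tau> n))"
    unfolding G_def using n step_density_measurable[of n] \<eta>_measurable[of n] by auto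
  have Gi: "integrable M G"
    unfolding G_def S_def using Suc n by auto
  have Hm: "H \<in> borel_measurable (F (\<tau> n))"
    unfolding H_def using n \<zeta>[of n] step_density_measurable[of n] \<eta>_measurable[of n] by auto
  obtain B where B: "\<And>\<omega>. \<omega> \<in> space M \<Longrightarrow> \<bar>\<zeta> n \<omega>\<bar> \<le> B"
    using \<zeta>_bounded[OF n(2)] unfolding bounded_iff by auto
  have Hi: "integrable M H"
  proof (rule Bochner_Integration.integrable_bound)
    show "integrable M (\<lambda>\<omega>. B * (\<eta> \<omega> * step_density L \<tau> \<zeta> n \<omega>))"
      using step_density_integral[OF n(1)] by simp
    show "H \<in> borel_measurable M" using Hm by (rule measurable_filtrationD)
    have "norm (H \<omega>) \<le> norm (B * (\<eta> \<omega> * step_density L \<tau> \<zeta> n \<omega>))" if "\<omega> \<in> space M" for \<omega>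
      using mult_right_mono[OF order_trans[OF B[OF that] abs_ge_self], of "\<bar>\<eta> \<omega> * step_density L \<tau> \<zeta> n \<omega>\<bar>"]
      by (simp add: H_def abs_mult mult_ac)
    then show "AE \<omega> in M. norm (H \<omega>) \<le> norm (B * (\<eta> \<omega> * step_density L \<tau> \<zeta> n \<omega>))" by simp
  qed
  \<comment> \<open>This identity is the reason for the choice of the sign of the drift.\<close>
  have abs_\<zeta>: "L * \<bar>\<zeta> n \<omega>\<bar> = \<zeta> n \<omega> * b \<omega>" for \<omega>
    unfolding b_def by auto
  have "\<eta> \<omega> * step_density L \<tau> \<zeta> (Suc n) \<omega> * S (Suc n) \<omega> =
     \<eta> \<omega> * (step_density L \<tau> \<zeta> n \<omega> * exp (b \<omega> * X \<omega> - (b \<omega>)\<^sup>2 * v / 2)) * (S n \<omega> + (L * \<bar>\<zeta> n \<omega>\<bar> * v - \<zeta> n \<omega> * X \<omega>))" for \<omega>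
    unfolding step_density_def S_def b_def v_def X_def by simp
  then have eq: "\<eta> \<omega> * step_density L \<tau> \<zeta> (Suc n) \<omega> * S (Suc n) \<omega> =
      G \<omega> * exp (b \<omega> * X \<omega> - (b \<omega>)\<^sup>2 * v / 2) +
      H \<omega> * (exp (b \<omega> * X \<omega> - (b \<omega>)\<^sup>2 * v / 2) * (b \<omega> * v - X \<omega>))" for \<omega>
    unfolding G_def H_def abs_\<zeta> by (simp only: algebra_simps)
  note 1 = expectation_times_signed_increment_function[OF s G Gi \<zeta>[OF n(2)], of
       "\<lambda>b x. exp (b * x - b\<^sup>2 * (\<tau> (Suc n) - \<tau> n) / 2)" L 1, OF _ exponential_moments(1,2)[OF s]]
  note 2 = expectation_times_signed_increment_function[OF s Hm Hi \<zeta>[OF n(2)], of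
       "\<lambda>b x. exp (b * x - b\<^sup>2 * (\<tau> (Suc n) - \<tau> n) / 2) * (b * (\<tau> (Suc n) - \<tau> n) - x)" L 0,
       OF _ exponential_moments(3,4)[OF s]]
  have i: "integrable M (\<lambda>\<omega>. G \<omega> * exp (b \<omega> * X \<omega> - (b \<omega>)\<^sup>2 * v / 2))"
     "integrable M (\<lambda>\<omega>. H \<omega> * (exp (b \<omega> * X \<omega> - (b \<omega>)\<^sup>2 * v / 2) * (b \<omega> * v - X \<omega>)))"
    unfolding b_def X_def v_def by (rule 1 2; measurable)+
  have e: "expectation (\<lambda>\<omega>. G \<omega> * exp (b \<omega> * X \<omega> - (b \<omega>)\<^sup>2 * v / 2)) = 1 * expectation G"
     "expectation (\<lambda>\<omega>. H \<omega> * (exp (b \<omega> * X \<omega> - (b \<omega>)\<^sup>2 * v / 2) * (b \<omega> * v - X \<omega>))) = 0 * expectation H"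
    unfolding b_def X_def v_def by (rule 1 2; measurable)+
  have "expectation G = 0" unfolding G_def S_def using Suc n by simp
  then show ?case
    unfolding S_def[symmetric] eq using Bochner_Integration.integrable_add[OF i] Bochner_Integration.integral_add[OF i] e
    by simp
qed

end

end

section \<open>Common refinement of step processes\<close>

text \<open>The approximations of the two stochastic integrals come with unrelated grids. Their difference
  has to be written as one step process, on a strictly increasing grid containing both, because the
  one-step Gaussian computations need increments of positive length.\<close>

lemma borel_measurable_vec_nth:
  "f \<in> borel_measurable N \<Longrightarrow> (\<lambda>x. f x $ c :: real) \<in> borel_measurable N"
  by (rule measurable_compose[OF _ borel_measurable_continuous_onI[of "\<lambda>x. x $ c"]]) (auto intro: continuous_intros)

lemma grid_le:
  fixes \<tau> :: "nat \<Rightarrow> real"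
  assumes "\<And>i. i < N \<Longrightarrow> \<tau> i \<le> \<tau> (Suc i)" "p \<le> q" "q \<le> N"
  shows "\<tau> p \<le> \<tau> q"
  using assms(2,3)
proof (induction rule: dec_induct)
  case (step n)
  then show ?case using assms(1)[of n] by simp
qed simp

lemma sum_indicator_grid:
  fixes \<sigma> :: "nat \<Rightarrow> real"
  assumes "\<And>i. i < K \<Longrightarrow> \<sigma> i \<le> \<sigma> (Suc i)"
  shows "(\<Sum>j<K. indicator {\<sigma> j<..\<sigma> (Suc j)} s) = (indicator {\<sigma> 0<..\<sigma> K} s :: real)"
  using assms
proof (induction K)
  case (Suc K)
  have "\<sigma> 0 \<le> \<sigma> K"
    using grid_le[of "Suc K" \<sigma> 0 K] Suc.prems by simp
  with Suc.prems[of K] have "indicator {\<sigma> 0<..\<sigma> K} s + indicator {\<sigma> K<..\<sigma> (Suc K)} s = (indicator {\<sigma> 0<..\<sigma> (Suc K)} s :: real)"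
    by (fastforce simp: indicator_def)
  then show ?case using Suc by simp
qed simp

lemma abs_step_sum:
  fixes \<sigma> :: "nat \<Rightarrow> real" and \<zeta> :: "nat \<Rightarrow> real"
  assumes "\<And>i. i < K \<Longrightarrow> \<sigma> i \<le> \<sigma> (Suc i)"
  shows "\<bar>\<Sum>j<K. indicator {\<sigma> j<..\<sigma> (Suc j)} s * \<zeta> j\<bar> = (\<Sum>j<K. indicator {\<sigma> j<..\<sigma> (Suc j)} s * \<bar>\<zeta> j\<bar>)"
  using assms
proof (induction K)
  case (Suc K)
  show ?case
  proof (cases "s \<in> {\<sigma> K<..\<sigma> (Suc K)}")
    case True
    have "\<sigma> i \<le> \<sigma> K" if "i \<le> K" for i
      using grid_le[of "Suc K" \<sigma> i K] that Suc.prems by simp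
    then have "\<sigma> (Suc j) \<le> \<sigma> K" if "j < K" for j
      using that by simp
    then have "indicator {\<sigma> j<..\<sigma> (Suc j)} s = (0::real)" if "j < K" for j
      using that True by (force simp: indicator_def)
    then show ?thesis using True by simp
  next
    case False
    then show ?thesis using Suc by simp
  qed
qed simp

text \<open>A telescoping sum up to a grid point, with the range of summation expressed through the values of
  the grid instead of its indices. The indicator of an interval between two grid points is a
  difference of two such conditions.\<close>

lemma sum_increments_below:
  fixes \<sigma> :: "nat \<Rightarrow> real" and f :: "real \<Rightarrow> real"
  assumes "\<And>i j. i < j \<Longrightarrow> j \<le> K \<Longrightarrow> \<sigma> i < \<sigma> j" and "p \<le> K"
  shows "(\<Sum>j<K. of_bool (\<sigma> (Suc j) \<le> \<sigma> p) * (f (\<sigma> (Suc j)) - f (\<sigma> j))) = f (\<sigma> p) - f (\<sigma> 0)"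
proof -
  have iff: "\<sigma> (Suc j) \<le> \<sigma> p \<longleftrightarrow> j < p" if "j < K" for j
    using assms(1)[of "Suc j" p] assms(1)[of p "Suc j"] assms(2) that
    by (cases "Suc j" p rule: linorder_cases) auto
  have "(\<Sum>j<K. of_bool (\<sigma> (Suc j) \<le> \<sigma> p) * (f (\<sigma> (Suc j)) - f (\<sigma> j))) =
      (\<Sum>j<K. if j < p then f (\<sigma> (Suc j)) - f (\<sigma> j) else 0)"
    by (rule sum.cong) (auto simp: iff)
  also have "\<dots> = (\<Sum>j\<in>{..<K} \<inter> {..<p}. f (\<sigma> (Suc j)) - f (\<sigma> j))"
    by (simp add: sum.inter_restrict)
  also have "{..<K} \<inter> {..<p} = {..<p}" using assms(2) by auto
  also have "(\<Sum>j<p. f (\<sigma> (Suc j)) - f (\<sigma> j)) = f (\<sigma> p) - f (\<sigma> 0)"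
    by (rule sum_lessThan_telescope)
  finally show ?thesis .
qed

text \<open>On a cell of the finer grid \<open>\<sigma>\<close> the step process over \<open>\<tau>\<close> is constant, so its value at the
  right end point, \<open>step_process N \<tau> \<xi> (\<sigma> (Suc j))\<close>, serves as the coefficient of the cell.\<close>

context
  fixes \<sigma> :: "nat \<Rightarrow> real" and K N :: nat and \<tau> :: "nat \<Rightarrow> real"
    and \<xi> :: "nat \<Rightarrow> 'w \<Rightarrow> 'b::euclidean_space"
  assumes \<sigma>: "\<And>i j. i < j \<Longrightarrow> j \<le> K \<Longrightarrow> \<sigma> i < \<sigma> j"
    and refines: "\<tau> ` {..N} \<subseteq> \<sigma> ` {..K}"
    and ends: "\<sigma> 0 = \<tau> 0" "\<sigma> K = \<tau> N"
    and \<tau>: "\<And>i. i < N \<Longrightarrow> \<tau> i \<le> \<tau> (Suc i)"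
begin

lemma grid_point_less_iff:
  assumes "i \<le> N" "j < K" "s \<in> {\<sigma> j<..\<sigma> (Suc j)}"
  shows "\<tau> i < s \<longleftrightarrow> \<tau> i < \<sigma> (Suc j)"
proof -
  obtain k where k: "k \<le> K" "\<tau> i = \<sigma> k" using refines assms(1) by blast
  show ?thesis
  proof (cases "k \<le> j")
    case True
    then have "\<sigma> k \<le> \<sigma> j" using \<sigma>[of k j] assms(2) by (cases "k = j") auto
    then show ?thesis using assms(3) k by auto
  next
    case False
    then have "\<sigma> (Suc j) \<le> \<sigma> k" using \<sigma>[of "Suc j" k] k by (cases "k = Suc j") auto
    then show ?thesis using assms(3) k by auto
  qed
qed

lemma step_process_const:
  assumes "j < K" "s \<in> {\<sigma> j<..\<sigma> (Suc j)}"
  shows "step_process N \<tau> \<xi> s \<omega> = step_process N \<tau> \<xi> (\<sigma> (Suc j)) \<omega>"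
proof -
  have "indicator {\<tau> i<..\<tau> (Suc i)} s = (indicator {\<tau> i<..\<tau> (Suc i)} (\<sigma> (Suc j)) :: real)" if "i < N" for i
    using grid_point_less_iff[of i, OF _ assms] grid_point_less_iff[of "Suc i", OF _ assms] that
    by (auto simp: indicator_def not_le[symmetric])
  then show ?thesis unfolding step_process_def by (intro sum.cong) auto
qed

lemma step_process_refine:
  "step_process K \<sigma> (\<lambda>j. step_process N \<tau> \<xi> (\<sigma> (Suc j))) s \<omega> = step_process N \<tau> \<xi> s \<omega>"
proof -
  have "step_process K \<sigma> (\<lambda>j. step_process N \<tau> \<xi> (\<sigma> (Suc j))) s \<omega> =
      (\<Sum>j<K. indicator {\<sigma> j<..\<sigma> (Suc j)} s *\<^sub>R step_process N \<tau> \<xi> s \<omega>)"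
    unfolding step_process_def[of K]
  proof (intro sum.cong refl)
    fix j assume "j \<in> {..<K}"
    then show "indicat_real {\<sigma> j<..\<sigma> (Suc j)} s *\<^sub>R step_process N \<tau> \<xi> (\<sigma> (Suc j)) \<omega> =
        indicator {\<sigma> j<..\<sigma> (Suc j)} s *\<^sub>R step_process N \<tau> \<xi> s \<omega>"
      using step_process_const[of j s \<omega>] by (cases "s \<in> {\<sigma> j<..\<sigma> (Suc j)}") simp_all
  qed
  also have "\<dots> = indicator {\<sigma> 0<..\<sigma> K} s *\<^sub>R step_process N \<tau> \<xi> s \<omega>"
    unfolding scaleR_sum_left[symmetric] by (subst sum_indicator_grid) (use \<sigma> in \<open>auto intro: less_imp_le\<close>)
  also have "\<dots> = (\<Sum>i<N. (indicator {\<tau> 0<..\<tau> N} s * indicator {\<tau> i<..\<tau> (Suc i)} s) *\<^sub>R \<xi> i \<omega>)"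
    unfolding step_process_def ends by (simp only: scaleR_sum_right scaleR_scaleR)
  also have "\<dots> = step_process N \<tau> \<xi> s \<omega>"
    unfolding step_process_def
  proof (intro sum.cong refl arg_cong2[of _ _ _ _ scaleR])
    fix i assume i: "i \<in> {..<N}"
    from grid_le[of N \<tau> 0 i] grid_le[of N \<tau> "Suc i" N] \<tau> i
    show "indicator {\<tau> 0<..\<tau> N} s * indicator {\<tau> i<..\<tau> (Suc i)} s = (indicator {\<tau> i<..\<tau> (Suc i)} s :: real)"
      by (auto simp: indicator_def)
  qed
  finally show ?thesis .
qed

lemma step_ito_integral_refine:
  "step_ito_integral W K \<sigma> (\<lambda>j. step_process N \<tau> \<xi> (\<sigma> (Suc j))) \<omega> = step_ito_integral W N \<tau> \<xi> \<omega>"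
proof -
  have inner: "(\<Sum>j<K. (W (\<sigma> (Suc j)) \<omega> - W (\<sigma> j) \<omega>) * indicator {\<tau> i<..\<tau> (Suc i)} (\<sigma> (Suc j))) =
      W (\<tau> (Suc i)) \<omega> - W (\<tau> i) \<omega>" if i: "i < N" for i
  proof -
    have "\<tau> i \<in> \<sigma> ` {..K}" "\<tau> (Suc i) \<in> \<sigma> ` {..K}"
      using refines i by (auto simp: image_subset_iff)
    then obtain p q where p: "p \<le> K" "\<tau> i = \<sigma> p" and q: "q \<le> K" "\<tau> (Suc i) = \<sigma> q" by auto
    have ind: "indicator {\<tau> i<..\<tau> (Suc i)} x = (of_bool (x \<le> \<sigma> q) - of_bool (x \<le> \<sigma> p) :: real)" for x
      using \<tau>[OF i] p q by (auto simp: indicator_def)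
    then have "(\<Sum>j<K. (W (\<sigma> (Suc j)) \<omega> - W (\<sigma> j) \<omega>) * indicator {\<tau> i<..\<tau> (Suc i)} (\<sigma> (Suc j))) =
       (\<Sum>j<K. of_bool (\<sigma> (Suc j) \<le> \<sigma> q) * (W (\<sigma> (Suc j)) \<omega> - W (\<sigma> j) \<omega>)) -
       (\<Sum>j<K. of_bool (\<sigma> (Suc j) \<le> \<sigma> p) * (W (\<sigma> (Suc j)) \<omega> - W (\<sigma> j) \<omega>))"
      unfolding sum_subtractf[symmetric] by (intro sum.cong refl) (simp add: ind algebra_simps)
    also have "\<dots> = (W (\<sigma> q) \<omega> - W (\<sigma> 0) \<omega>) - (W (\<sigma> p) \<omega> - W (\<sigma> 0) \<omega>)"
      using sum_increments_below[where f = "\<lambda>r. W r \<omega>" and \<sigma> = \<sigma>, OF \<sigma> p(1)]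
        sum_increments_below[where f = "\<lambda>r. W r \<omega>" and \<sigma> = \<sigma>, OF \<sigma> q(1)] by simp
    finally show ?thesis using p q by simp
  qed
  have "step_ito_integral W K \<sigma> (\<lambda>j. step_process N \<tau> \<xi> (\<sigma> (Suc j))) \<omega> =
     (\<Sum>j<K. \<Sum>i<N. ((W (\<sigma> (Suc j)) \<omega> - W (\<sigma> j) \<omega>) * indicator {\<tau> i<..\<tau> (Suc i)} (\<sigma> (Suc j))) *\<^sub>R \<xi> i \<omega>)"
    unfolding step_ito_integral_def step_process_def by (simp only: scaleR_sum_right scaleR_scaleR)
  also have "\<dots> = (\<Sum>i<N. (\<Sum>j<K. (W (\<sigma> (Suc j)) \<omega> - W (\<sigma> j) \<omega>) * indicator {\<tau> i<..\<tau> (Suc i)} (\<sigma> (Suc j))) *\<^sub>R \<xi> i \<omega>)"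
    by (subst sum.swap) (simp only: scaleR_sum_left)
  also have "\<dots> = step_ito_integral W N \<tau> \<xi> \<omega>"
    unfolding step_ito_integral_def by (intro sum.cong refl) (simp only: inner lessThan_iff)
  finally show ?thesis .
qed

end

lemma common_strict_grid:
  fixes \<tau>0 \<tau>1 :: "nat \<Rightarrow> real"
  assumes "\<tau>0 0 = a" "\<tau>0 N0 = b" "\<And>i. i < N0 \<Longrightarrow> \<tau>0 i \<le> \<tau>0 (Suc i)"
    and "\<tau>1 0 = a" "\<tau>1 N1 = b" "\<And>i. i < N1 \<Longrightarrow> \<tau>1 i \<le> \<tau>1 (Suc i)"
  obtains \<sigma> :: "nat \<Rightarrow> real" and K where "\<sigma> 0 = a" "\<sigma> K = b" "\<forall>i j. i < j \<longrightarrow> j \<le> K \<longrightarrow> \<sigma> i < \<sigma> j"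
    "\<tau>0 ` {..N0} \<subseteq> \<sigma> ` {..K}" "\<tau>1 ` {..N1} \<subseteq> \<sigma> ` {..K}"
proof -
  define A where "A = \<tau>0 ` {..N0} \<union> \<tau>1 ` {..N1}"
  define xs where "xs = sorted_list_of_set A"
  define K where "K = length xs - 1"
  have fin: "finite A" unfolding A_def by simp
  have set_xs: "set xs = A" and sorted: "sorted_wrt (<) xs"
    unfolding xs_def using fin by auto
  have len: "length xs = Suc K"
    using set_xs unfolding K_def A_def by (cases xs) auto
  have less: "xs ! i < xs ! j" if "i < j" "j \<le> K" for i j
    using sorted that len by (simp add: sorted_wrt_iff_nth_less)
  have "set xs = (!) xs ` {..<length xs}"
    by (auto simp: set_conv_nth)
  then have img: "(!) xs ` {..K} = A"
    unfolding set_xs len lessThan_Suc_atMost by simp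
  have bounds: "a \<le> x" "x \<le> b" if "x \<in> A" for x
    using that grid_le[of N0 \<tau>0 0] grid_le[of N0 \<tau>0 _ N0] grid_le[of N1 \<tau>1 0] grid_le[of N1 \<tau>1 _ N1] assms
    unfolding A_def by auto
  have "a \<in> A" "b \<in> A" unfolding A_def using assms by (auto intro: rev_image_eqI)
  then obtain i j where i: "i \<le> K" "xs ! i = a" and j: "j \<le> K" "xs ! j = b"
    unfolding img[symmetric] by auto
  have "xs ! 0 = a"
    using less[of 0 i] i bounds(1)[of "xs ! 0"] img by (cases "i = 0") force+
  moreover have "xs ! K = b"
    using less[of j K] j bounds(2)[of "xs ! K"] img by (cases "j = K") force+
  ultimately show ?thesis
    using that[of "(!) xs" K] less unfolding img A_def by blast
qed

context brownian_space begin

text \<open>The coefficient of a cell is evaluated at its right end point, but only those \<open>\<xi> i\<close> contribute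
  whose interval begins before that point, hence not after \<open>\<sigma> j\<close>; this gives measurability at the
  left end point.\<close>

lemma adapted_step_refine:
  fixes \<xi> :: "nat \<Rightarrow> 'w \<Rightarrow> 'b::euclidean_space" and \<sigma> :: "nat \<Rightarrow> real"
  assumes step: "adapted_step M F a b N \<tau> \<xi>"
    and \<sigma>: "\<And>i j. i < j \<Longrightarrow> j \<le> K \<Longrightarrow> \<sigma> i < \<sigma> j" "\<tau> ` {..N} \<subseteq> \<sigma> ` {..K}" "\<sigma> 0 = a" "\<sigma> K = b"
    and "j < K"
  shows "step_process N \<tau> \<xi> (\<sigma> (Suc j)) \<in> borel_measurable (F (\<sigma> j))"
    and "bounded (step_process N \<tau> \<xi> (\<sigma> (Suc j)) ` space M)"
proof -
  note st = step[unfolded adapted_step_def]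
  have less: "\<tau> i \<le> \<sigma> j" if "i < N" "\<tau> i < \<sigma> (Suc j)" for i
  proof -
    have "\<tau> i \<in> \<sigma> ` {..K}" using \<sigma>(2) that by (auto simp: image_subset_iff)
    then obtain k where k: "k \<le> K" "\<tau> i = \<sigma> k" by auto
    then have "k \<le> j" using \<sigma>(1)[of "Suc j" k] that by (cases "Suc j" k rule: linorder_cases) auto
    then show ?thesis using k \<sigma>(1)[of k j] assms(6) by (cases "k = j") auto
  qed
  show "step_process N \<tau> \<xi> (\<sigma> (Suc j)) \<in> borel_measurable (F (\<sigma> j))"
    unfolding step_process_def
  proof (intro borel_measurable_sum)
    fix i assume "i \<in> {..<N}"
    then show "(\<lambda>\<omega>. indicat_real {\<tau> i<..\<tau> (Suc i)} (\<sigma> (Suc j)) *\<^sub>R \<xi> i \<omega>) \<in> borel_measurable (F (\<sigma> j))"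
      using measurable_filtration_mono[of "\<xi> i" "\<tau> i" borel "\<sigma> j"] less[of i] st
      by (cases "\<tau> i < \<sigma> (Suc j)") auto
  qed
  have "bounded ((\<lambda>\<omega>. \<Sum>i<n. indicat_real {\<tau> i<..\<tau> (Suc i)} (\<sigma> (Suc j)) *\<^sub>R \<xi> i \<omega>) ` space M)" if "n \<le> N" for n
    using that
  proof (induction n)
    case (Suc n)
    have "bounded ((\<lambda>x. indicat_real {\<tau> n<..\<tau> (Suc n)} (\<sigma> (Suc j)) *\<^sub>R x) ` \<xi> n ` space M)"
      by (rule bounded_scaling) (use st Suc.prems in auto)
    then show ?case
      using Suc bounded_plus_comp by (auto simp: image_image)
  qed (auto simp: image_constant_conv)
  then show "bounded (step_process N \<tau> \<xi> (\<sigma> (Suc j)) ` space M)"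
    unfolding step_process_def[abs_def] by simp
qed

lemma step_difference_component:
  fixes \<xi>0 \<xi>1 :: "nat \<Rightarrow> 'w \<Rightarrow> real^'n"
  assumes s0: "adapted_step M F a b N0 \<tau>0 \<xi>0" and s1: "adapted_step M F a b N1 \<tau>1 \<xi>1"
  obtains K and \<sigma> :: "nat \<Rightarrow> real" and \<zeta> :: "nat \<Rightarrow> 'w \<Rightarrow> real" where "\<And>i. i < K \<Longrightarrow> \<sigma> i < \<sigma> (Suc i)" "adapted_step M F a b K \<sigma> \<zeta>"
    "\<And>s \<omega>. step_process K \<sigma> \<zeta> s \<omega> = (step_process N0 \<tau>0 \<xi>0 s \<omega> - step_process N1 \<tau>1 \<xi>1 s \<omega>) $ c"
    "\<And>\<omega>. step_ito_integral W K \<sigma> \<zeta> \<omega> = (step_ito_integral W N0 \<tau>0 \<xi>0 \<omega> - step_ito_integral W N1 \<tau>1 \<xi>1 \<omega>) $ c"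
proof -
  have st0: "\<tau>0 0 = a" "\<tau>0 N0 = b" "\<And>i. i < N0 \<Longrightarrow> \<tau>0 i \<le> \<tau>0 (Suc i)"
    and st1: "\<tau>1 0 = a" "\<tau>1 N1 = b" "\<And>i. i < N1 \<Longrightarrow> \<tau>1 i \<le> \<tau>1 (Suc i)"
    using s0 s1 unfolding adapted_step_def by blast+
  obtain \<sigma> :: "nat \<Rightarrow> real" and K where \<sigma>0: "\<sigma> 0 = a" and \<sigma>K: "\<sigma> K = b"
    and less': "\<forall>i j. i < j \<longrightarrow> j \<le> K \<longrightarrow> \<sigma> i < \<sigma> j"
    and sub: "\<tau>0 ` {..N0} \<subseteq> \<sigma> ` {..K}" "\<tau>1 ` {..N1} \<subseteq> \<sigma> ` {..K}"
    by (rule common_strict_grid[OF st0 st1])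
  have less: "\<sigma> i < \<sigma> j" if "i < j" "j \<le> K" for i j
    using less' that by blast
  have ends: "\<sigma> 0 = \<tau>0 0" "\<sigma> K = \<tau>0 N0" "\<sigma> 0 = \<tau>1 0" "\<sigma> K = \<tau>1 N1"
    unfolding \<sigma>0 \<sigma>K st0 st1 by simp_all
  define \<zeta> where "\<zeta> j \<omega> = (step_process N0 \<tau>0 \<xi>0 (\<sigma> (Suc j)) \<omega> - step_process N1 \<tau>1 \<xi>1 (\<sigma> (Suc j)) \<omega>) $ c" for j \<omega>
  note refine = step_process_refine[OF less sub(1) ends(1,2) st0(3), symmetric]
    step_process_refine[OF less sub(2) ends(3,4) st1(3), symmetric]
  note refine_ito = step_ito_integral_refine[OF less sub(1) ends(1,2) st0(3), symmetric]
    step_ito_integral_refine[OF less sub(2) ends(3,4) st1(3), symmetric]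
  show ?thesis
  proof (rule that)
    show "\<sigma> i < \<sigma> (Suc i)" if "i < K" for i using less that by simp
    then show "adapted_step M F a b K \<sigma> \<zeta>"
      unfolding adapted_step_def
    proof (intro conjI allI impI)
      fix i assume i: "i < K"
      note r0 = adapted_step_refine[OF s0 less sub(1) \<sigma>0 \<sigma>K i] and r1 = adapted_step_refine[OF s1 less sub(2) \<sigma>0 \<sigma>K i]
      show "\<zeta> i \<in> borel_measurable (F (\<sigma> i))"
        unfolding \<zeta>_def[abs_def] using r0(1) r1(1)
        by (intro borel_measurable_vec_nth borel_measurable_diff)
      have "bounded ((\<lambda>x. x $ c) ` (\<lambda>\<omega>. step_process N0 \<tau>0 \<xi>0 (\<sigma> (Suc i)) \<omega> - step_process N1 \<tau>1 \<xi>1 (\<sigma> (Suc i)) \<omega>) ` space M)"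
        by (intro bounded_component_cart bounded_minus_comp r0(2) r1(2))
      then show "bounded (\<zeta> i ` space M)"
        unfolding \<zeta>_def[abs_def] by (simp add: image_image)
    qed (use \<sigma>0 \<sigma>K less in \<open>auto intro: less_imp_le\<close>)
    show "step_process K \<sigma> \<zeta> s \<omega> = (step_process N0 \<tau>0 \<xi>0 s \<omega> - step_process N1 \<tau>1 \<xi>1 s \<omega>) $ c" for s \<omega>
    proof -
      have "step_process N0 \<tau>0 \<xi>0 s \<omega> = step_process K \<sigma> (\<lambda>j. step_process N0 \<tau>0 \<xi>0 (\<sigma> (Suc j))) s \<omega>"
        by (rule refine(1))
      moreover have "step_process N1 \<tau>1 \<xi>1 s \<omega> = step_process K \<sigma> (\<lambda>j. step_process N1 \<tau>1 \<xi>1 (\<sigma> (Suc j))) s \<omega>"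
        by (rule refine(2))
      ultimately show ?thesis
        by (simp add: step_process_def[of K] \<zeta>_def sum_subtractf right_diff_distrib)
    qed
    show "step_ito_integral W K \<sigma> \<zeta> \<omega> = (step_ito_integral W N0 \<tau>0 \<xi>0 \<omega> - step_ito_integral W N1 \<tau>1 \<xi>1 \<omega>) $ c" for \<omega>
    proof -
      have "step_ito_integral W N0 \<tau>0 \<xi>0 \<omega> = step_ito_integral W K \<sigma> (\<lambda>j. step_process N0 \<tau>0 \<xi>0 (\<sigma> (Suc j))) \<omega>"
        by (rule refine_ito(1))
      moreover have "step_ito_integral W N1 \<tau>1 \<xi>1 \<omega> = step_ito_integral W K \<sigma> (\<lambda>j. step_process N1 \<tau>1 \<xi>1 (\<sigma> (Suc j))) \<omega>"
        by (rule refine_ito(2))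
      ultimately show ?thesis
        by (simp add: step_ito_integral_def[of W K] \<zeta>_def sum_subtractf right_diff_distrib)
    qed
  qed
qed

end

section \<open>The one-dimensional estimate\<close>

text \<open>Processes are only measurable on a time interval. Extended by zero, after clamping the time to
  the interval, they become measurable on the whole line, where the product measure theorems apply.\<close>

lemma borel_measurable_extend_interval:
  fixes X :: "real \<Rightarrow> 'w \<Rightarrow> 'b::{real_normed_vector, second_countable_topology}"
  assumes X: "(\<lambda>(s, \<omega>). X s \<omega>) \<in> borel_measurable (restrict_space borel {a..b} \<Otimes>\<^sub>M N)" and "a \<le> b"
  shows "(\<lambda>(s, \<omega>). indicator {a..b} s *\<^sub>R X s \<omega>) \<in> borel_measurable (borel \<Otimes>\<^sub>M N)"
proof -
  define c where "c s = max a (min b s)" for s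
  have "c \<in> borel_measurable borel" unfolding c_def by measurable
  then have c: "c \<in> measurable borel (restrict_space borel {a..b})"
    using \<open>a \<le> b\<close> by (intro measurable_restrict_space2) (auto simp: c_def)
  have "(\<lambda>p. (c (fst p), snd p)) \<in> measurable (borel \<Otimes>\<^sub>M N) (restrict_space borel {a..b} \<Otimes>\<^sub>M N)"
    by (intro measurable_Pair measurable_compose[OF measurable_fst c] measurable_snd)
  from measurable_compose[OF this X]
  have "(\<lambda>p. X (c (fst p)) (snd p)) \<in> borel_measurable (borel \<Otimes>\<^sub>M N)"
    by simp
  moreover have "(\<lambda>p. indicator {a..b} (fst p) :: real) \<in> borel_measurable (borel \<Otimes>\<^sub>M N)"
    by (rule measurable_compose[OF measurable_fst]) simp
  ultimately have "(\<lambda>p. indicator {a..b} (fst p) *\<^sub>R X (c (fst p)) (snd p)) \<in> borel_measurable (borel \<Otimes>\<^sub>M N)"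
    by (rule borel_measurable_scaleR[rotated])
  moreover have "(\<lambda>(s, \<omega>). indicator {a..b} s *\<^sub>R X s \<omega>) = (\<lambda>p. indicator {a..b} (fst p) *\<^sub>R X (c (fst p)) (snd p))"
    by (auto simp: fun_eq_iff indicator_def c_def)
  ultimately show ?thesis by simp
qed

lemma square_integral_le:
  fixes h :: "real \<Rightarrow> real"
  assumes h: "h \<in> borel_measurable lborel" and zero: "\<And>x. x \<notin> {a..b} \<Longrightarrow> h x = 0" and "a \<le> b"
    and fin: "(\<integral>\<^sup>+x. ennreal ((h x)\<^sup>2) \<partial>lborel) < \<infinity>"
  shows "integrable lborel h"
    and "ennreal ((\<integral>x. \<bar>h x\<bar> \<partial>lborel)\<^sup>2) \<le> ennreal (b - a) * (\<integral>\<^sup>+x. ennreal ((h x)\<^sup>2) \<partial>lborel)"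
proof -
  have "(\<integral>\<^sup>+x. ennreal \<bar>h x\<bar> * indicator {a..b} x \<partial>lborel)\<^sup>2
      \<le> (\<integral>\<^sup>+x. (ennreal \<bar>h x\<bar>)\<^sup>2 \<partial>lborel) * (\<integral>\<^sup>+x. (indicator {a..b} x)\<^sup>2 \<partial>lborel)"
    using h by (intro Cauchy_Schwarz_nn_integral) auto
  also have "(\<integral>\<^sup>+x. (indicator {a..b} x)\<^sup>2 \<partial>lborel) = (\<integral>\<^sup>+x. indicator {a..b} x \<partial>lborel)"
    by (rule nn_integral_cong) (simp add: indicator_def)
  also have "\<dots> = ennreal (b - a)"
    using \<open>a \<le> b\<close> by simp
  also have "(\<integral>\<^sup>+x. (ennreal \<bar>h x\<bar>)\<^sup>2 \<partial>lborel) = (\<integral>\<^sup>+x. ennreal ((h x)\<^sup>2) \<partial>lborel)"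
    by (simp add: ennreal_power)
  also have "(\<integral>\<^sup>+x. ennreal \<bar>h x\<bar> * indicator {a..b} x \<partial>lborel) = (\<integral>\<^sup>+x. ennreal (norm (h x)) \<partial>lborel)"
    by (rule nn_integral_cong) (use zero in \<open>auto simp: indicator_def\<close>)
  finally have cs: "(\<integral>\<^sup>+x. ennreal (norm (h x)) \<partial>lborel)\<^sup>2 \<le> ennreal (b - a) * (\<integral>\<^sup>+x. ennreal ((h x)\<^sup>2) \<partial>lborel)"
    by (simp add: mult.commute)
  also have "\<dots> < \<infinity>" using fin by (simp add: ennreal_mult_less_top)
  finally have "(\<integral>\<^sup>+x. ennreal (norm (h x)) \<partial>lborel) < \<infinity>"
    by (simp add: power_less_top_ennreal)
  with h show int: "integrable lborel h" unfolding integrable_iff_bounded by blast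
  have "(\<integral>\<^sup>+x. ennreal (norm (h x)) \<partial>lborel) = ennreal (\<integral>x. \<bar>h x\<bar> \<partial>lborel)"
    using nn_integral_eq_integral[OF integrable_norm[OF int]] by simp
  with cs show "ennreal ((\<integral>x. \<bar>h x\<bar> \<partial>lborel)\<^sup>2) \<le> ennreal (b - a) * (\<integral>\<^sup>+x. ennreal ((h x)\<^sup>2) \<partial>lborel)"
    by (simp add: ennreal_power)
qed

text \<open>Cauchy-Schwarz, stated so that it also covers a function \<open>f\<close> that is not integrable: the
  right-hand side is then infinite, which is why \<open>a < b\<close> is required.\<close>

lemma abs_integral_difference_square:
  fixes f g :: "real \<Rightarrow> real"
  assumes f: "f \<in> borel_measurable lborel" and g: "integrable lborel g"
    and zero: "\<And>x. x \<notin> {a..b} \<Longrightarrow> f x = 0" "\<And>x. x \<notin> {a..b} \<Longrightarrow> g x = 0" and "a < b"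
  shows "ennreal (((\<integral>x. \<bar>f x\<bar> \<partial>lborel) - (\<integral>x. \<bar>g x\<bar> \<partial>lborel))\<^sup>2)
    \<le> ennreal (b - a) * (\<integral>\<^sup>+x. ennreal ((g x - f x)\<^sup>2) \<partial>lborel)"
proof (cases "(\<integral>\<^sup>+x. ennreal ((g x - f x)\<^sup>2) \<partial>lborel) < \<infinity>")
  case True
  define h where "h x = g x - f x" for x
  have h: "h \<in> borel_measurable lborel" "\<And>x. x \<notin> {a..b} \<Longrightarrow> h x = 0"
    unfolding h_def using f g zero by auto
  have fin: "(\<integral>\<^sup>+x. ennreal ((h x)\<^sup>2) \<partial>lborel) < \<infinity>"
    using True unfolding h_def .
  note sq = square_integral_le[OF h less_imp_le[OF \<open>a < b\<close>] fin]
  have "integrable lborel (\<lambda>x. g x - h x)" using g sq(1) by auto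
  then have fi: "integrable lborel f" by (simp add: h_def)
  have "\<bar>(\<integral>x. \<bar>f x\<bar> \<partial>lborel) - (\<integral>x. \<bar>g x\<bar> \<partial>lborel)\<bar> = \<bar>\<integral>x. \<bar>f x\<bar> - \<bar>g x\<bar> \<partial>lborel\<bar>"
    using fi g by (simp add: Bochner_Integration.integral_diff)
  also have "\<dots> \<le> (\<integral>x. \<bar>\<bar>f x\<bar> - \<bar>g x\<bar>\<bar> \<partial>lborel)"
    by (rule integral_abs_bound)
  also have "\<dots> \<le> (\<integral>x. \<bar>h x\<bar> \<partial>lborel)"
    using fi g sq(1) by (intro integral_mono) (auto simp: h_def)
  finally have "((\<integral>x. \<bar>f x\<bar> \<partial>lborel) - (\<integral>x. \<bar>g x\<bar> \<partial>lborel))\<^sup>2 \<le> (\<integral>x. \<bar>h x\<bar> \<partial>lborel)\<^sup>2"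
    using power_mono[of "\<bar>(\<integral>x. \<bar>f x\<bar> \<partial>lborel) - (\<integral>x. \<bar>g x\<bar> \<partial>lborel)\<bar>" _ 2] by simp
  then have "ennreal (((\<integral>x. \<bar>f x\<bar> \<partial>lborel) - (\<integral>x. \<bar>g x\<bar> \<partial>lborel))\<^sup>2) \<le> ennreal ((\<integral>x. \<bar>h x\<bar> \<partial>lborel)\<^sup>2)"
    by (rule ennreal_leI)
  also note sq(2)
  finally show ?thesis unfolding h_def .
next
  case False
  then have "(\<integral>\<^sup>+x. ennreal ((g x - f x)\<^sup>2) \<partial>lborel) = \<infinity>"
    by (metis infinity_ennreal_def top.not_eq_extremum)
  then show ?thesis using \<open>a < b\<close> by (simp add: ennreal_mult_top)
qed

lemma integral_abs_step_process:
  fixes \<sigma> :: "nat \<Rightarrow> real" and \<zeta> :: "nat \<Rightarrow> 'w \<Rightarrow> real"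
  assumes "\<And>i. i < K \<Longrightarrow> \<sigma> i \<le> \<sigma> (Suc i)"
  shows "integrable lborel (\<lambda>s. step_process K \<sigma> \<zeta> s \<omega>)"
    and "(\<integral>s. \<bar>step_process K \<sigma> \<zeta> s \<omega>\<bar> \<partial>lborel) = (\<Sum>j<K. \<bar>\<zeta> j \<omega>\<bar> * (\<sigma> (Suc j) - \<sigma> j))"
proof -
  have i: "has_bochner_integral lborel (\<lambda>s. indicator {\<sigma> j<..\<sigma> (Suc j)} s * c) (c * (\<sigma> (Suc j) - \<sigma> j))"
    if "j < K" for j and c :: real
    using has_bochner_integral_mult_left[OF has_bochner_integral_real_indicator[of "{\<sigma> j<..\<sigma> (Suc j)}" lborel], of c] assms[OF that]
    by (simp add: mult.commute)
  show "integrable lborel (\<lambda>s. step_process K \<sigma> \<zeta> s \<omega>)"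
    unfolding step_process_def real_scaleR_def
    by (intro Bochner_Integration.integrable_sum integrable.intros[OF i]) auto
  have "has_bochner_integral lborel (\<lambda>s. \<Sum>j<K. indicator {\<sigma> j<..\<sigma> (Suc j)} s * \<bar>\<zeta> j \<omega>\<bar>) (\<Sum>j<K. \<bar>\<zeta> j \<omega>\<bar> * (\<sigma> (Suc j) - \<sigma> j))"
    by (rule has_bochner_integral_sum) (use i in auto)
  moreover have "\<bar>step_process K \<sigma> \<zeta> s \<omega>\<bar> = (\<Sum>j<K. indicator {\<sigma> j<..\<sigma> (Suc j)} s * \<bar>\<zeta> j \<omega>\<bar>)" for s
    unfolding step_process_def real_scaleR_def by (rule abs_step_sum) (rule assms)
  ultimately show "(\<integral>s. \<bar>step_process K \<sigma> \<zeta> s \<omega>\<bar> \<partial>lborel) = (\<Sum>j<K. \<bar>\<zeta> j \<omega>\<bar> * (\<sigma> (Suc j) - \<sigma> j))"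
    by (simp only: has_bochner_integral_integral_eq)
qed

context brownian_space begin

lemma step_ito_integral_measurable:
  fixes \<xi> :: "nat \<Rightarrow> 'w \<Rightarrow> 'b::euclidean_space"
  assumes a: "0 \<le> a" and step: "adapted_step M F a b N \<tau> \<xi>"
  shows "step_ito_integral W N \<tau> \<xi> \<in> borel_measurable M"
  unfolding step_ito_integral_def
proof (intro borel_measurable_sum borel_measurable_scaleR borel_measurable_diff)
  note st = step[unfolded adapted_step_def]
  fix i assume i: "i \<in> {..<N}"
  have "0 \<le> \<tau> j" if "j \<le> N" for j
    using grid_le[of N \<tau> 0 j] st that a by simp
  then show "W (\<tau> (Suc i)) \<in> borel_measurable M" "W (\<tau> i) \<in> borel_measurable M"
    using i by (auto intro!: W_measurable)
  show "\<xi> i \<in> borel_measurable M"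
    using st i by (auto intro: measurable_filtrationD)
qed

text \<open>The duality argument. Test the inequality for \<open>U\<close> against \<open>\<eta> \<Gamma>\<close>, where \<open>\<eta> = min m U\<^sup>+\<close> is known at
  time \<open>t\<close> and \<open>\<Gamma>\<close> is the density for the drift \<open>L sgn \<zeta>\<close>. The martingale property turns the left-hand
  side into at least \<open>E \<eta>\<^sup>2\<close>, the step part is centred, and Young's inequality absorbs half of
  \<open>E \<eta>\<^sup>2\<close>. Truncating at \<open>m\<close> makes all these expectations finite.\<close>

lemma step_positive_part_estimate:
  assumes t: "0 \<le> t"
    and step: "adapted_step M F t T K \<sigma> \<zeta>" and less: "\<And>i. i < K \<Longrightarrow> \<sigma> i < \<sigma> (Suc i)"
    and U: "U \<in> borel_measurable (F t)" and \<Psi>: "\<Psi> \<in> borel_measurable M" and "0 \<le> m"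
    and le: "AE \<omega> in M. 0 < U \<omega> \<longrightarrow> U \<omega> \<le> \<Psi> \<omega> + L * (\<integral>s. \<bar>step_process K \<sigma> \<zeta> s \<omega>\<bar> \<partial>lborel) - step_ito_integral W K \<sigma> \<zeta> \<omega>"
  shows "(\<integral>\<^sup>+\<omega>. ennreal ((min m (max 0 (U \<omega>)))\<^sup>2) \<partial>M) \<le> ennreal (exp (L\<^sup>2 * (T - t))) * (\<integral>\<^sup>+\<omega>. ennreal ((\<Psi> \<omega>)\<^sup>2) \<partial>M)"
proof (cases "(\<integral>\<^sup>+\<omega>. ennreal ((\<Psi> \<omega>)\<^sup>2) \<partial>M) < \<infinity>")
  case False
  then have "(\<integral>\<^sup>+\<omega>. ennreal ((\<Psi> \<omega>)\<^sup>2) \<partial>M) = \<infinity>"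
    by (metis infinity_ennreal_def top.not_eq_extremum)
  then show ?thesis by (simp add: ennreal_mult_top)
next
  case True
  define \<eta> where "\<eta> = (\<lambda>\<omega>. min m (max 0 (U \<omega>)))"
  define \<Gamma> where "\<Gamma> = step_density L \<sigma> \<zeta> K"
  define S where "S = (\<lambda>\<omega>. (\<Sum>j<K. L * \<bar>\<zeta> j \<omega>\<bar> * (\<sigma> (Suc j) - \<sigma> j) - \<zeta> j \<omega> * (W (\<sigma> (Suc j)) \<omega> - W (\<sigma> j) \<omega>)))"
  define q where "q = exp (L\<^sup>2 * (T - t))"
  have q: "q > 0" unfolding q_def by simp
  note st = step[unfolded adapted_step_def]
  have ends: "\<sigma> 0 = t" "\<sigma> K = T" and \<zeta>: "\<And>i. i < K \<Longrightarrow> \<zeta> i \<in> borel_measurable (F (\<sigma> i))"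
    "\<And>i. i < K \<Longrightarrow> bounded (\<zeta> i ` space M)"
    using st by auto
  have \<sigma>0: "0 \<le> \<sigma> 0" using ends t by simp
  have \<eta>: "\<eta> \<in> borel_measurable (F (\<sigma> 0))" unfolding \<eta>_def ends using U by measurable
  have \<eta>_nonneg: "0 \<le> \<eta> \<omega>" and \<eta>_le: "\<eta> \<omega> \<le> m" for \<omega> unfolding \<eta>_def using \<open>0 \<le> m\<close> by auto
  have \<eta>2: "(\<lambda>\<omega>. (\<eta> \<omega>)\<^sup>2) \<in> borel_measurable (F (\<sigma> 0))" using \<eta> by measurable
  have b: "\<bar>\<eta> \<omega>\<bar> \<le> m" "\<bar>(\<eta> \<omega>)\<^sup>2\<bar> \<le> m\<^sup>2" for \<omega>
    using \<eta>_nonneg[of \<omega>] \<eta>_le[of \<omega>] power_mono[of "\<eta> \<omega>" m 2] by auto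
  have d1: "integrable M (\<lambda>\<omega>. (\<eta> \<omega>)\<^sup>2 * \<Gamma> \<omega>) \<and>
      expectation (\<lambda>\<omega>. (\<eta> \<omega>)\<^sup>2 * \<Gamma> \<omega>) = expectation (\<lambda>\<omega>. (\<eta> \<omega>)\<^sup>2)"
    unfolding \<Gamma>_def
    by (rule step_density_integral[where N = K and m = "m\<^sup>2"]) (use \<sigma>0 less \<zeta> \<eta>2 b(2) in auto)
  have d2: "integrable M (\<lambda>\<omega>. (\<eta> \<omega> * \<Gamma> \<omega>)\<^sup>2) \<and>
      expectation (\<lambda>\<omega>. (\<eta> \<omega> * \<Gamma> \<omega>)\<^sup>2) = exp (L\<^sup>2 * (\<sigma> K - \<sigma> 0)) * expectation (\<lambda>\<omega>. (\<eta> \<omega>)\<^sup>2)"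
    unfolding \<Gamma>_def
    by (rule step_density_second_moment[where N = K and m = m]) (use \<sigma>0 less \<zeta> \<eta> b(1) in auto)
  note d2 = d2[unfolded ends, folded q_def]
  have d3: "integrable M (\<lambda>\<omega>. \<eta> \<omega> * \<Gamma> \<omega> * S \<omega>) \<and> expectation (\<lambda>\<omega>. \<eta> \<omega> * \<Gamma> \<omega> * S \<omega>) = 0"
    unfolding \<Gamma>_def S_def
    by (rule step_density_orthogonal[where N = K and m = m]) (use \<sigma>0 less \<zeta> \<eta> b(1) in auto)
  have \<Psi>2: "integrable M (\<lambda>\<omega>. (\<Psi> \<omega>)\<^sup>2)"
    using True \<Psi> by (simp add: integrable_iff_bounded)
  have \<Gamma>: "0 \<le> \<Gamma> \<omega>" for \<omega> unfolding \<Gamma>_def by (rule step_density_nonneg)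
  have S: "L * (\<integral>s. \<bar>step_process K \<sigma> \<zeta> s \<omega>\<bar> \<partial>lborel) - step_ito_integral W K \<sigma> \<zeta> \<omega> = S \<omega>" for \<omega>
  proof -
    have "(\<integral>s. \<bar>step_process K \<sigma> \<zeta> s \<omega>\<bar> \<partial>lborel) = (\<Sum>j<K. \<bar>\<zeta> j \<omega>\<bar> * (\<sigma> (Suc j) - \<sigma> j))"
      by (rule integral_abs_step_process(2)) (rule less_imp_le[OF less])
    then show ?thesis
      unfolding S_def step_ito_integral_def by (simp add: sum_distrib_left sum_subtractf mult_ac)
  qed
  \<comment> \<open>Young's inequality with the weight that matches the second moment of the density\<close>
  have young: "\<eta> \<omega> * \<Gamma> \<omega> * \<Psi> \<omega> \<le> inverse q / 2 * (\<eta> \<omega> * \<Gamma> \<omega>)\<^sup>2 + q / 2 * (\<Psi> \<omega>)\<^sup>2" for \<omega>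
  proof -
    have "0 \<le> inverse q / 2 * (\<eta> \<omega> * \<Gamma> \<omega> - q * \<Psi> \<omega>)\<^sup>2" using q by simp
    also have "\<dots> = inverse q / 2 * (\<eta> \<omega> * \<Gamma> \<omega>)\<^sup>2 + q / 2 * (\<Psi> \<omega>)\<^sup>2 - \<eta> \<omega> * \<Gamma> \<omega> * \<Psi> \<omega>"
      using q by (simp add: power2_eq_square field_simps)
    finally show ?thesis by simp
  qed
  have "AE \<omega> in M. (\<eta> \<omega>)\<^sup>2 * \<Gamma> \<omega> \<le> inverse q / 2 * (\<eta> \<omega> * \<Gamma> \<omega>)\<^sup>2 + q / 2 * (\<Psi> \<omega>)\<^sup>2 + \<eta> \<omega> * \<Gamma> \<omega> * S \<omega>"
    using le
  proof eventually_elim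
    case (elim \<omega>)
    show ?case
    proof (cases "0 < U \<omega>")
      case True
      then have "\<eta> \<omega> \<le> \<Psi> \<omega> + S \<omega>" using elim S[of \<omega>] unfolding \<eta>_def by simp
      then have "\<eta> \<omega> * \<Gamma> \<omega> * \<eta> \<omega> \<le> \<eta> \<omega> * \<Gamma> \<omega> * (\<Psi> \<omega> + S \<omega>)"
        using \<eta>_nonneg \<Gamma> by (intro mult_left_mono) auto
      with young[of \<omega>] show ?thesis by (simp add: power2_eq_square algebra_simps)
    next
      case False
      then have "\<eta> \<omega> = 0" unfolding \<eta>_def using \<open>0 \<le> m\<close> by auto
      then show ?thesis using young[of \<omega>] by simp
    qed
  qed
  then have "expectation (\<lambda>\<omega>. (\<eta> \<omega>)\<^sup>2 * \<Gamma> \<omega>) \<le>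
      expectation (\<lambda>\<omega>. inverse q / 2 * (\<eta> \<omega> * \<Gamma> \<omega>)\<^sup>2 + q / 2 * (\<Psi> \<omega>)\<^sup>2 + \<eta> \<omega> * \<Gamma> \<omega> * S \<omega>)"
    using d1 d2 d3 \<Psi>2 by (intro integral_mono_AE) auto
  also have "\<dots> = inverse q / 2 * (q * expectation (\<lambda>\<omega>. (\<eta> \<omega>)\<^sup>2)) + q / 2 * expectation (\<lambda>\<omega>. (\<Psi> \<omega>)\<^sup>2)"
    using d2 d3 \<Psi>2 by simp
  also have "inverse q / 2 * (q * expectation (\<lambda>\<omega>. (\<eta> \<omega>)\<^sup>2)) = expectation (\<lambda>\<omega>. (\<eta> \<omega>)\<^sup>2) / 2"
    using q by simp
  finally have *: "expectation (\<lambda>\<omega>. (\<eta> \<omega>)\<^sup>2) \<le> q * expectation (\<lambda>\<omega>. (\<Psi> \<omega>)\<^sup>2)"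
    using d1 by simp
  have \<eta>i: "integrable M (\<lambda>\<omega>. (\<eta> \<omega>)\<^sup>2)"
    using measurable_filtrationD[OF \<eta>2] b(2) by (intro integrable_const_bound[of _ "m\<^sup>2"]) auto
  have "(\<integral>\<^sup>+\<omega>. ennreal ((\<eta> \<omega>)\<^sup>2) \<partial>M) = ennreal (expectation (\<lambda>\<omega>. (\<eta> \<omega>)\<^sup>2))"
    using \<eta>i by (intro nn_integral_eq_integral) auto
  also have "\<dots> \<le> ennreal (q * expectation (\<lambda>\<omega>. (\<Psi> \<omega>)\<^sup>2))"
    using * by (rule ennreal_leI)
  also have "\<dots> = ennreal q * (\<integral>\<^sup>+\<omega>. ennreal ((\<Psi> \<omega>)\<^sup>2) \<partial>M)"
    using \<Psi>2 q by (subst nn_integral_eq_integral) (auto simp: ennreal_mult)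
  finally show ?thesis unfolding \<eta>_def q_def .
qed

text \<open>Replacing \<open>\<zeta>\<close> by an approximating step process changes the right-hand side by an error that is
  small in \<open>L\<^sup>2\<close>; the previous lemma is insensitive to the grid, so the error vanishes in the limit.
  The truncation level tends to infinity afterwards.\<close>

lemma positive_part_estimate:
  assumes t: "0 \<le> t" "t < T"
    and step: "\<And>k. adapted_step M F t T (K k) (\<sigma> k) (z k)" "\<And>k i. i < K k \<Longrightarrow> \<sigma> k i < \<sigma> k (Suc i)"
    and conv: "(\<lambda>k. \<integral>\<^sup>+\<omega>. (\<integral>\<^sup>+s\<in>{t..T}. ennreal ((step_process (K k) (\<sigma> k) (z k) s \<omega> - \<zeta> s \<omega>)\<^sup>2) \<partial>lborel) \<partial>M) \<longlonglongrightarrow> 0"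
      "(\<lambda>k. \<integral>\<^sup>+\<omega>. ennreal ((step_ito_integral W (K k) (\<sigma> k) (z k) \<omega> - J \<omega>)\<^sup>2) \<partial>M) \<longlonglongrightarrow> 0"
    and \<zeta>: "(\<lambda>(s, \<omega>). \<zeta> s \<omega>) \<in> borel_measurable (restrict_space borel {t..T} \<Otimes>\<^sub>M M)"
    and J: "J \<in> borel_measurable M"
    and U: "U \<in> borel_measurable (F t)" and \<Phi>: "\<Phi> \<in> borel_measurable M"
    and le: "AE \<omega> in M. 0 < U \<omega> \<longrightarrow> U \<omega> \<le> \<Phi> \<omega> + L * (LBINT s:{t..T}. \<bar>\<zeta> s \<omega>\<bar>) - J \<omega>"
  shows "(\<integral>\<^sup>+\<omega>. ennreal ((max 0 (U \<omega>))\<^sup>2) \<partial>M) \<le> ennreal (3 * exp (L\<^sup>2 * (T - t))) * (\<integral>\<^sup>+\<omega>. ennreal ((\<Phi> \<omega>)\<^sup>2) \<partial>M)"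
proof -
  define f where "f \<omega> s = indicator {t..T} s * \<zeta> s \<omega>" for \<omega> s
  define I where "I = (\<lambda>\<omega>. \<integral>s. \<bar>f \<omega> s\<bar> \<partial>lborel)"
  define I' where "I' k = (\<lambda>\<omega>. \<integral>s. \<bar>step_process (K k) (\<sigma> k) (z k) s \<omega>\<bar> \<partial>lborel)" for k
  define J' where "J' k = step_ito_integral W (K k) (\<sigma> k) (z k)" for k
  define \<epsilon> where "\<epsilon> k = (\<integral>\<^sup>+\<omega>. (\<integral>\<^sup>+s\<in>{t..T}. ennreal ((step_process (K k) (\<sigma> k) (z k) s \<omega> - \<zeta> s \<omega>)\<^sup>2) \<partial>lborel) \<partial>M)" for k
  define \<delta> where "\<delta> k = (\<integral>\<^sup>+\<omega>. ennreal ((J' k \<omega> - J \<omega>)\<^sup>2) \<partial>M)" for k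
  define q where "q = exp (L\<^sup>2 * (T - t))"
  define E where "E = (\<integral>\<^sup>+\<omega>. ennreal ((\<Phi> \<omega>)\<^sup>2) \<partial>M)"
  note st = step(1)[unfolded adapted_step_def]
  have "(\<lambda>(s, \<omega>). f \<omega> s) \<in> borel_measurable (borel \<Otimes>\<^sub>M M)"
    using borel_measurable_extend_interval[OF \<zeta>] t unfolding f_def by simp
  then have f_joint: "(\<lambda>(\<omega>, s). f \<omega> s) \<in> borel_measurable (M \<Otimes>\<^sub>M lborel)"
    using measurable_pair_swap[of "\<lambda>(s, \<omega>). f \<omega> s" borel M borel] by (simp add: case_prod_beta cong: measurable_cong_sets)
  have f_meas: "f \<omega> \<in> borel_measurable lborel" if "\<omega> \<in> space M" for \<omega>
    using measurable_Pair2[OF f_joint that] by simp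
  have I: "I \<in> borel_measurable M"
    unfolding I_def using f_joint by (intro lborel.borel_measurable_lebesgue_integral) (auto simp: case_prod_beta)
  have LBI: "(LBINT s:{t..T}. \<bar>\<zeta> s \<omega>\<bar>) = I \<omega>" for \<omega>
    unfolding I_def f_def set_lebesgue_integral_def by (simp add: abs_mult)
  have z: "z k i \<in> borel_measurable M" if "i < K k" for k i
    using st[of k] that by (auto intro: measurable_filtrationD)
  have J': "J' k \<in> borel_measurable M" for k
    unfolding J'_def using t(1) step(1) by (rule step_ito_integral_measurable)
  have I': "I' k \<in> borel_measurable M" for k
  proof -
    have "I' k = (\<lambda>\<omega>. \<Sum>j<K k. \<bar>z k j \<omega>\<bar> * (\<sigma> k (Suc j) - \<sigma> k j))"
      unfolding I'_def by (rule ext, rule integral_abs_step_process(2)) (rule less_imp_le[OF step(2)])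
    then show ?thesis
      using z by simp
  qed
  have step_outside: "step_process (K k) (\<sigma> k) (z k) s \<omega> = 0" if "s \<notin> {t..T}" for k s \<omega>
    unfolding step_process_def
  proof (intro sum.neutral ballI)
    fix i assume "i \<in> {..<K k}"
    then have "t \<le> \<sigma> k i" "\<sigma> k (Suc i) \<le> T"
      using grid_le[of "K k" "\<sigma> k" 0 i] grid_le[of "K k" "\<sigma> k" "Suc i" "K k"] st[of k] by auto
    then show "indicat_real {\<sigma> k i<..\<sigma> k (Suc i)} s *\<^sub>R z k i \<omega> = 0"
      using that by (auto simp: indicator_def)
  qed
  have diff: "ennreal ((I \<omega> - I' k \<omega>)\<^sup>2) \<le> ennreal (T - t) *
     (\<integral>\<^sup>+s\<in>{t..T}. ennreal ((step_process (K k) (\<sigma> k) (z k) s \<omega> - \<zeta> s \<omega>)\<^sup>2) \<partial>lborel)" if "\<omega> \<in> space M" for \<omega> k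
  proof -
    have "ennreal ((I \<omega> - I' k \<omega>)\<^sup>2) \<le> ennreal (T - t) *
       (\<integral>\<^sup>+s. ennreal ((step_process (K k) (\<sigma> k) (z k) s \<omega> - f \<omega> s)\<^sup>2) \<partial>lborel)"
      unfolding I_def I'_def using t(2)
      by (intro abs_integral_difference_square f_meas that integral_abs_step_process less_imp_le step(2) step_outside)
         (auto simp: f_def)
    also have "(\<integral>\<^sup>+s. ennreal ((step_process (K k) (\<sigma> k) (z k) s \<omega> - f \<omega> s)\<^sup>2) \<partial>lborel) =
      (\<integral>\<^sup>+s\<in>{t..T}. ennreal ((step_process (K k) (\<sigma> k) (z k) s \<omega> - \<zeta> s \<omega>)\<^sup>2) \<partial>lborel)"
      by (rule nn_integral_cong) (auto simp: f_def indicator_def step_outside)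
    finally show ?thesis .
  qed
  have sq3: "(x + y + w)\<^sup>2 \<le> 3 * x\<^sup>2 + 3 * y\<^sup>2 + 3 * w\<^sup>2" for x y w :: real
  proof -
    have "0 \<le> (x - y)\<^sup>2 + (y - w)\<^sup>2 + (x - w)\<^sup>2" by simp
    also have "\<dots> = 3 * x\<^sup>2 + 3 * y\<^sup>2 + 3 * w\<^sup>2 - (x + y + w)\<^sup>2"
      by (simp add: power2_eq_square algebra_simps)
    finally show ?thesis by simp
  qed
  have bound: "(\<integral>\<^sup>+\<omega>. ennreal ((min m (max 0 (U \<omega>)))\<^sup>2) \<partial>M) \<le>
      ennreal q * (3 * E + ennreal (3 * L\<^sup>2 * (T - t)) * \<epsilon> k + 3 * \<delta> k)" if "0 \<le> m" for m k
  proof -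
    \<comment> \<open>The approximation errors of both integrals are moved into the inhomogeneous term.\<close>
    define \<Psi> where "\<Psi> = (\<lambda>\<omega>. \<Phi> \<omega> + L * (I \<omega> - I' k \<omega>) + (J' k \<omega> - J \<omega>))"
    have \<Psi>: "\<Psi> \<in> borel_measurable M"
      unfolding \<Psi>_def using \<Phi> I I' J J' by measurable
    have "AE \<omega> in M. 0 < U \<omega> \<longrightarrow> U \<omega> \<le> \<Psi> \<omega> + L * I' k \<omega> - J' k \<omega>"
      using le by eventually_elim (simp add: LBI \<Psi>_def algebra_simps)
    then have "(\<integral>\<^sup>+\<omega>. ennreal ((min m (max 0 (U \<omega>)))\<^sup>2) \<partial>M) \<le> ennreal q * (\<integral>\<^sup>+\<omega>. ennreal ((\<Psi> \<omega>)\<^sup>2) \<partial>M)"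
      unfolding q_def I'_def J'_def
      by (intro step_positive_part_estimate[OF t(1) step(1) step(2) U \<Psi> that])
    also have "(\<integral>\<^sup>+\<omega>. ennreal ((\<Psi> \<omega>)\<^sup>2) \<partial>M) \<le> (\<integral>\<^sup>+\<omega>. 3 * ennreal ((\<Phi> \<omega>)\<^sup>2) + ennreal (3 * L\<^sup>2 * (T - t)) *
       (\<integral>\<^sup>+s\<in>{t..T}. ennreal ((step_process (K k) (\<sigma> k) (z k) s \<omega> - \<zeta> s \<omega>)\<^sup>2) \<partial>lborel) + 3 * ennreal ((J' k \<omega> - J \<omega>)\<^sup>2) \<partial>M)"
    proof (rule nn_integral_mono)
      fix \<omega> assume \<omega>: "\<omega> \<in> space M"
      have "ennreal ((\<Psi> \<omega>)\<^sup>2) \<le> ennreal (3 * (\<Phi> \<omega>)\<^sup>2 + 3 * (L * (I \<omega> - I' k \<omega>))\<^sup>2 + 3 * (J' k \<omega> - J \<omega>)\<^sup>2)"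
        unfolding \<Psi>_def by (rule ennreal_leI[OF sq3])
      also have "\<dots> = 3 * ennreal ((\<Phi> \<omega>)\<^sup>2) + ennreal (3 * L\<^sup>2) * ennreal ((I \<omega> - I' k \<omega>)\<^sup>2) + 3 * ennreal ((J' k \<omega> - J \<omega>)\<^sup>2)"
        by (simp add: ennreal_plus[symmetric] ennreal_mult[symmetric] power_mult_distrib del: ennreal_plus flip: ennreal_numeral)
      also have "\<dots> \<le> 3 * ennreal ((\<Phi> \<omega>)\<^sup>2) + ennreal (3 * L\<^sup>2) * (ennreal (T - t) *
         (\<integral>\<^sup>+s\<in>{t..T}. ennreal ((step_process (K k) (\<sigma> k) (z k) s \<omega> - \<zeta> s \<omega>)\<^sup>2) \<partial>lborel)) + 3 * ennreal ((J' k \<omega> - J \<omega>)\<^sup>2)"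
        by (intro add_mono mult_left_mono diff \<omega>) auto
      finally show "ennreal ((\<Psi> \<omega>)\<^sup>2) \<le> 3 * ennreal ((\<Phi> \<omega>)\<^sup>2) + ennreal (3 * L\<^sup>2 * (T - t)) *
         (\<integral>\<^sup>+s\<in>{t..T}. ennreal ((step_process (K k) (\<sigma> k) (z k) s \<omega> - \<zeta> s \<omega>)\<^sup>2) \<partial>lborel) + 3 * ennreal ((J' k \<omega> - J \<omega>)\<^sup>2)"
        using t by (simp add: ennreal_mult mult.assoc)
    qed
    also have "\<dots> = 3 * E + ennreal (3 * L\<^sup>2 * (T - t)) * \<epsilon> k + 3 * \<delta> k"
    proof -
      have "(\<lambda>p. step_process (K k) (\<sigma> k) (z k) (snd p) (fst p)) \<in> borel_measurable (M \<Otimes>\<^sub>M lborel)"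
        unfolding step_process_def
      proof (intro borel_measurable_sum borel_measurable_scaleR)
        fix i assume "i \<in> {..<K k}"
        then have zi: "z k i \<in> borel_measurable M" using z by simp
        show "(\<lambda>p. z k i (fst p)) \<in> borel_measurable (M \<Otimes>\<^sub>M lborel)"
          by (rule measurable_compose[OF measurable_fst zi])
        show "(\<lambda>p. indicat_real {\<sigma> k i<..\<sigma> k (Suc i)} (snd p)) \<in> borel_measurable (M \<Otimes>\<^sub>M lborel)"
          by (rule measurable_compose[OF measurable_snd]) simp
      qed
      then have "(\<lambda>p. ennreal ((step_process (K k) (\<sigma> k) (z k) (snd p) (fst p) - f (fst p) (snd p))\<^sup>2)) \<in> borel_measurable (M \<Otimes>\<^sub>M lborel)"
        using f_joint unfolding case_prod_beta by measurable
      then have "(\<lambda>\<omega>. \<integral>\<^sup>+s. ennreal ((step_process (K k) (\<sigma> k) (z k) s \<omega> - f \<omega> s)\<^sup>2) \<partial>lborel) \<in> borel_measurable M"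
        by (intro lborel.borel_measurable_nn_integral) (simp add: case_prod_beta)
      moreover have "(\<integral>\<^sup>+s. ennreal ((step_process (K k) (\<sigma> k) (z k) s \<omega> - f \<omega> s)\<^sup>2) \<partial>lborel) =
        (\<integral>\<^sup>+s\<in>{t..T}. ennreal ((step_process (K k) (\<sigma> k) (z k) s \<omega> - \<zeta> s \<omega>)\<^sup>2) \<partial>lborel)" for \<omega>
        by (rule nn_integral_cong) (auto simp: f_def indicator_def step_outside)
      ultimately have m: "(\<lambda>\<omega>. \<integral>\<^sup>+s\<in>{t..T}. ennreal ((step_process (K k) (\<sigma> k) (z k) s \<omega> - \<zeta> s \<omega>)\<^sup>2) \<partial>lborel) \<in> borel_measurable M"
        by simp
      have m2: "(\<lambda>\<omega>. ennreal ((\<Phi> \<omega>)\<^sup>2)) \<in> borel_measurable M" "(\<lambda>\<omega>. ennreal ((J' k \<omega> - J \<omega>)\<^sup>2)) \<in> borel_measurable M"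
        using \<Phi> J J' by measurable
      show ?thesis
        unfolding E_def \<epsilon>_def \<delta>_def using m m2 by (simp add: nn_integral_add nn_integral_cmult)
    qed
    finally show ?thesis by (simp add: mult_left_mono)
  qed
  have "(\<integral>\<^sup>+\<omega>. ennreal ((min m (max 0 (U \<omega>)))\<^sup>2) \<partial>M) \<le> ennreal q * (3 * E)" if "0 \<le> m" for m
  proof -
    have "(\<lambda>k. ennreal q * (3 * E + ennreal (3 * L\<^sup>2 * (T - t)) * \<epsilon> k + 3 * \<delta> k)) \<longlonglongrightarrow>
        ennreal q * (3 * E + ennreal (3 * L\<^sup>2 * (T - t)) * 0 + 3 * 0)"
      using conv unfolding \<epsilon>_def[symmetric] J'_def[symmetric] \<delta>_def[symmetric]
      by (intro ennreal_tendsto_cmult tendsto_add tendsto_const) auto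
    then show ?thesis using bound[OF that] by (intro LIMSEQ_le_const) auto
  qed
  moreover have "(\<lambda>m. \<integral>\<^sup>+\<omega>. ennreal ((min (real m) (max 0 (U \<omega>)))\<^sup>2) \<partial>M) \<longlonglongrightarrow> (\<integral>\<^sup>+\<omega>. ennreal ((max 0 (U \<omega>))\<^sup>2) \<partial>M)"
  proof (rule nn_integral_LIMSEQ)
    show "incseq (\<lambda>m \<omega>. ennreal ((min (real m) (max 0 (U \<omega>)))\<^sup>2))"
      by (intro incseq_SucI le_funI ennreal_leI power_mono) auto
    show "(\<lambda>\<omega>. ennreal ((min (real m) (max 0 (U \<omega>)))\<^sup>2)) \<in> borel_measurable M" for m
      using measurable_filtrationD[OF U] by measurable
    show "(\<lambda>m. ennreal ((min (real m) (max 0 (U \<omega>)))\<^sup>2)) \<longlonglongrightarrow> ennreal ((max 0 (U \<omega>))\<^sup>2)" for \<omega>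
    proof (rule tendsto_eventually)
      obtain n where "max 0 (U \<omega>) \<le> real n" using real_arch_simple by blast
      then have "min (real m) (max 0 (U \<omega>)) = max 0 (U \<omega>)" if "m \<ge> n" for m
        using that by auto
      then show "\<forall>\<^sub>F m in sequentially. ennreal ((min (real m) (max 0 (U \<omega>)))\<^sup>2) = ennreal ((max 0 (U \<omega>))\<^sup>2)"
        unfolding eventually_sequentially by (intro exI[of _ n]) simp
    qed
  qed
  ultimately have "(\<integral>\<^sup>+\<omega>. ennreal ((max 0 (U \<omega>))\<^sup>2) \<partial>M) \<le> ennreal q * (3 * E)"
    by (intro LIMSEQ_le_const2) auto
  also have "\<dots> = ennreal (3 * q) * E"
    unfolding q_def by (simp add: ennreal_mult mult_ac)
  finally show ?thesis unfolding q_def E_def .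
qed

end

section \<open>Comparison of the generators\<close>

text \<open>A closed condition that holds almost surely at each point holds almost surely at all points of a
  countable dense set, and therefore everywhere. This puts the exceptional null sets, which may
  depend on \<open>(y, z)\<close>, into a single one, so that random arguments can be inserted.\<close>

lemma (in prob_space) AE_all_closed:
  fixes P :: "'a \<Rightarrow> 'b::second_countable_topology \<Rightarrow> bool"
  assumes closed: "AE \<omega> in M. closed {x. P \<omega> x}" and P: "\<And>x. AE \<omega> in M. P \<omega> x"
  shows "AE \<omega> in M. \<forall>x. P \<omega> x"
proof -
  obtain D :: "'b set" where D: "countable D" "\<And>X. open X \<Longrightarrow> X \<noteq> {} \<Longrightarrow> \<exists>d\<in>D. d \<in> X"
    using countable_dense_exists by blast
  have "AE \<omega> in M. \<forall>x\<in>D. P \<omega> x"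
    using P by (subst AE_ball_countable[OF D(1)]) blast
  with closed show ?thesis
  proof eventually_elim
    case (elim \<omega>)
    have "- {x. P \<omega> x} = {}"
      using D(2)[of "- {x. P \<omega> x}"] elim by (auto simp: open_Compl)
    then show ?case by auto
  qed
qed

text \<open>The null set where the derivative fails to vanish depends on \<open>r\<close>, so the mean value theorem is not
  available pathwise. By dominated convergence, however, \<open>r \<mapsto> E \<bar>q r - q 0\<bar>\<close> has derivative zero
  at every point.\<close>

lemma (in prob_space) zero_derivative_imp_AE_constant:
  fixes q :: "real \<Rightarrow> 'a \<Rightarrow> real"
  assumes meas: "\<And>r. q r \<in> borel_measurable M"
    and lip: "AE \<omega> in M. \<forall>r s. \<bar>q r \<omega> - q s \<omega>\<bar> \<le> L * \<bar>r - s\<bar>"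
    and deriv: "\<And>r. AE \<omega> in M. ((\<lambda>s. q s \<omega>) has_real_derivative 0) (at r)"
  shows "AE \<omega> in M. q r \<omega> = q 0 \<omega>"
proof -
  define G where "G r = expectation (\<lambda>\<omega>. \<bar>q r \<omega> - q 0 \<omega>\<bar>)" for r
  have int: "integrable M (\<lambda>\<omega>. \<bar>q r \<omega> - q s \<omega>\<bar>)" for r s
  proof (rule integrable_const_bound)
    show "AE \<omega> in M. norm \<bar>q r \<omega> - q s \<omega>\<bar> \<le> L * \<bar>r - s\<bar>"
      using lip by eventually_elim simp
  qed (use meas in measurable)
  have "(G has_real_derivative 0) (at r)" for r
    unfolding has_field_derivative_iff
  proof (rule LIMSEQ_SEQ_conv[THEN iffD1], intro allI impI)
    fix S :: "nat \<Rightarrow> real" assume S: "(\<forall>n. S n \<noteq> r) \<and> S \<longlonglongrightarrow> r"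
    define h where "h n \<omega> = \<bar>(q (S n) \<omega> - q r \<omega>) / (S n - r)\<bar>" for n \<omega>
    have "(\<lambda>n. expectation (h n)) \<longlonglongrightarrow> expectation (\<lambda>\<omega>. 0)"
    proof (rule integral_dominated_convergence[where w = "\<lambda>_. L"])
      show "h n \<in> borel_measurable M" for n unfolding h_def using meas by measurable
      show "AE \<omega> in M. (\<lambda>n. h n \<omega>) \<longlonglongrightarrow> 0"
        using deriv[of r]
      proof eventually_elim
        case (elim \<omega>)
        then have "(\<lambda>x. (q x \<omega> - q r \<omega>) / (x - r)) \<midarrow>r\<rightarrow> 0"
          unfolding has_field_derivative_iff .
        from this[folded LIMSEQ_SEQ_conv] have "(\<lambda>n. (q (S n) \<omega> - q r \<omega>) / (S n - r)) \<longlonglongrightarrow> 0"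
          using S by blast
        then show ?case unfolding h_def by (rule tendsto_rabs_zero)
      qed
      show "AE \<omega> in M. norm (h n \<omega>) \<le> L" for n
        using lip
      proof eventually_elim
        case (elim \<omega>)
        then have "\<bar>q (S n) \<omega> - q r \<omega>\<bar> \<le> L * \<bar>S n - r\<bar>" by blast
        moreover have "\<bar>S n - r\<bar> > 0" using S by simp
        ultimately show ?case unfolding h_def by (simp add: abs_divide divide_le_eq)
      qed
    qed simp_all
    then have lim: "(\<lambda>n. expectation (h n)) \<longlonglongrightarrow> 0" by simp
    show "(\<lambda>n. (G (S n) - G r) / (S n - r)) \<longlonglongrightarrow> 0"
    proof (rule Lim_null_comparison[OF _ lim], intro always_eventually allI)
      fix n
      have "\<bar>G (S n) - G r\<bar> = \<bar>expectation (\<lambda>\<omega>. \<bar>q (S n) \<omega> - q 0 \<omega>\<bar> - \<bar>q r \<omega> - q 0 \<omega>\<bar>)\<bar>"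
        unfolding G_def using int by simp
      also have "\<dots> \<le> expectation (\<lambda>\<omega>. \<bar>\<bar>q (S n) \<omega> - q 0 \<omega>\<bar> - \<bar>q r \<omega> - q 0 \<omega>\<bar>\<bar>)"
        by (rule integral_abs_bound)
      also have "\<dots> \<le> expectation (\<lambda>\<omega>. \<bar>q (S n) \<omega> - q r \<omega>\<bar>)"
        using int by (intro integral_mono) auto
      finally have "\<bar>G (S n) - G r\<bar> / \<bar>S n - r\<bar> \<le> expectation (\<lambda>\<omega>. \<bar>q (S n) \<omega> - q r \<omega>\<bar>) / \<bar>S n - r\<bar>"
        by (rule divide_right_mono) simp
      also have "\<dots> = expectation (h n)"
        unfolding h_def abs_divide by simp
      finally show "norm ((G (S n) - G r) / (S n - r)) \<le> expectation (h n)" by simp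
    qed
  qed
  then have "G r = G 0" by (intro DERIV_isconst_all) blast
  then have "expectation (\<lambda>\<omega>. \<bar>q r \<omega> - q 0 \<omega>\<bar>) = 0" unfolding G_def by simp
  then have "AE \<omega> in M. \<bar>q r \<omega> - q 0 \<omega>\<bar> = 0"
    using int by (subst integral_nonneg_eq_0_iff_AE[symmetric]) auto
  then show ?thesis by eventually_elim simp
qed

lemma generator_measurable:
  fixes g :: "real \<Rightarrow> real \<Rightarrow> real^'n \<Rightarrow> real^'n \<Rightarrow> 'w \<Rightarrow> real^'n"
  assumes g: "lipschitz_generator M F T g" and ts: "(t, s) \<in> time_triangle T"
  shows "(\<lambda>\<omega>. g t s y z \<omega>) \<in> borel_measurable M"
proof -
  have g': "(\<lambda>((t, s), y, z, \<omega>). g t s y z \<omega>)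
      \<in> borel_measurable (restrict_space borel (time_triangle T) \<Otimes>\<^sub>M borel \<Otimes>\<^sub>M borel \<Otimes>\<^sub>M M)"
    using g unfolding lipschitz_generator_def by blast
  have "(\<lambda>\<omega>. ((t, s), y, z, \<omega>)) \<in> measurable M (restrict_space borel (time_triangle T) \<Otimes>\<^sub>M borel \<Otimes>\<^sub>M borel \<Otimes>\<^sub>M M)"
    using ts by (intro measurable_Pair measurable_const measurable_ident) (auto simp: space_restrict_space)
  from measurable_compose[OF this g'] show ?thesis by simp
qed

lemma generator_process_measurable:
  fixes g :: "real \<Rightarrow> real \<Rightarrow> real^'n \<Rightarrow> real^'n \<Rightarrow> 'w \<Rightarrow> real^'n"
  assumes g: "lipschitz_generator M F T g" and t: "0 \<le> t"
    and Y: "(\<lambda>(s, \<omega>). Y s \<omega>) \<in> borel_measurable (restrict_space borel {t..T} \<Otimes>\<^sub>M M)"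
    and Z: "(\<lambda>(s, \<omega>). Z s \<omega>) \<in> borel_measurable (restrict_space borel {t..T} \<Otimes>\<^sub>M M)"
  shows "(\<lambda>(s, \<omega>). g t s (Y s \<omega>) (Z s \<omega>) \<omega>) \<in> borel_measurable (restrict_space borel {t..T} \<Otimes>\<^sub>M M)"
proof -
  have g': "(\<lambda>((t, s), y, z, \<omega>). g t s y z \<omega>)
      \<in> borel_measurable (restrict_space borel (time_triangle T) \<Otimes>\<^sub>M borel \<Otimes>\<^sub>M borel \<Otimes>\<^sub>M M)"
    using g unfolding lipschitz_generator_def by blast
  have "(\<lambda>s. (t, s)) \<in> measurable (restrict_space borel {t..T}) (restrict_space borel (time_triangle T))"
  proof (rule measurable_restrict_space2)
    have "(\<lambda>s. (t, s)) \<in> borel_measurable borel"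
      by (intro borel_measurable_continuous_onI continuous_intros)
    then show "(\<lambda>s. (t, s)) \<in> borel_measurable (restrict_space borel {t..T})"
      by (rule measurable_restrict_space1)
  qed (use t in \<open>auto simp: time_triangle_def space_restrict_space\<close>)
  then have "(\<lambda>p. ((t, fst p), (case p of (s, \<omega>) \<Rightarrow> Y s \<omega>), (case p of (s, \<omega>) \<Rightarrow> Z s \<omega>), snd p))
      \<in> measurable (restrict_space borel {t..T} \<Otimes>\<^sub>M M) (restrict_space borel (time_triangle T) \<Otimes>\<^sub>M borel \<Otimes>\<^sub>M borel \<Otimes>\<^sub>M M)"
    by (intro measurable_Pair Y Z measurable_snd) (rule measurable_compose[OF measurable_fst])
  from measurable_compose[OF this g'] show ?thesis by (simp add: case_prod_beta)
qed

lemma lipschitz_generator_continuous: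
  assumes "L-lipschitz_on UNIV (\<lambda>(y, z). g t s y z \<omega>)"
    "continuous_on UNIV a" "continuous_on UNIV b"
  shows "continuous_on UNIV (\<lambda>x. g t s (a x) (b x) \<omega>)"
  using continuous_on_compose2[OF lipschitz_on_continuous_on[OF assms(1)] continuous_on_Pair[OF assms(2,3)]] by simp

context prob_space begin

text \<open>Along the segment from \<open>z0\<close> to \<open>z1\<close> the derivative of the \<open>i\<close>-th component is \<open>(A v)\<^sub>i = A\<^sub>i\<^sub>i v\<^sub>i = 0\<close>,
  because \<open>A\<close> is diagonal and the direction \<open>v\<close> has no \<open>i\<close>-th component.\<close>

lemma diagonal_jacobian_imp_AE_eq:
  fixes g :: "real \<Rightarrow> real \<Rightarrow> real^'n \<Rightarrow> real^'n \<Rightarrow> 'a \<Rightarrow> real^'n"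
  assumes g: "lipschitz_generator M F T g" and ts: "(t, s) \<in> time_triangle T"
    and lip: "AE \<omega> in M. L-lipschitz_on UNIV (\<lambda>(y, z). g t s y z \<omega>)"
    and diag: "\<And>z. AE \<omega> in M. (\<lambda>z'. g t s y z' \<omega>) differentiable (at z) \<and>
      jacobian (\<lambda>z'. g t s y z' \<omega>) (at z) \<in> diagonal_matrices"
    and eq: "z0 $ i = z1 $ i"
  shows "AE \<omega> in M. g t s y z0 \<omega> $ i = g t s y z1 \<omega> $ i"
proof -
  define v where "v = z1 - z0"
  have v: "v $ i = 0" unfolding v_def using eq by simp
  define q where "q r \<omega> = g t s y (z0 + r *\<^sub>R v) \<omega> $ i" for r \<omega>
  have "AE \<omega> in M. q 1 \<omega> = q 0 \<omega>"
  proof (rule zero_derivative_imp_AE_constant)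
    show "q r \<in> borel_measurable M" for r
      unfolding q_def
      by (rule measurable_compose[OF generator_measurable[OF g ts] borel_measurable_continuous_onI])
         (auto intro: continuous_intros)
    show "AE \<omega> in M. \<forall>r s. \<bar>q r \<omega> - q s \<omega>\<bar> \<le> L * norm v * \<bar>r - s\<bar>"
      using lip
    proof eventually_elim
      case (elim \<omega>)
      show ?case
      proof (intro allI)
        fix r s'
        have "\<bar>q r \<omega> - q s' \<omega>\<bar> \<le> norm (g t s y (z0 + r *\<^sub>R v) \<omega> - g t s y (z0 + s' *\<^sub>R v) \<omega>)"
          unfolding q_def using component_le_norm_cart[of "g t s y (z0 + r *\<^sub>R v) \<omega> - g t s y (z0 + s' *\<^sub>R v) \<omega>" i] by simp
        also have "\<dots> \<le> L * dist (y, z0 + r *\<^sub>R v) (y, z0 + s' *\<^sub>R v)"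
          using lipschitz_onD[OF elim, of "(y, z0 + r *\<^sub>R v)" "(y, z0 + s' *\<^sub>R v)"] by (simp add: dist_norm)
        also have "dist (y, z0 + r *\<^sub>R v) (y, z0 + s' *\<^sub>R v) = norm v * \<bar>r - s'\<bar>"
          by (simp add: dist_Pair_Pair dist_norm flip: scaleR_diff_left)
        finally show "\<bar>q r \<omega> - q s' \<omega>\<bar> \<le> L * norm v * \<bar>r - s'\<bar>" by (simp add: mult.assoc)
      qed
    qed
    show "AE \<omega> in M. ((\<lambda>r. q r \<omega>) has_real_derivative 0) (at r)" for r
      using diag[of "z0 + r *\<^sub>R v"]
    proof eventually_elim
      case (elim \<omega>)
      define A where "A = jacobian (\<lambda>z'. g t s y z' \<omega>) (at (z0 + r *\<^sub>R v))"
      have A: "((\<lambda>z'. g t s y z' \<omega>) has_derivative (\<lambda>h. A *v h)) (at (z0 + r *\<^sub>R v))"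
        unfolding A_def using elim jacobian_works by blast
      have "((\<lambda>r. z0 + r *\<^sub>R v) has_derivative (\<lambda>h. h *\<^sub>R v)) (at r)"
        by (auto intro!: derivative_eq_intros)
      from has_derivative_compose[OF this A]
      have "((\<lambda>r. g t s y (z0 + r *\<^sub>R v) \<omega> $ i) has_derivative (\<lambda>h. (A *v (h *\<^sub>R v)) $ i)) (at r)"
        by (rule bounded_linear.has_derivative[OF bounded_linear_vec_nth])
      moreover have "(A *v (h *\<^sub>R v)) $ i = 0" for h
        unfolding matrix_vector_mult_def using elim v
        by (auto simp: A_def[symmetric] diagonal_matrices_def intro!: sum.neutral) metis
      moreover have "(*) 0 = (\<lambda>h::real. 0::real)" by (rule ext) simp
      ultimately show ?case
        unfolding q_def has_field_derivative_def by simp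
    qed
  qed
  then show ?thesis unfolding q_def v_def by eventually_elim simp
qed

lemma diagonal_jacobian_lipschitz:
  fixes g :: "real \<Rightarrow> real \<Rightarrow> real^'n \<Rightarrow> real^'n \<Rightarrow> 'a \<Rightarrow> real^'n"
  assumes g: "lipschitz_generator M F T g" and ts: "(t, s) \<in> time_triangle T"
    and lip: "AE \<omega> in M. L-lipschitz_on UNIV (\<lambda>(y, z). g t s y z \<omega>)"
    and diag: "\<And>y z. AE \<omega> in M. (\<lambda>z'. g t s y z' \<omega>) differentiable (at z) \<and>
      jacobian (\<lambda>z'. g t s y z' \<omega>) (at z) \<in> diagonal_matrices"
  shows "AE \<omega> in M. \<forall>y z z'. \<bar>g t s y z \<omega> $ i - g t s y z' \<omega> $ i\<bar> \<le> L * \<bar>z $ i - z' $ i\<bar>"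
proof -
  have pt: "AE \<omega> in M. \<bar>g t s y z \<omega> $ i - g t s y z' \<omega> $ i\<bar> \<le> L * \<bar>z $ i - z' $ i\<bar>" for y z z'
  proof -
    \<comment> \<open>The point \<open>w\<close> agrees with \<open>z\<close> in the \<open>i\<close>-th coordinate and with \<open>z'\<close> in all others.\<close>
    define w where "w = z' + axis i (z $ i - z' $ i)"
    have "AE \<omega> in M. g t s y z \<omega> $ i = g t s y w \<omega> $ i"
      by (rule diagonal_jacobian_imp_AE_eq[OF g ts lip diag]) (simp add: w_def axis_def)
    with lip show ?thesis
    proof eventually_elim
      case (elim \<omega>)
      have "\<bar>g t s y w \<omega> $ i - g t s y z' \<omega> $ i\<bar> \<le> norm (g t s y w \<omega> - g t s y z' \<omega>)"
        using component_le_norm_cart[of "g t s y w \<omega> - g t s y z' \<omega>" i] by simp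
      also have "\<dots> \<le> L * dist (y, w) (y, z')"
        using lipschitz_onD[OF elim(1), of "(y, w)" "(y, z')"] by (simp add: dist_norm)
      also have "dist (y, w) (y, z') = \<bar>z $ i - z' $ i\<bar>"
        by (simp add: dist_Pair_Pair dist_norm w_def norm_eq_sqrt_inner inner_axis_axis)
      finally show ?case using elim(2) by simp
    qed
  qed
  have "AE \<omega> in M. \<forall>x. \<bar>g t s (fst x) (fst (snd x)) \<omega> $ i - g t s (fst x) (snd (snd x)) \<omega> $ i\<bar>
      \<le> L * \<bar>fst (snd x) $ i - snd (snd x) $ i\<bar>"
  proof (rule AE_all_closed)
    show "AE \<omega> in M. closed {x. \<bar>g t s (fst x) (fst (snd x)) \<omega> $ i - g t s (fst x) (snd (snd x)) \<omega> $ i\<bar>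
        \<le> L * \<bar>fst (snd x) $ i - snd (snd x) $ i\<bar>}"
      using lip
    proof eventually_elim
      case (elim \<omega>)
      show ?case
        by (intro closed_Collect_le continuous_intros lipschitz_generator_continuous[of L g t s \<omega>, OF elim])
    qed
  qed (rule pt)
  then show ?thesis by eventually_elim auto
qed

text \<open>With \<open>p = (y0 - y1)\<^sup>+\<close> one has \<open>y0 \<le> y1 + p\<close>; monotonicity replaces \<open>y0\<close> by \<open>y1 + p\<close>, the Lipschitz
  condition removes \<open>p\<close>, and the diagonal structure exchanges \<open>z0\<close> for \<open>z1\<close> at a cost depending on
  the \<open>i\<close>-th coordinate only. The right-hand side is therefore a scalar expression in \<open>z\<close>, as the
  one-dimensional estimate demands.\<close>

lemma generator_comparison:
  fixes g0 g1 g :: "real \<Rightarrow> real \<Rightarrow> real^'n \<Rightarrow> real^'n \<Rightarrow> 'a \<Rightarrow> real^'n"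
  assumes g: "lipschitz_generator M F T g" and ts: "(t, s) \<in> time_triangle T"
    and lip: "AE \<omega> in M. L-lipschitz_on UNIV (\<lambda>(y, z). g t s y z \<omega>)"
    and lip0: "AE \<omega> in M. L0-lipschitz_on UNIV (\<lambda>(y, z). g0 t s y z \<omega>)"
    and lip1: "AE \<omega> in M. L1-lipschitz_on UNIV (\<lambda>(y, z). g1 t s y z \<omega>)"
    and mono: "AE \<omega> in M. \<forall>z. mono (\<lambda>y. g t s y z \<omega>)"
    and between: "\<And>y z. AE \<omega> in M. g0 t s y z \<omega> \<le> g t s y z \<omega> \<and> g t s y z \<omega> \<le> g1 t s y z \<omega>"
    and diag: "\<And>y z. AE \<omega> in M. (\<lambda>z'. g t s y z' \<omega>) differentiable (at z) \<and>
      jacobian (\<lambda>z'. g t s y z' \<omega>) (at z) \<in> diagonal_matrices"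
  shows "AE \<omega> in M. \<forall>y0 y1 z0 z1. g0 t s y0 z0 \<omega> $ i - g1 t s y1 z1 \<omega> $ i
    \<le> L * norm (\<chi> j. max 0 (y0 $ j - y1 $ j)) + L * \<bar>z0 $ i - z1 $ i\<bar>"
proof -
  have "AE \<omega> in M. \<forall>x. g0 t s (fst x) (snd x) \<omega> $ i \<le> g t s (fst x) (snd x) \<omega> $ i"
  proof (rule AE_all_closed)
    show "AE \<omega> in M. closed {x. g0 t s (fst x) (snd x) \<omega> $ i \<le> g t s (fst x) (snd x) \<omega> $ i}"
      using lip lip0
    proof eventually_elim
      case (elim \<omega>)
      show ?case
        by (intro closed_Collect_le continuous_intros lipschitz_generator_continuous[of L g t s \<omega>, OF elim(1)]
            lipschitz_generator_continuous[of L0 g0 t s \<omega>, OF elim(2)])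
    qed
    show "AE \<omega> in M. g0 t s (fst x) (snd x) \<omega> $ i \<le> g t s (fst x) (snd x) \<omega> $ i" for x
      using between[of "fst x" "snd x"] by eventually_elim (simp add: less_eq_vec_def)
  qed
  moreover have "AE \<omega> in M. \<forall>x. g t s (fst x) (snd x) \<omega> $ i \<le> g1 t s (fst x) (snd x) \<omega> $ i"
  proof (rule AE_all_closed)
    show "AE \<omega> in M. closed {x. g t s (fst x) (snd x) \<omega> $ i \<le> g1 t s (fst x) (snd x) \<omega> $ i}"
      using lip lip1
    proof eventually_elim
      case (elim \<omega>)
      show ?case
        by (intro closed_Collect_le continuous_intros lipschitz_generator_continuous[of L g t s \<omega>, OF elim(1)]
            lipschitz_generator_continuous[of L1 g1 t s \<omega>, OF elim(2)])
    qed
    show "AE \<omega> in M. g t s (fst x) (snd x) \<omega> $ i \<le> g1 t s (fst x) (snd x) \<omega> $ i" for x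
      using between[of "fst x" "snd x"] by eventually_elim (simp add: less_eq_vec_def)
  qed
  moreover note diagonal_jacobian_lipschitz[OF g ts lip diag, of i]
  ultimately show ?thesis
    using lip mono
  proof eventually_elim
    case (elim \<omega>)
    show ?case
    proof (intro allI)
      fix y0 y1 z0 z1 :: "real^'n"
      define p where "p = (\<chi> j. max 0 (y0 $ j - y1 $ j))"
      have "y0 \<le> y1 + p" unfolding p_def less_eq_vec_def by (simp add: max_def)
      then have "g t s y0 z0 \<omega> \<le> g t s (y1 + p) z0 \<omega>" using elim(5) by (auto dest: monoD)
      then have 1: "g t s y0 z0 \<omega> $ i \<le> g t s (y1 + p) z0 \<omega> $ i" by (simp add: less_eq_vec_def)
      have "\<bar>g t s (y1 + p) z0 \<omega> $ i - g t s y1 z0 \<omega> $ i\<bar> \<le> norm (g t s (y1 + p) z0 \<omega> - g t s y1 z0 \<omega>)"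
        using component_le_norm_cart[of "g t s (y1 + p) z0 \<omega> - g t s y1 z0 \<omega>" i] by simp
      also have "\<dots> \<le> L * dist (y1 + p, z0) (y1, z0)"
        using lipschitz_onD[OF elim(4), of "(y1 + p, z0)" "(y1, z0)"] by (simp add: dist_norm)
      also have "dist (y1 + p, z0) (y1, z0) = norm p"
        by (simp add: dist_Pair_Pair dist_norm)
      finally have 2: "g t s (y1 + p) z0 \<omega> $ i \<le> g t s y1 z0 \<omega> $ i + L * norm p" by simp
      have 3: "g t s y1 z0 \<omega> $ i \<le> g t s y1 z1 \<omega> $ i + L * \<bar>z0 $ i - z1 $ i\<bar>"
        using elim(3)[rule_format, of y1 z0 z1] by simp
      have 4: "g0 t s y0 z0 \<omega> $ i \<le> g t s y0 z0 \<omega> $ i" "g t s y1 z1 \<omega> $ i \<le> g1 t s y1 z1 \<omega> $ i"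
        using elim(1)[rule_format, of "(y0, z0)"] elim(2)[rule_format, of "(y1, z1)"] by auto
      from 1 2 3 4 show "g0 t s y0 z0 \<omega> $ i - g1 t s y1 z1 \<omega> $ i \<le> L * norm p + L * \<bar>z0 $ i - z1 $ i\<bar>"
        by linarith
    qed
  qed
qed

end

section \<open>Comparison of the solutions\<close>

lemma nn_integral_exp_le:
  fixes c :: real
  assumes "0 < c" "0 \<le> s"
  shows "(\<integral>\<^sup>+t\<in>{0..s}. ennreal (exp (c * t)) \<partial>lborel) \<le> ennreal (exp (c * s) / c)"
proof -
  have "(\<integral>\<^sup>+t. ennreal (exp (c * t)) * indicator {0..s} t \<partial>lborel) = ennreal (exp (c * s) / c - exp (c * 0) / c)"
    using assms by (intro nn_integral_FTC_Icc) (auto intro!: derivative_eq_intros)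
  also have "\<dots> \<le> ennreal (exp (c * s) / c)"
    using assms by (intro ennreal_leI) simp
  finally show ?thesis .
qed

text \<open>Integrating against the weight \<open>exp (k t)\<close> and exchanging the order of integration bounds the
  weighted integral \<open>V\<close> of \<open>u\<close> by \<open>(c / k) V\<close>. Since \<open>V\<close> is finite, \<open>V = 0\<close> as soon as \<open>k > c\<close>.\<close>

lemma volterra_inequality_imp_AE_zero:
  fixes u :: "real \<Rightarrow> ennreal" and c T :: real
  assumes u: "u \<in> borel_measurable lborel" and fin: "(\<integral>\<^sup>+t\<in>{0..T}. u t \<partial>lborel) < \<infinity>" and "0 \<le> c"
    and le: "AE t in lborel. t \<in> {0..T} \<longrightarrow> u t \<le> ennreal c * (\<integral>\<^sup>+s\<in>{t..T}. u s \<partial>lborel)"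
  shows "AE t in lborel. t \<in> {0..T} \<longrightarrow> u t = 0"
proof -
  \<comment> \<open>Any weight with \<open>c / k \<le> 1 / 2\<close> and \<open>k > 0\<close> works; \<open>c = 0\<close> is admitted.\<close>
  define k where "k = 2 * c + 1"
  have k: "0 < k" "c / k \<le> 1 / 2" unfolding k_def using \<open>0 \<le> c\<close> by (auto simp: field_simps)
  define w where "w t = ennreal (exp (k * t))" for t
  have w: "w \<in> borel_measurable lborel" unfolding w_def by measurable
  note [measurable] = u w
  define V where "V = (\<integral>\<^sup>+t\<in>{0..T}. (w t * u t) \<partial>lborel)"
  have "V \<le> (\<integral>\<^sup>+t. ennreal (exp (k * T)) * (u t * indicator {0..T} t) \<partial>lborel)"
    unfolding V_def w_def using k
    by (intro nn_integral_mono) (auto simp: indicator_def intro!: mult_right_mono ennreal_leI)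
  also have "\<dots> = ennreal (exp (k * T)) * (\<integral>\<^sup>+t\<in>{0..T}. u t \<partial>lborel)"
    by (rule nn_integral_cmult) measurable
  also have "\<dots> < \<infinity>" using fin by (simp add: ennreal_mult_less_top)
  finally have V_fin: "V < \<infinity>" .
  have "V \<le> (\<integral>\<^sup>+t. (\<integral>\<^sup>+s. ennreal c * (w t * u s * indicator {0..T} t * indicator {t..T} s) \<partial>lborel) \<partial>lborel)"
    unfolding V_def
  proof (rule nn_integral_mono_AE)
    show "AE t in lborel. w t * u t * indicator {0..T} t \<le>
        (\<integral>\<^sup>+s. ennreal c * (w t * u s * indicator {0..T} t * indicator {t..T} s) \<partial>lborel)"
      using le
    proof eventually_elim
      case (elim t)
      have "(\<integral>\<^sup>+s. ennreal c * (w t * u s * indicator {0..T} t * indicator {t..T} s) \<partial>lborel) =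
         (\<integral>\<^sup>+s. (ennreal c * w t * indicator {0..T} t) * (u s * indicator {t..T} s) \<partial>lborel)"
        by (rule nn_integral_cong) (simp add: mult_ac)
      also have "\<dots> = (ennreal c * w t * indicator {0..T} t) * (\<integral>\<^sup>+s\<in>{t..T}. u s \<partial>lborel)"
        by (rule nn_integral_cmult) measurable
      finally show ?case
        using elim mult_left_mono[of "u t" "ennreal c * (\<integral>\<^sup>+s\<in>{t..T}. u s \<partial>lborel)" "w t"]
        by (auto simp: indicator_def mult_ac)
    qed
  qed
  also have "\<dots> = (\<integral>\<^sup>+s. (\<integral>\<^sup>+t. ennreal c * (w t * u s * indicator {0..T} t * indicator {t..T} s) \<partial>lborel) \<partial>lborel)"
  proof (rule lborel_pair.Fubini')
    have "{x::real \<times> real. snd x \<le> fst x} \<in> sets (borel \<Otimes>\<^sub>M borel)"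
      unfolding borel_prod by (intro borel_closed closed_Collect_le continuous_intros)
    then have "{x::real \<times> real. snd x \<le> fst x} \<in> sets (lborel \<Otimes>\<^sub>M lborel)"
      by (simp cong: sets_pair_measure_cong)
    then have "(\<lambda>x. indicator {x. snd x \<le> fst x} x * indicator {..T} (fst x) :: ennreal) \<in> borel_measurable (lborel \<Otimes>\<^sub>M lborel)"
      by measurable
    moreover have "(\<lambda>x. indicator {snd x..T} (fst x) :: ennreal) = (\<lambda>x. indicator {x. snd x \<le> fst x} x * indicator {..T} (fst x))"
      by (auto simp: indicator_def fun_eq_iff)
    ultimately have "(\<lambda>x. indicator {snd x..T} (fst x) :: ennreal) \<in> borel_measurable (lborel \<Otimes>\<^sub>M lborel)"
      by simp
    moreover have "(\<lambda>x. ennreal c * (w (snd x) * u (fst x) * indicator {0..T} (snd x))) \<in> borel_measurable (lborel \<Otimes>\<^sub>M lborel)"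
      by measurable
    ultimately have "(\<lambda>x. ennreal c * (w (snd x) * u (fst x) * indicator {0..T} (snd x)) * indicator {snd x..T} (fst x))
        \<in> borel_measurable (lborel \<Otimes>\<^sub>M lborel)"
      by (rule borel_measurable_times_ennreal[rotated])
    then show "case_prod (\<lambda>s t. ennreal c * (w t * u s * indicator {0..T} t * indicator {t..T} s)) \<in> borel_measurable (lborel \<Otimes>\<^sub>M lborel)"
      by (simp only: case_prod_unfold mult.assoc)
  qed
  also have "\<dots> \<le> (\<integral>\<^sup>+s. ennreal (1 / 2) * (w s * u s * indicator {0..T} s) \<partial>lborel)"
  proof (rule nn_integral_mono)
    fix s
    have "(\<integral>\<^sup>+t. ennreal c * (w t * u s * indicator {0..T} t * indicator {t..T} s) \<partial>lborel) =
       (\<integral>\<^sup>+t. (ennreal c * u s * indicator {0..T} s) * (w t * indicator {0..s} t) \<partial>lborel)"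
      by (rule nn_integral_cong) (auto simp: indicator_def mult_ac)
    also have "\<dots> = (ennreal c * u s * indicator {0..T} s) * (\<integral>\<^sup>+t\<in>{0..s}. w t \<partial>lborel)"
      by (rule nn_integral_cmult) measurable
    also have "\<dots> \<le> (ennreal c * u s * indicator {0..T} s) * ennreal (exp (k * s) / k)"
      using nn_integral_exp_le[OF k(1), of s] unfolding w_def
      by (auto simp: indicator_def intro!: mult_left_mono)
    also have "\<dots> = ennreal (c / k) * (w s * u s * indicator {0..T} s)"
    proof -
      have "ennreal c * ennreal (exp (k * s) / k) = ennreal (c / k) * w s"
        unfolding w_def using k \<open>0 \<le> c\<close> by (simp flip: ennreal_mult)
      then show ?thesis by (metis (no_types, lifting) mult.assoc mult.commute)
    qed
    also have "\<dots> \<le> ennreal (1 / 2) * (w s * u s * indicator {0..T} s)"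
      using k by (intro mult_right_mono ennreal_leI) auto
    finally show "(\<integral>\<^sup>+t. ennreal c * (w t * u s * indicator {0..T} t * indicator {t..T} s) \<partial>lborel)
      \<le> ennreal (1 / 2) * (w s * u s * indicator {0..T} s)" .
  qed
  also have "\<dots> = ennreal (1 / 2) * V"
    unfolding V_def by (rule nn_integral_cmult) measurable
  finally have "V \<le> ennreal (1 / 2) * V" .
  then have "V = 0"
  proof -
    obtain v where v: "V = ennreal v" "0 \<le> v" using V_fin by (cases V) auto
    have "ennreal v \<le> ennreal (1 / 2) * ennreal v"
      using \<open>V \<le> ennreal (1 / 2) * V\<close> unfolding v(1) .
    also have "\<dots> = ennreal (1 / 2 * v)"
      using v by (intro ennreal_mult[symmetric]) auto
    finally have "v \<le> 1 / 2 * v"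
      by (rule ennreal_le_iff[THEN iffD1, rotated]) (use v in simp)
    with v show ?thesis by simp
  qed
  then have "AE t in lborel. w t * u t * indicator {0..T} t = 0"
    unfolding V_def by (subst (asm) nn_integral_0_iff_AE) auto
  then show ?thesis
    by eventually_elim (auto simp: w_def indicator_def split: if_splits)
qed

context brownian_space begin

lemma progressive_imp_measurable:
  assumes "progressive F a b X" "a \<le> b"
  shows "(\<lambda>(s, \<omega>). X s \<omega>) \<in> borel_measurable (restrict_space borel {a..b} \<Otimes>\<^sub>M M)"
proof -
  have X: "(\<lambda>(s, \<omega>). X s \<omega>) \<in> borel_measurable (restrict_space borel {a..b} \<Otimes>\<^sub>M F b)"
    using assms unfolding progressive_def by auto
  have "(\<lambda>\<omega>. \<omega>) \<in> measurable M (F b)"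
    by (rule measurable_filtrationD[of _ b]) simp
  then have "(\<lambda>p. (fst p, snd p)) \<in> measurable (restrict_space borel {a..b} \<Otimes>\<^sub>M M) (restrict_space borel {a..b} \<Otimes>\<^sub>M F b)"
    by (intro measurable_Pair measurable_fst measurable_compose[OF measurable_snd])
  from measurable_compose[OF this X] show ?thesis by (simp add: case_prod_beta)
qed

lemma interval_section_measurable:
  fixes X :: "real \<Rightarrow> 'w \<Rightarrow> 'b::{real_normed_vector, second_countable_topology}"
  assumes X: "(\<lambda>(s, \<omega>). X s \<omega>) \<in> borel_measurable (restrict_space borel {a..b} \<Otimes>\<^sub>M M)" and "a \<le> b"
    and \<omega>: "\<omega> \<in> space M"
  shows "(\<lambda>s. indicator {a..b} s *\<^sub>R X s \<omega>) \<in> borel_measurable lborel"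
    and "(\<lambda>s. ennreal ((norm (X s \<omega>))\<^sup>2) * indicator {a..b} s) \<in> borel_measurable lborel"
proof -
  show 1: "(\<lambda>s. indicator {a..b} s *\<^sub>R X s \<omega>) \<in> borel_measurable lborel"
    using measurable_Pair1[OF borel_measurable_extend_interval[OF X \<open>a \<le> b\<close>] \<omega>] by simp
  have eq: "(\<lambda>s. ennreal ((norm (X s \<omega>))\<^sup>2) * indicator {a..b} s) = (\<lambda>s. ennreal ((norm (indicator {a..b} s *\<^sub>R X s \<omega>))\<^sup>2))"
    by (rule ext) (auto simp: indicator_def)
  show "(\<lambda>s. ennreal ((norm (X s \<omega>))\<^sup>2) * indicator {a..b} s) \<in> borel_measurable lborel"
    unfolding eq by (rule measurable_compose[OF 1, of "\<lambda>x. ennreal ((norm x)\<^sup>2)"]) measurable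
qed

lemma interval_square_integral_measurable:
  fixes X :: "real \<Rightarrow> 'w \<Rightarrow> 'b::{real_normed_vector, second_countable_topology}"
  assumes X: "(\<lambda>(s, \<omega>). X s \<omega>) \<in> borel_measurable (restrict_space borel {a..b} \<Otimes>\<^sub>M M)" and "a \<le> b"
  shows "(\<lambda>\<omega>. \<integral>\<^sup>+s\<in>{a..b}. ennreal ((norm (X s \<omega>))\<^sup>2) \<partial>lborel) \<in> borel_measurable M"
proof -
  have "(\<lambda>(s, \<omega>). indicator {a..b} s *\<^sub>R X s \<omega>) \<in> borel_measurable (lborel \<Otimes>\<^sub>M M)"
    using borel_measurable_extend_interval[OF assms] by (simp cong: measurable_cong_sets)
  then have "(\<lambda>(\<omega>, s). indicator {a..b} s *\<^sub>R X s \<omega>) \<in> borel_measurable (M \<Otimes>\<^sub>M lborel)"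
    by (subst measurable_pair_swap_iff) (simp add: case_prod_beta)
  then have "(\<lambda>p. ennreal ((norm (indicator {a..b} (snd p) *\<^sub>R X (snd p) (fst p)))\<^sup>2)) \<in> borel_measurable (M \<Otimes>\<^sub>M lborel)"
    unfolding case_prod_beta by measurable
  then have "(\<lambda>\<omega>. \<integral>\<^sup>+s. ennreal ((norm (indicator {a..b} s *\<^sub>R X s \<omega>))\<^sup>2) \<partial>lborel) \<in> borel_measurable M"
    by (intro lborel.borel_measurable_nn_integral) (simp add: case_prod_beta)
  moreover have "(\<integral>\<^sup>+s. ennreal ((norm (indicator {a..b} s *\<^sub>R X s \<omega>))\<^sup>2) \<partial>lborel) =
      (\<integral>\<^sup>+s\<in>{a..b}. ennreal ((norm (X s \<omega>))\<^sup>2) \<partial>lborel)" for \<omega>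
    by (rule nn_integral_cong) (auto simp: indicator_def)
  ultimately show ?thesis by simp
qed

lemma step_process_joint_measurable:
  fixes \<xi> :: "nat \<Rightarrow> 'w \<Rightarrow> 'b::euclidean_space"
  assumes "adapted_step M F a b N \<tau> \<xi>"
  shows "(\<lambda>(s, \<omega>). step_process N \<tau> \<xi> s \<omega>) \<in> borel_measurable (restrict_space borel {a..b} \<Otimes>\<^sub>M M)"
  unfolding step_process_def case_prod_beta
proof (intro borel_measurable_sum borel_measurable_scaleR)
  fix i assume "i \<in> {..<N}"
  then have \<xi>: "\<xi> i \<in> borel_measurable M"
    using assms unfolding adapted_step_def by (auto intro: measurable_filtrationD)
  show "(\<lambda>p. \<xi> i (snd p)) \<in> borel_measurable (restrict_space borel {a..b} \<Otimes>\<^sub>M M)"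
    by (rule measurable_compose[OF measurable_snd \<xi>])
  have "(indicator {\<tau> i<..\<tau> (Suc i)} :: real \<Rightarrow> real) \<in> borel_measurable (restrict_space borel {a..b})"
    by (rule measurable_restrict_space1) simp
  then show "(\<lambda>p. indicat_real {\<tau> i<..\<tau> (Suc i)} (fst p)) \<in> borel_measurable (restrict_space borel {a..b} \<Otimes>\<^sub>M M)"
    by (rule measurable_compose[OF measurable_fst])
qed

text \<open>The difference of two stochastic integrals is approximated by the difference of the step processes
  on a common strict grid, and passing to a component does not increase the distance.\<close>

lemma ito_integral_difference_component:
  fixes H0 H1 :: "real \<Rightarrow> 'w \<Rightarrow> real^'n"
  assumes "0 \<le> a" "a \<le> b" and ito0: "has_ito_integral M F W a b H0 I0" and ito1: "has_ito_integral M F W a b H1 I1"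
  obtains K and \<sigma> :: "nat \<Rightarrow> nat \<Rightarrow> real" and \<zeta> :: "nat \<Rightarrow> nat \<Rightarrow> 'w \<Rightarrow> real"
  where "\<And>k i. i < K k \<Longrightarrow> \<sigma> k i < \<sigma> k (Suc i)" "\<And>k. adapted_step M F a b (K k) (\<sigma> k) (\<zeta> k)"
    "(\<lambda>k. \<integral>\<^sup>+\<omega>. (\<integral>\<^sup>+s\<in>{a..b}. ennreal ((step_process (K k) (\<sigma> k) (\<zeta> k) s \<omega> - (H0 s \<omega> $ c - H1 s \<omega> $ c))\<^sup>2) \<partial>lborel) \<partial>M)
      \<longlonglongrightarrow> 0"
    "(\<lambda>k. \<integral>\<^sup>+\<omega>. ennreal ((step_ito_integral W (K k) (\<sigma> k) (\<zeta> k) \<omega> - (I0 \<omega> $ c - I1 \<omega> $ c))\<^sup>2) \<partial>M) \<longlonglongrightarrow> 0"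
proof -
  obtain N0 \<tau>0 \<xi>0 where s0: "\<And>k. adapted_step M F a b (N0 k) (\<tau>0 k) (\<xi>0 k)"
    and c0: "(\<lambda>k. \<integral>\<^sup>+\<omega>. (\<integral>\<^sup>+s\<in>{a..b}. ennreal ((norm (step_process (N0 k) (\<tau>0 k) (\<xi>0 k) s \<omega> - H0 s \<omega>))\<^sup>2) \<partial>lborel) \<partial>M) \<longlonglongrightarrow> 0"
    and d0: "(\<lambda>k. \<integral>\<^sup>+\<omega>. ennreal ((norm (step_ito_integral W (N0 k) (\<tau>0 k) (\<xi>0 k) \<omega> - I0 \<omega>))\<^sup>2) \<partial>M) \<longlonglongrightarrow> 0"
    using ito0 unfolding has_ito_integral_def by blast
  obtain N1 \<tau>1 \<xi>1 where s1: "\<And>k. adapted_step M F a b (N1 k) (\<tau>1 k) (\<xi>1 k)"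
    and c1: "(\<lambda>k. \<integral>\<^sup>+\<omega>. (\<integral>\<^sup>+s\<in>{a..b}. ennreal ((norm (step_process (N1 k) (\<tau>1 k) (\<xi>1 k) s \<omega> - H1 s \<omega>))\<^sup>2) \<partial>lborel) \<partial>M) \<longlonglongrightarrow> 0"
    and d1: "(\<lambda>k. \<integral>\<^sup>+\<omega>. ennreal ((norm (step_ito_integral W (N1 k) (\<tau>1 k) (\<xi>1 k) \<omega> - I1 \<omega>))\<^sup>2) \<partial>M) \<longlonglongrightarrow> 0"
    using ito1 unfolding has_ito_integral_def by blast
  define S0 S1 where "S0 k = step_process (N0 k) (\<tau>0 k) (\<xi>0 k)" and "S1 k = step_process (N1 k) (\<tau>1 k) (\<xi>1 k)" for k
  define J0 J1 where "J0 k = step_ito_integral W (N0 k) (\<tau>0 k) (\<xi>0 k)" and "J1 k = step_ito_integral W (N1 k) (\<tau>1 k) (\<xi>1 k)" for k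
  have "\<forall>k. \<exists>K \<sigma> \<zeta>. (\<forall>i<K. \<sigma> i < \<sigma> (Suc i)) \<and> adapted_step M F a b K \<sigma> (\<zeta> :: nat \<Rightarrow> 'w \<Rightarrow> real) \<and>
      (\<forall>s \<omega>. step_process K \<sigma> \<zeta> s \<omega> = (S0 k s \<omega> - S1 k s \<omega>) $ c) \<and>
      (\<forall>\<omega>. step_ito_integral W K \<sigma> \<zeta> \<omega> = (J0 k \<omega> - J1 k \<omega>) $ c)"
  proof
    fix k
    show "\<exists>K \<sigma> \<zeta>. (\<forall>i<K. \<sigma> i < \<sigma> (Suc i)) \<and> adapted_step M F a b K \<sigma> (\<zeta> :: nat \<Rightarrow> 'w \<Rightarrow> real) \<and>
      (\<forall>s \<omega>. step_process K \<sigma> \<zeta> s \<omega> = (S0 k s \<omega> - S1 k s \<omega>) $ c) \<and>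
      (\<forall>\<omega>. step_ito_integral W K \<sigma> \<zeta> \<omega> = (J0 k \<omega> - J1 k \<omega>) $ c)"
      by (rule step_difference_component[OF s0[of k] s1[of k], of c]) (unfold S0_def S1_def J0_def J1_def, blast)
  qed
  then obtain K \<sigma> and \<zeta> :: "nat \<Rightarrow> nat \<Rightarrow> 'w \<Rightarrow> real" where
    K: "\<And>k. (\<forall>i<K k. \<sigma> k i < \<sigma> k (Suc i)) \<and> adapted_step M F a b (K k) (\<sigma> k) (\<zeta> k) \<and>
      (\<forall>s \<omega>. step_process (K k) (\<sigma> k) (\<zeta> k) s \<omega> = (S0 k s \<omega> - S1 k s \<omega>) $ c) \<and>
      (\<forall>\<omega>. step_ito_integral W (K k) (\<sigma> k) (\<zeta> k) \<omega> = (J0 k \<omega> - J1 k \<omega>) $ c)"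
    by metis
  have sq: "ennreal (((x - y) $ c - (x' $ c - y' $ c))\<^sup>2) \<le> 2 * ennreal ((norm (x - x'))\<^sup>2) + 2 * ennreal ((norm (y - y'))\<^sup>2)"
    for x y x' y' :: "real^'n"
  proof -
    define p q where "p = norm (x - x')" and "q = norm (y - y')"
    have "\<bar>(x - y) $ c - (x' $ c - y' $ c)\<bar> \<le> p + q"
      using component_le_norm_cart[of "x - x'" c] component_le_norm_cart[of "y - y'" c]
      unfolding p_def q_def by simp
    then have "((x - y) $ c - (x' $ c - y' $ c))\<^sup>2 \<le> (p + q)\<^sup>2"
      using power_mono[of "\<bar>(x - y) $ c - (x' $ c - y' $ c)\<bar>" "p + q" 2] by simp
    also have "\<dots> \<le> 2 * p\<^sup>2 + 2 * q\<^sup>2"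
      using zero_le_power2[of "p - q"] by (simp add: power2_eq_square algebra_simps)
    finally have "ennreal (((x - y) $ c - (x' $ c - y' $ c))\<^sup>2) \<le> ennreal (2 * p\<^sup>2 + 2 * q\<^sup>2)"
      by (rule ennreal_leI)
    then show ?thesis unfolding p_def q_def by (simp add: ennreal_mult)
  qed
  have H: "(\<lambda>(s, \<omega>). H0 s \<omega>) \<in> borel_measurable (restrict_space borel {a..b} \<Otimes>\<^sub>M M)"
    "(\<lambda>(s, \<omega>). H1 s \<omega>) \<in> borel_measurable (restrict_space borel {a..b} \<Otimes>\<^sub>M M)"
    using ito0 ito1 \<open>a \<le> b\<close> unfolding has_ito_integral_def by (auto intro: progressive_imp_measurable)
  have SH: "(\<lambda>(s, \<omega>). S0 k s \<omega> - H0 s \<omega>) \<in> borel_measurable (restrict_space borel {a..b} \<Otimes>\<^sub>M M)"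
    "(\<lambda>(s, \<omega>). S1 k s \<omega> - H1 s \<omega>) \<in> borel_measurable (restrict_space borel {a..b} \<Otimes>\<^sub>M M)" for k
    using H step_process_joint_measurable[OF s0[of k]] step_process_joint_measurable[OF s1[of k]]
    unfolding S0_def S1_def case_prod_beta by (auto intro: borel_measurable_diff)
  have J: "J0 k \<in> borel_measurable M" "J1 k \<in> borel_measurable M" for k
    unfolding J0_def J1_def by (rule step_ito_integral_measurable[OF \<open>0 \<le> a\<close>] s0 s1)+
  have I: "I0 \<in> borel_measurable M" "I1 \<in> borel_measurable M"
    using ito0 ito1 unfolding has_ito_integral_def by auto
  show ?thesis
  proof (rule that)
    show "\<sigma> k i < \<sigma> k (Suc i)" if "i < K k" for k i using K that by blast
    show "adapted_step M F a b (K k) (\<sigma> k) (\<zeta> k)" for k using K by blast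
    define e0 where "e0 k \<omega> = (\<integral>\<^sup>+s\<in>{a..b}. ennreal ((norm (S0 k s \<omega> - H0 s \<omega>))\<^sup>2) \<partial>lborel)" for k \<omega>
    define e1 where "e1 k \<omega> = (\<integral>\<^sup>+s\<in>{a..b}. ennreal ((norm (S1 k s \<omega> - H1 s \<omega>))\<^sup>2) \<partial>lborel)" for k \<omega>
    have e: "e0 k \<in> borel_measurable M" "e1 k \<in> borel_measurable M" for k
      unfolding e0_def e1_def using SH[of k] \<open>a \<le> b\<close> by (auto intro: interval_square_integral_measurable)
    have "(\<lambda>k. 2 * (\<integral>\<^sup>+\<omega>. e0 k \<omega> \<partial>M) + 2 * (\<integral>\<^sup>+\<omega>. e1 k \<omega> \<partial>M)) \<longlonglongrightarrow> 2 * 0 + 2 * 0"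
      using c0 c1 unfolding e0_def e1_def S0_def S1_def
      by (intro tendsto_add ennreal_tendsto_cmult) auto
    then have lim: "(\<lambda>k. 2 * (\<integral>\<^sup>+\<omega>. e0 k \<omega> \<partial>M) + 2 * (\<integral>\<^sup>+\<omega>. e1 k \<omega> \<partial>M)) \<longlonglongrightarrow> 0" by simp
    have *: "(\<integral>\<^sup>+s\<in>{a..b}. ennreal ((step_process (K k) (\<sigma> k) (\<zeta> k) s \<omega> - (H0 s \<omega> $ c - H1 s \<omega> $ c))\<^sup>2) \<partial>lborel) \<le> 2 * e0 k \<omega> + 2 * e1 k \<omega>"
      if \<omega>: "\<omega> \<in> space M" for k \<omega>
    proof -
      have m: "(\<lambda>s. ennreal ((norm (S0 k s \<omega> - H0 s \<omega>))\<^sup>2) * indicator {a..b} s) \<in> borel_measurable lborel"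
        "(\<lambda>s. ennreal ((norm (S1 k s \<omega> - H1 s \<omega>))\<^sup>2) * indicator {a..b} s) \<in> borel_measurable lborel"
        using interval_section_measurable[OF SH(1) \<open>a \<le> b\<close> \<omega>] interval_section_measurable[OF SH(2) \<open>a \<le> b\<close> \<omega>] by simp_all
      have "(\<integral>\<^sup>+s\<in>{a..b}. ennreal ((step_process (K k) (\<sigma> k) (\<zeta> k) s \<omega> - (H0 s \<omega> $ c - H1 s \<omega> $ c))\<^sup>2) \<partial>lborel)
        \<le> (\<integral>\<^sup>+s. 2 * (ennreal ((norm (S0 k s \<omega> - H0 s \<omega>))\<^sup>2) * indicator {a..b} s) +
           2 * (ennreal ((norm (S1 k s \<omega> - H1 s \<omega>))\<^sup>2) * indicator {a..b} s) \<partial>lborel)"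
        using sq K by (intro nn_integral_mono) (auto simp: indicator_def)
      also have "\<dots> = 2 * e0 k \<omega> + 2 * e1 k \<omega>"
        unfolding e0_def e1_def using m by (simp add: nn_integral_add nn_integral_cmult)
      finally show ?thesis .
    qed
    show "(\<lambda>k. \<integral>\<^sup>+\<omega>. (\<integral>\<^sup>+s\<in>{a..b}. ennreal ((step_process (K k) (\<sigma> k) (\<zeta> k) s \<omega> - (H0 s \<omega> $ c - H1 s \<omega> $ c))\<^sup>2) \<partial>lborel) \<partial>M) \<longlonglongrightarrow> 0"
    proof (rule tendsto_sandwich[OF _ _ tendsto_const lim]; intro always_eventually allI)
      fix k
      have "(\<integral>\<^sup>+\<omega>. (\<integral>\<^sup>+s\<in>{a..b}. ennreal ((step_process (K k) (\<sigma> k) (\<zeta> k) s \<omega> - (H0 s \<omega> $ c - H1 s \<omega> $ c))\<^sup>2) \<partial>lborel) \<partial>M)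
        \<le> (\<integral>\<^sup>+\<omega>. 2 * e0 k \<omega> + 2 * e1 k \<omega> \<partial>M)"
        by (rule nn_integral_mono) (rule *)
      also have "\<dots> = 2 * (\<integral>\<^sup>+\<omega>. e0 k \<omega> \<partial>M) + 2 * (\<integral>\<^sup>+\<omega>. e1 k \<omega> \<partial>M)"
        using e by (simp add: nn_integral_add nn_integral_cmult)
      finally show "(\<integral>\<^sup>+\<omega>. (\<integral>\<^sup>+s\<in>{a..b}. ennreal ((step_process (K k) (\<sigma> k) (\<zeta> k) s \<omega> - (H0 s \<omega> $ c - H1 s \<omega> $ c))\<^sup>2) \<partial>lborel) \<partial>M)
        \<le> 2 * (\<integral>\<^sup>+\<omega>. e0 k \<omega> \<partial>M) + 2 * (\<integral>\<^sup>+\<omega>. e1 k \<omega> \<partial>M)" .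
    qed simp
    have "(\<lambda>k. 2 * (\<integral>\<^sup>+\<omega>. ennreal ((norm (J0 k \<omega> - I0 \<omega>))\<^sup>2) \<partial>M) + 2 * (\<integral>\<^sup>+\<omega>. ennreal ((norm (J1 k \<omega> - I1 \<omega>))\<^sup>2) \<partial>M)) \<longlonglongrightarrow> 2 * 0 + 2 * 0"
      using d0 d1 unfolding J0_def J1_def by (intro tendsto_add ennreal_tendsto_cmult) auto
    then have lim': "(\<lambda>k. 2 * (\<integral>\<^sup>+\<omega>. ennreal ((norm (J0 k \<omega> - I0 \<omega>))\<^sup>2) \<partial>M) + 2 * (\<integral>\<^sup>+\<omega>. ennreal ((norm (J1 k \<omega> - I1 \<omega>))\<^sup>2) \<partial>M)) \<longlonglongrightarrow> 0" by simp
    show "(\<lambda>k. \<integral>\<^sup>+\<omega>. ennreal ((step_ito_integral W (K k) (\<sigma> k) (\<zeta> k) \<omega> - (I0 \<omega> $ c - I1 \<omega> $ c))\<^sup>2) \<partial>M) \<longlonglongrightarrow> 0"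
    proof (rule tendsto_sandwich[OF _ _ tendsto_const lim']; intro always_eventually allI)
      fix k
      have "(\<integral>\<^sup>+\<omega>. ennreal ((step_ito_integral W (K k) (\<sigma> k) (\<zeta> k) \<omega> - (I0 \<omega> $ c - I1 \<omega> $ c))\<^sup>2) \<partial>M)
        \<le> (\<integral>\<^sup>+\<omega>. 2 * ennreal ((norm (J0 k \<omega> - I0 \<omega>))\<^sup>2) + 2 * ennreal ((norm (J1 k \<omega> - I1 \<omega>))\<^sup>2) \<partial>M)"
        using sq K by (intro nn_integral_mono) auto
      also have "\<dots> = 2 * (\<integral>\<^sup>+\<omega>. ennreal ((norm (J0 k \<omega> - I0 \<omega>))\<^sup>2) \<partial>M) + 2 * (\<integral>\<^sup>+\<omega>. ennreal ((norm (J1 k \<omega> - I1 \<omega>))\<^sup>2) \<partial>M)"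
        using I J by (simp add: nn_integral_add nn_integral_cmult)
      finally show "(\<integral>\<^sup>+\<omega>. ennreal ((step_ito_integral W (K k) (\<sigma> k) (\<zeta> k) \<omega> - (I0 \<omega> $ c - I1 \<omega> $ c))\<^sup>2) \<partial>M)
        \<le> 2 * (\<integral>\<^sup>+\<omega>. ennreal ((norm (J0 k \<omega> - I0 \<omega>))\<^sup>2) \<partial>M) + 2 * (\<integral>\<^sup>+\<omega>. ennreal ((norm (J1 k \<omega> - I1 \<omega>))\<^sup>2) \<partial>M)" .
    qed simp
  qed
qed

end

lemma positive_part_norm_measurable:
  fixes f g :: "'a \<Rightarrow> real^'n"
  assumes "f \<in> borel_measurable N" "g \<in> borel_measurable N"
  shows "(\<lambda>x. norm (\<chi> j. max 0 (f x $ j - g x $ j))) \<in> borel_measurable N"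
proof -
  have *: "(\<lambda>y::real^'n. norm (\<chi> j. max 0 (y $ j))) \<in> borel_measurable borel"
    by (intro borel_measurable_continuous_onI continuous_intros)
  from measurable_compose[OF borel_measurable_diff[OF assms] *] show ?thesis by simp
qed

lemma positive_part_norm_square:
  fixes x :: "real^'n"
  shows "(norm (\<chi> j. max 0 (x $ j)))\<^sup>2 = (\<Sum>j\<in>UNIV. (max 0 (x $ j))\<^sup>2)"
  unfolding norm_vec_def L2_set_def by (simp add: sum_nonneg)

lemma positive_part_norm_square_le:
  fixes x y :: "real^'n"
  shows "(norm (\<chi> j. max 0 (x $ j - y $ j)))\<^sup>2 \<le> 2 * (norm x)\<^sup>2 + 2 * (norm y)\<^sup>2"
proof -
  have "norm (\<chi> j. max 0 (x $ j - y $ j)) \<le> norm (x - y)"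
    by (rule norm_le_componentwise_cart) simp
  also have "\<dots> \<le> norm x + norm y" by (rule norm_triangle_ineq4)
  finally have "(norm (\<chi> j. max 0 (x $ j - y $ j)))\<^sup>2 \<le> (norm x + norm y)\<^sup>2"
    by (rule power_mono) simp
  also have "\<dots> \<le> 2 * (norm x)\<^sup>2 + 2 * (norm y)\<^sup>2"
    using zero_le_power2[of "norm x - norm y"] by (simp add: power2_eq_square algebra_simps)
  finally show ?thesis .
qed

lemma borel_measurable_subinterval:
  fixes X :: "real \<Rightarrow> 'w \<Rightarrow> 'b::topological_space"
  assumes X: "(\<lambda>(s, \<omega>). X s \<omega>) \<in> borel_measurable (restrict_space borel {a..b} \<Otimes>\<^sub>M N)" and sub: "{c..d} \<subseteq> {a..b}"
  shows "(\<lambda>(s, \<omega>). X s \<omega>) \<in> borel_measurable (restrict_space borel {c..d} \<Otimes>\<^sub>M N)"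
proof -
  have "(\<lambda>s. s) \<in> measurable (restrict_space borel {c..d}) (restrict_space borel {a..b})"
    using sub by (intro measurable_restrict_space2 measurable_restrict_space1) (auto simp: space_restrict_space)
  then have "(\<lambda>p. (fst p, snd p)) \<in> measurable (restrict_space borel {c..d} \<Otimes>\<^sub>M N) (restrict_space borel {a..b} \<Otimes>\<^sub>M N)"
    by (intro measurable_Pair measurable_snd measurable_compose[OF measurable_fst])
  from measurable_compose[OF this X] show ?thesis by (simp add: case_prod_beta)
qed

context brownian_space begin

text \<open>For fixed \<open>t\<close> the equations become a scalar backward inequality for one coordinate; the
  one-dimensional estimate applies with \<open>\<Phi> = L \<integral>\<^sub>t\<^sup>T P ds\<close>, and Cauchy-Schwarz in time bounds \<open>\<Phi>\<close>.\<close>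

lemma bsvie_component_estimate:
  fixes Y0 Y1 Z0 Z1 :: "real \<Rightarrow> 'w \<Rightarrow> real^'n" and i :: 'n
  defines "P \<equiv> \<lambda>s \<omega>. norm (\<chi> j. max 0 (Y0 s \<omega> $ j - Y1 s \<omega> $ j))"
  assumes t: "0 \<le> t" "t < T"
    and g: "lipschitz_generator M F T g0" "lipschitz_generator M F T g1"
    and cmp: "\<And>s. s \<in> {t..T} \<Longrightarrow> AE \<omega> in M. \<forall>y0 y1 z0 z1. g0 t s y0 z0 \<omega> $ i - g1 t s y1 z1 \<omega> $ i
      \<le> L * norm (\<chi> j. max 0 (y0 $ j - y1 $ j)) + L * \<bar>z0 $ i - z1 $ i\<bar>"
    and Y: "(\<lambda>(s, \<omega>). Y0 s \<omega>) \<in> borel_measurable (restrict_space borel {t..T} \<Otimes>\<^sub>M M)"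
      "(\<lambda>(s, \<omega>). Y1 s \<omega>) \<in> borel_measurable (restrict_space borel {t..T} \<Otimes>\<^sub>M M)"
    and Yt: "Y0 t \<in> borel_measurable (F t)" "Y1 t \<in> borel_measurable (F t)"
    and fin: "AE \<omega> in M. (\<integral>\<^sup>+s\<in>{t..T}. ennreal ((P s \<omega>)\<^sup>2) \<partial>lborel) < \<infinity>"
    and ito: "has_ito_integral M F W t T Z0 I0" "has_ito_integral M F W t T Z1 I1"
    and eq0: "AE \<omega> in M. set_integrable lborel {t..T} (\<lambda>s. g0 t s (Y0 s \<omega>) (Z0 s \<omega>) \<omega>) \<and>
      Y0 t \<omega> = \<psi>0 \<omega> + (LBINT s:{t..T}. g0 t s (Y0 s \<omega>) (Z0 s \<omega>) \<omega>) - I0 \<omega>"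
    and eq1: "AE \<omega> in M. set_integrable lborel {t..T} (\<lambda>s. g1 t s (Y1 s \<omega>) (Z1 s \<omega>) \<omega>) \<and>
      Y1 t \<omega> = \<psi>1 \<omega> + (LBINT s:{t..T}. g1 t s (Y1 s \<omega>) (Z1 s \<omega>) \<omega>) - I1 \<omega>"
    and \<psi>: "AE \<omega> in M. \<psi>0 \<omega> \<le> \<psi>1 \<omega>"
  shows "(\<integral>\<^sup>+\<omega>. ennreal ((max 0 (Y0 t \<omega> $ i - Y1 t \<omega> $ i))\<^sup>2) \<partial>M) \<le>
    ennreal (3 * exp (L\<^sup>2 * (T - t)) * (L\<^sup>2 * (T - t))) * (\<integral>\<^sup>+\<omega>. (\<integral>\<^sup>+s\<in>{t..T}. ennreal ((P s \<omega>)\<^sup>2) \<partial>lborel) \<partial>M)"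
proof -
  have tT: "t \<le> T" using t by simp
  obtain K and \<sigma> :: "nat \<Rightarrow> nat \<Rightarrow> real" and z :: "nat \<Rightarrow> nat \<Rightarrow> 'w \<Rightarrow> real"
    where less: "\<And>k j. j < K k \<Longrightarrow> \<sigma> k j < \<sigma> k (Suc j)" and step: "\<And>k. adapted_step M F t T (K k) (\<sigma> k) (z k)"
    and conv: "(\<lambda>k. \<integral>\<^sup>+\<omega>. (\<integral>\<^sup>+s\<in>{t..T}. ennreal ((step_process (K k) (\<sigma> k) (z k) s \<omega> - (Z0 s \<omega> $ i - Z1 s \<omega> $ i))\<^sup>2) \<partial>lborel) \<partial>M)
      \<longlonglongrightarrow> 0"
    and conv_ito: "(\<lambda>k. \<integral>\<^sup>+\<omega>. ennreal ((step_ito_integral W (K k) (\<sigma> k) (z k) \<omega> - (I0 \<omega> $ i - I1 \<omega> $ i))\<^sup>2) \<partial>M) \<longlonglongrightarrow> 0"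
    using ito_integral_difference_component[OF t(1) tT ito, of i] by blast
  define \<zeta> where "\<zeta> s \<omega> = Z0 s \<omega> $ i - Z1 s \<omega> $ i" for s \<omega>
  define J where "J \<omega> = I0 \<omega> $ i - I1 \<omega> $ i" for \<omega>
  define G where "G s \<omega> = g0 t s (Y0 s \<omega>) (Z0 s \<omega>) \<omega> $ i - g1 t s (Y1 s \<omega>) (Z1 s \<omega>) \<omega> $ i" for s \<omega>
  define \<Phi> where "\<Phi> \<omega> = L * (LBINT s:{t..T}. P s \<omega>)" for \<omega>
  let ?R = "restrict_space borel {t..T} \<Otimes>\<^sub>M M"
  have Z: "(\<lambda>(s, \<omega>). Z0 s \<omega>) \<in> borel_measurable ?R" "(\<lambda>(s, \<omega>). Z1 s \<omega>) \<in> borel_measurable ?R"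
    using ito tT unfolding has_ito_integral_def by (auto intro: progressive_imp_measurable)
  have I: "I0 \<in> borel_measurable M" "I1 \<in> borel_measurable M"
    using ito unfolding has_ito_integral_def by auto
  have J: "J \<in> borel_measurable M"
    unfolding J_def using I by (intro borel_measurable_diff borel_measurable_vec_nth)
  have \<zeta>: "(\<lambda>(s, \<omega>). \<zeta> s \<omega>) \<in> borel_measurable ?R"
    unfolding \<zeta>_def case_prod_beta
    using Z unfolding case_prod_beta by (intro borel_measurable_diff borel_measurable_vec_nth)
  have P: "(\<lambda>(s, \<omega>). P s \<omega>) \<in> borel_measurable ?R"
    using positive_part_norm_measurable[OF Y] unfolding P_def by (simp add: case_prod_beta)
  have G: "(\<lambda>(s, \<omega>). G s \<omega>) \<in> borel_measurable ?R"
    using generator_process_measurable[OF g(1) t(1) Y(1) Z(1)] generator_process_measurable[OF g(2) t(1) Y(2) Z(2)]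
    unfolding G_def case_prod_beta by (intro borel_measurable_diff borel_measurable_vec_nth)
  \<comment> \<open>The generators are compared for every \<open>s\<close> with a null set depending on \<open>s\<close>; Fubini exchanges the two.\<close>
  have G_le: "AE \<omega> in M. AE s in lborel. s \<in> {t..T} \<longrightarrow> G s \<omega> \<le> L * P s \<omega> + L * \<bar>\<zeta> s \<omega>\<bar>"
  proof -
    define D where "D s \<omega> = G s \<omega> - (L * P s \<omega> + L * \<bar>\<zeta> s \<omega>\<bar>)" for s \<omega>
    have "(\<lambda>(s, \<omega>). D s \<omega>) \<in> borel_measurable ?R"
      using G P \<zeta> unfolding D_def case_prod_beta by measurable
    from borel_measurable_extend_interval[OF this tT]
    have "(\<lambda>x. indicator {t..T} (fst x) *\<^sub>R D (fst x) (snd x)) \<in> borel_measurable (lborel \<Otimes>\<^sub>M M)"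
      by (simp add: case_prod_beta cong: measurable_cong_sets)
    then have m: "{x \<in> space (lborel \<Otimes>\<^sub>M M). indicator {t..T} (fst x) *\<^sub>R D (fst x) (snd x) \<le> 0} \<in> sets (lborel \<Otimes>\<^sub>M M)"
      by measurable
    interpret p: pair_sigma_finite lborel M ..
    have "AE s in lborel. AE \<omega> in M. indicator {t..T} s *\<^sub>R D s \<omega> \<le> 0"
    proof (rule AE_I2)
      fix s
      show "AE \<omega> in M. indicator {t..T} s *\<^sub>R D s \<omega> \<le> 0"
      proof (cases "s \<in> {t..T}")
        case True
        from cmp[OF this] show ?thesis
          by eventually_elim (use True in \<open>simp add: D_def G_def P_def \<zeta>_def\<close>)
      qed simp
    qed
    then have "AE \<omega> in M. AE s in lborel. indicator {t..T} s *\<^sub>R D s \<omega> \<le> 0"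
      by (subst (asm) p.AE_commute[OF m])
    then show ?thesis
    proof eventually_elim
      case (elim \<omega>)
      then show ?case by eventually_elim (auto simp: D_def indicator_def)
    qed
  qed
  \<comment> \<open>Integrability of \<open>\<zeta>\<close> is inherited from one step process at finite distance.\<close>
  have \<zeta>_int: "AE \<omega> in M. set_integrable lborel {t..T} (\<lambda>s. \<zeta> s \<omega>)"
  proof -
    define e where "e k \<omega> = (\<integral>\<^sup>+s\<in>{t..T}. ennreal ((norm (step_process (K k) (\<sigma> k) (z k) s \<omega> - \<zeta> s \<omega>))\<^sup>2) \<partial>lborel)" for k \<omega>
    have "(\<lambda>k. \<integral>\<^sup>+\<omega>. e k \<omega> \<partial>M) \<longlonglongrightarrow> 0"
      using conv unfolding e_def \<zeta>_def by simp
    then have "\<forall>\<^sub>F k in sequentially. (\<integral>\<^sup>+\<omega>. e k \<omega> \<partial>M) < 1"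
      by (rule order_tendstoD) simp
    then obtain k where k: "(\<integral>\<^sup>+\<omega>. e k \<omega> \<partial>M) < 1"
      unfolding eventually_sequentially by blast
    have SZ: "(\<lambda>(s, \<omega>). step_process (K k) (\<sigma> k) (z k) s \<omega> - \<zeta> s \<omega>) \<in> borel_measurable ?R"
      using step_process_joint_measurable[OF step[of k]] \<zeta> unfolding case_prod_beta by (rule borel_measurable_diff)
    have "e k \<in> borel_measurable M"
      unfolding e_def by (rule interval_square_integral_measurable[OF SZ tT])
    then have "AE \<omega> in M. e k \<omega> \<noteq> \<infinity>"
      using k by (intro nn_integral_noteq_infinite) (auto simp: top_unique)
    with AE_space show ?thesis
    proof eventually_elim
      case (elim \<omega>)
      define h where "h s = indicator {t..T} s *\<^sub>R (step_process (K k) (\<sigma> k) (z k) s \<omega> - \<zeta> s \<omega>)" for s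
      have "(\<integral>\<^sup>+s. ennreal ((h s)\<^sup>2) \<partial>lborel) = e k \<omega>"
        unfolding e_def h_def by (rule nn_integral_cong) (auto simp: indicator_def)
      then have "(\<integral>\<^sup>+s. ennreal ((h s)\<^sup>2) \<partial>lborel) < \<infinity>"
        using elim by (simp add: less_top)
      moreover have "h \<in> borel_measurable lborel"
        unfolding h_def by (rule interval_section_measurable(1)[OF SZ tT elim(1)])
      ultimately have "integrable lborel h"
        using tT by (intro square_integral_le(1)[of h t T]) (auto simp: h_def)
      moreover have "integrable lborel (\<lambda>s. step_process (K k) (\<sigma> k) (z k) s \<omega>)"
        by (rule integral_abs_step_process(1)) (rule less_imp_le[OF less])
      then have "integrable lborel (\<lambda>s. indicator {t..T} s *\<^sub>R step_process (K k) (\<sigma> k) (z k) s \<omega>)"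
        by (rule integrable_mult_indicator[rotated]) simp
      ultimately have "integrable lborel (\<lambda>s. indicator {t..T} s *\<^sub>R step_process (K k) (\<sigma> k) (z k) s \<omega> - h s)"
        by (rule Bochner_Integration.integrable_diff[rotated])
      then show ?case
        unfolding set_integrable_def h_def by (simp add: algebra_simps)
    qed
  qed
  have P_int: "AE \<omega> in M. set_integrable lborel {t..T} (\<lambda>s. P s \<omega>) \<and>
      ennreal ((\<Phi> \<omega>)\<^sup>2) \<le> ennreal (L\<^sup>2 * (T - t)) * (\<integral>\<^sup>+s\<in>{t..T}. ennreal ((P s \<omega>)\<^sup>2) \<partial>lborel)"
    using AE_space fin
  proof eventually_elim
    case (elim \<omega>)
    define h where "h s = indicator {t..T} s *\<^sub>R P s \<omega>" for s
    have h2: "(\<integral>\<^sup>+s. ennreal ((h s)\<^sup>2) \<partial>lborel) = (\<integral>\<^sup>+s\<in>{t..T}. ennreal ((P s \<omega>)\<^sup>2) \<partial>lborel)"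
      unfolding h_def by (rule nn_integral_cong) (auto simp: indicator_def)
    have hm: "h \<in> borel_measurable lborel"
      unfolding h_def by (rule interval_section_measurable(1)[OF P tT elim(1)])
    have h0: "h s = 0" if "s \<notin> {t..T}" for s using that unfolding h_def by simp
    note sq = square_integral_le[OF hm h0 tT, unfolded h2, OF _ elim(2)]
    have "\<bar>h s\<bar> = h s" for s unfolding h_def P_def by simp
    then have "(\<integral>s. \<bar>h s\<bar> \<partial>lborel) = (LBINT s:{t..T}. P s \<omega>)"
      unfolding set_lebesgue_integral_def h_def by simp
    then have "ennreal ((\<Phi> \<omega>)\<^sup>2) = ennreal (L\<^sup>2) * ennreal ((\<integral>s. \<bar>h s\<bar> \<partial>lborel)\<^sup>2)"
      unfolding \<Phi>_def by (simp add: power_mult_distrib ennreal_mult)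
    also have "\<dots> \<le> ennreal (L\<^sup>2) * (ennreal (T - t) * (\<integral>\<^sup>+s\<in>{t..T}. ennreal ((P s \<omega>)\<^sup>2) \<partial>lborel))"
      using sq(2) by (intro mult_left_mono) auto
    finally show ?case
      using sq(1) tT unfolding set_integrable_def h_def by (simp add: ennreal_mult mult.assoc)
  qed
  have vec_int: "(LBINT s:A. f s) $ i = (LBINT s:A. f s $ i)" "set_integrable lborel A (\<lambda>s. f s $ i)"
    if "set_integrable lborel A f" for A and f :: "real \<Rightarrow> real^'n"
    using integral_bounded_linear[OF bounded_linear_vec_nth that[unfolded set_integrable_def], of i]
      integrable_bounded_linear[OF bounded_linear_vec_nth that[unfolded set_integrable_def], of i]
    unfolding set_lebesgue_integral_def set_integrable_def by simp_all
  have main: "AE \<omega> in M. 0 < Y0 t \<omega> $ i - Y1 t \<omega> $ i \<longrightarrow>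
      Y0 t \<omega> $ i - Y1 t \<omega> $ i \<le> \<Phi> \<omega> + L * (LBINT s:{t..T}. \<bar>\<zeta> s \<omega>\<bar>) - J \<omega>"
    using eq0 eq1 \<psi> G_le \<zeta>_int P_int
  proof eventually_elim
    case (elim \<omega>)
    let ?G0 = "\<lambda>s. g0 t s (Y0 s \<omega>) (Z0 s \<omega>) \<omega>" and ?G1 = "\<lambda>s. g1 t s (Y1 s \<omega>) (Z1 s \<omega>) \<omega>"
    have i0: "set_integrable lborel {t..T} ?G0" and i1: "set_integrable lborel {t..T} ?G1" using elim by auto
    have iP: "set_integrable lborel {t..T} (\<lambda>s. L * P s \<omega>)" using elim by auto
    have i\<zeta>: "set_integrable lborel {t..T} (\<lambda>s. L * \<bar>\<zeta> s \<omega>\<bar>)"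
      using set_integrable_abs[OF elim(5)] by auto
    have "Y0 t \<omega> $ i - Y1 t \<omega> $ i = \<psi>0 \<omega> $ i - \<psi>1 \<omega> $ i + ((LBINT s:{t..T}. ?G0 s $ i) - (LBINT s:{t..T}. ?G1 s $ i)) - J \<omega>"
      using elim(1,2) vec_int(1)[OF i0] vec_int(1)[OF i1] unfolding J_def by (simp add: vec_eq_iff)
    also have "(LBINT s:{t..T}. ?G0 s $ i) - (LBINT s:{t..T}. ?G1 s $ i) = (LBINT s:{t..T}. G s \<omega>)"
      unfolding G_def by (rule set_integral_diff(2)[OF vec_int(2)[OF i0] vec_int(2)[OF i1], symmetric])
    also have "(LBINT s:{t..T}. G s \<omega>) \<le> (LBINT s:{t..T}. L * P s \<omega> + L * \<bar>\<zeta> s \<omega>\<bar>)"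
    proof (rule set_integral_mono_AE)
      show "set_integrable lborel {t..T} (\<lambda>s. G s \<omega>)"
        unfolding G_def by (rule set_integral_diff(1)[OF vec_int(2)[OF i0] vec_int(2)[OF i1]])
      show "set_integrable lborel {t..T} (\<lambda>s. L * P s \<omega> + L * \<bar>\<zeta> s \<omega>\<bar>)"
        by (rule set_integral_add(1)[OF iP i\<zeta>])
      show "AE s\<in>{t..T} in lborel. G s \<omega> \<le> L * P s \<omega> + L * \<bar>\<zeta> s \<omega>\<bar>" by (rule elim(4))
    qed
    also have "(LBINT s:{t..T}. L * P s \<omega> + L * \<bar>\<zeta> s \<omega>\<bar>) = \<Phi> \<omega> + L * (LBINT s:{t..T}. \<bar>\<zeta> s \<omega>\<bar>)"
      using set_integral_add(2)[OF iP i\<zeta>] unfolding \<Phi>_def by simp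
    finally show ?case
      using elim(3) unfolding less_eq_vec_def by (auto dest: spec[of _ i])
  qed
  have U: "(\<lambda>\<omega>. Y0 t \<omega> $ i - Y1 t \<omega> $ i) \<in> borel_measurable (F t)"
    using Yt by (intro borel_measurable_diff borel_measurable_vec_nth)
  have \<Phi>: "\<Phi> \<in> borel_measurable M"
  proof -
    have "(\<lambda>(s, \<omega>). indicator {t..T} s *\<^sub>R P s \<omega>) \<in> borel_measurable (lborel \<Otimes>\<^sub>M M)"
      using borel_measurable_extend_interval[OF P tT] by (simp cong: measurable_cong_sets)
    then have "(\<lambda>(\<omega>, s). indicator {t..T} s *\<^sub>R P s \<omega>) \<in> borel_measurable (M \<Otimes>\<^sub>M lborel)"
      by (subst measurable_pair_swap_iff) (simp add: case_prod_beta)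
    then have "(\<lambda>\<omega>. \<integral>s. indicator {t..T} s *\<^sub>R P s \<omega> \<partial>lborel) \<in> borel_measurable M"
      by (rule lborel.borel_measurable_lebesgue_integral)
    then show ?thesis unfolding \<Phi>_def set_lebesgue_integral_def by simp
  qed
  have "(\<integral>\<^sup>+\<omega>. ennreal ((max 0 (Y0 t \<omega> $ i - Y1 t \<omega> $ i))\<^sup>2) \<partial>M) \<le>
      ennreal (3 * exp (L\<^sup>2 * (T - t))) * (\<integral>\<^sup>+\<omega>. ennreal ((\<Phi> \<omega>)\<^sup>2) \<partial>M)"
    using conv conv_ito unfolding \<zeta>_def[symmetric] J_def[symmetric]
    by (intro positive_part_estimate[OF t step less _ _ \<zeta> J U \<Phi> main])
  also have "(\<integral>\<^sup>+\<omega>. ennreal ((\<Phi> \<omega>)\<^sup>2) \<partial>M) \<le>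
      (\<integral>\<^sup>+\<omega>. ennreal (L\<^sup>2 * (T - t)) * (\<integral>\<^sup>+s\<in>{t..T}. ennreal ((P s \<omega>)\<^sup>2) \<partial>lborel) \<partial>M)"
    using P_int by (intro nn_integral_mono_AE) (auto elim: eventually_mono)
  also have "\<dots> = ennreal (L\<^sup>2 * (T - t)) * (\<integral>\<^sup>+\<omega>. (\<integral>\<^sup>+s\<in>{t..T}. ennreal ((P s \<omega>)\<^sup>2) \<partial>lborel) \<partial>M)"
    using interval_square_integral_measurable[OF P tT] by (intro nn_integral_cmult) simp
  finally show ?thesis
    using tT by (simp add: ennreal_mult mult.assoc mult_left_mono)
qed

end

theorem theorem3p2:
  fixes M :: "'w measure"
    and F :: "real \<Rightarrow> 'w measure"
    and W :: "real \<Rightarrow> 'w \<Rightarrow> real"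
    and T :: real
    and g0 g1 gbar :: "real \<Rightarrow> real \<Rightarrow> real^'n \<Rightarrow> real^'n \<Rightarrow> 'w \<Rightarrow> real^'n"
    and \<psi>0 \<psi>1 Y0 Y1 :: "real \<Rightarrow> 'w \<Rightarrow> real^'n"
    and Z0 Z1 :: "real \<Rightarrow> real \<Rightarrow> 'w \<Rightarrow> real^'n"
  assumes "T > 0"
    and "prob_space M" and "complete_measure M"
    and "standard_brownian_motion M W"
    and "F = augmented_filtration M W"
    and "lipschitz_generator M F T g0" and "bounded_at_zero M T g0"
    and "lipschitz_generator M F T g1" and "bounded_at_zero M T g1"
    and "lipschitz_generator M F T gbar"
    and "\<forall>(t, s)\<in>time_triangle T. AE \<omega> in M. \<forall>z. mono (\<lambda>y. gbar t s y z \<omega>)"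
    and "\<forall>(t, s)\<in>time_triangle T. \<forall>y z. AE \<omega> in M.
      g0 t s y z \<omega> \<le> gbar t s y z \<omega> \<and> gbar t s y z \<omega> \<le> g1 t s y z \<omega>"
    and "\<forall>(t, s)\<in>time_triangle T. \<forall>y z. AE \<omega> in M.
      (\<lambda>z'. gbar t s y z' \<omega>) differentiable (at z) \<and>
      jacobian (\<lambda>z'. gbar t s y z' \<omega>) (at z) \<in> diagonal_matrices"
    and "\<psi>0 \<in> C_L2 M F T" and "\<psi>1 \<in> C_L2 M F T"
    and "\<forall>t\<in>{0..T}. AE \<omega> in M. \<psi>0 t \<omega> \<le> \<psi>1 t \<omega>"
    and "bsvie_adapted_solution M F W T g0 \<psi>0 Y0 Z0"
    and "bsvie_adapted_solution M F W T g1 \<psi>1 Y1 Z1"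
  shows "AE t in lborel. t \<in> {0..T} \<longrightarrow> (AE \<omega> in M. Y0 t \<omega> \<le> Y1 t \<omega>)"
proof -
  interpret B: brownian_space M W
    using assms(2,4) by (intro brownian_space.intro brownian_space_axioms.intro)
  note F = \<open>F = augmented_filtration M W\<close>
  note g0 = \<open>lipschitz_generator M F T g0\<close> and g1 = \<open>lipschitz_generator M F T g1\<close>
    and gbar = \<open>lipschitz_generator M F T gbar\<close>
  note sol0 = \<open>bsvie_adapted_solution M F W T g0 \<psi>0 Y0 Z0\<close> and sol1 = \<open>bsvie_adapted_solution M F W T g1 \<psi>1 Y1 Z1\<close>
  obtain L where L: "\<And>t s. (t, s) \<in> time_triangle T \<Longrightarrow> AE \<omega> in M. L-lipschitz_on UNIV (\<lambda>(y, z). gbar t s y z \<omega>)"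
    using gbar unfolding lipschitz_generator_def by fast
  obtain L0 where L0: "\<And>t s. (t, s) \<in> time_triangle T \<Longrightarrow> AE \<omega> in M. L0-lipschitz_on UNIV (\<lambda>(y, z). g0 t s y z \<omega>)"
    using g0 unfolding lipschitz_generator_def by fast
  obtain L1 where L1: "\<And>t s. (t, s) \<in> time_triangle T \<Longrightarrow> AE \<omega> in M. L1-lipschitz_on UNIV (\<lambda>(y, z). g1 t s y z \<omega>)"
    using g1 unfolding lipschitz_generator_def by fast
  have cmp: "AE \<omega> in M. \<forall>y0 y1 z0 z1. g0 t s y0 z0 \<omega> $ i - g1 t s y1 z1 \<omega> $ i
      \<le> L * norm (\<chi> j. max 0 (y0 $ j - y1 $ j)) + L * \<bar>z0 $ i - z1 $ i\<bar>"
    if ts: "(t, s) \<in> time_triangle T" for t s and i :: 'n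
    by (rule B.generator_comparison[where g = gbar and ?g0.0 = g0 and ?g1.0 = g1, OF gbar ts L[OF ts] L0[OF ts] L1[OF ts]])
      (use assms(11-13) ts in blast)+
  have Y: "(\<lambda>(t, \<omega>). Y0 t \<omega>) \<in> borel_measurable (restrict_space borel {0..T} \<Otimes>\<^sub>M M)"
    "(\<lambda>(t, \<omega>). Y1 t \<omega>) \<in> borel_measurable (restrict_space borel {0..T} \<Otimes>\<^sub>M M)"
    and Yt: "\<And>t. t \<in> {0..T} \<Longrightarrow> Y0 t \<in> borel_measurable (F t)" "\<And>t. t \<in> {0..T} \<Longrightarrow> Y1 t \<in> borel_measurable (F t)"
    and Y2: "(\<integral>\<^sup>+\<omega>. (\<integral>\<^sup>+t\<in>{0..T}. ennreal ((norm (Y0 t \<omega>))\<^sup>2) \<partial>lborel) \<partial>M) < \<infinity>"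
      "(\<integral>\<^sup>+\<omega>. (\<integral>\<^sup>+t\<in>{0..T}. ennreal ((norm (Y1 t \<omega>))\<^sup>2) \<partial>lborel) \<partial>M) < \<infinity>"
    using sol0 sol1 unfolding bsvie_adapted_solution_def H2_triangle_def L2_adapted_def by auto
  have T0: "0 \<le> T" using \<open>T > 0\<close> by simp
  define P where "P s \<omega> = norm (\<chi> j. max 0 (Y0 s \<omega> $ j - Y1 s \<omega> $ j))" for s \<omega>
  have P: "(\<lambda>(s, \<omega>). P s \<omega>) \<in> borel_measurable (restrict_space borel {0..T} \<Otimes>\<^sub>M M)"
    using positive_part_norm_measurable[OF Y] unfolding P_def by (simp add: case_prod_beta)
  define u where "u s = (\<integral>\<^sup>+\<omega>. ennreal ((indicator {0..T} s * P s \<omega>)\<^sup>2) \<partial>M)" for s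
  have "(\<lambda>(s, \<omega>). indicator {0..T} s *\<^sub>R P s \<omega>) \<in> borel_measurable (lborel \<Otimes>\<^sub>M M)"
    using borel_measurable_extend_interval[OF P T0] by (simp cong: measurable_cong_sets)
  from measurable_compose[OF this, of "\<lambda>x. ennreal (x\<^sup>2)" borel]
  have P2: "(\<lambda>x. ennreal ((indicator {0..T} (fst x) * P (fst x) (snd x))\<^sup>2)) \<in> borel_measurable (lborel \<Otimes>\<^sub>M M)"
    by (simp add: case_prod_beta)
  have u: "u \<in> borel_measurable lborel"
    unfolding u_def using P2 by (intro B.borel_measurable_nn_integral) (simp only: case_prod_unfold)
  interpret pair: pair_sigma_finite lborel M ..
  have fubini: "(\<integral>\<^sup>+\<omega>. (\<integral>\<^sup>+s\<in>{t..T}. ennreal ((P s \<omega>)\<^sup>2) \<partial>lborel) \<partial>M) = (\<integral>\<^sup>+s\<in>{t..T}. u s \<partial>lborel)" if "0 \<le> t" for t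
  proof -
    have "(\<integral>\<^sup>+\<omega>. (\<integral>\<^sup>+s\<in>{t..T}. ennreal ((P s \<omega>)\<^sup>2) \<partial>lborel) \<partial>M) =
       (\<integral>\<^sup>+\<omega>. (\<integral>\<^sup>+s. ennreal ((indicator {0..T} s * P s \<omega>)\<^sup>2) * indicator {t..T} s \<partial>lborel) \<partial>M)"
      using that by (intro nn_integral_cong) (auto simp: indicator_def)
    also have "\<dots> = (\<integral>\<^sup>+s. (\<integral>\<^sup>+\<omega>. ennreal ((indicator {0..T} s * P s \<omega>)\<^sup>2) * indicator {t..T} s \<partial>M) \<partial>lborel)"
    proof (rule pair.Fubini')
      have "(\<lambda>x. indicator {t..T} (fst x) :: ennreal) \<in> borel_measurable (lborel \<Otimes>\<^sub>M M)"
        by (rule measurable_compose[OF measurable_fst]) simp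
      with P2 have "(\<lambda>x. ennreal ((indicator {0..T} (fst x) * P (fst x) (snd x))\<^sup>2) * indicator {t..T} (fst x)) \<in> borel_measurable (lborel \<Otimes>\<^sub>M M)"
        by (rule borel_measurable_times_ennreal)
      then show "(\<lambda>(s, \<omega>). ennreal ((indicator {0..T} s * P s \<omega>)\<^sup>2) * indicator {t..T} s) \<in> borel_measurable (lborel \<Otimes>\<^sub>M M)"
        by (simp only: case_prod_unfold)
    qed
    also have "\<dots> = (\<integral>\<^sup>+s\<in>{t..T}. u s \<partial>lborel)"
      unfolding u_def
    proof (intro nn_integral_cong nn_integral_multc)
      fix s :: real
      show "(\<lambda>\<omega>. ennreal ((indicator {0..T} s * P s \<omega>)\<^sup>2)) \<in> borel_measurable M"
        using measurable_compose[OF measurable_Pair1' P2, of s] by simp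
    qed
    finally show ?thesis .
  qed
  have PY: "(\<integral>\<^sup>+\<omega>. (\<integral>\<^sup>+s\<in>{0..T}. ennreal ((P s \<omega>)\<^sup>2) \<partial>lborel) \<partial>M) < \<infinity>"
  proof -
    define a0 a1 where "a0 \<omega> = (\<integral>\<^sup>+s\<in>{0..T}. ennreal ((norm (Y0 s \<omega>))\<^sup>2) \<partial>lborel)"
      and "a1 \<omega> = (\<integral>\<^sup>+s\<in>{0..T}. ennreal ((norm (Y1 s \<omega>))\<^sup>2) \<partial>lborel)" for \<omega>
    have a: "a0 \<in> borel_measurable M" "a1 \<in> borel_measurable M"
      unfolding a0_def a1_def by (rule B.interval_square_integral_measurable[OF Y(1) T0] B.interval_square_integral_measurable[OF Y(2) T0])+
    have "(\<integral>\<^sup>+\<omega>. (\<integral>\<^sup>+s\<in>{0..T}. ennreal ((P s \<omega>)\<^sup>2) \<partial>lborel) \<partial>M) \<le> (\<integral>\<^sup>+\<omega>. 2 * a0 \<omega> + 2 * a1 \<omega> \<partial>M)"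
    proof (rule nn_integral_mono)
      fix \<omega> assume \<omega>: "\<omega> \<in> space M"
      have "ennreal ((P s \<omega>)\<^sup>2) \<le> 2 * ennreal ((norm (Y0 s \<omega>))\<^sup>2) + 2 * ennreal ((norm (Y1 s \<omega>))\<^sup>2)" for s
        using ennreal_leI[OF positive_part_norm_square_le[of "Y0 s \<omega>" "Y1 s \<omega>"]] unfolding P_def by (simp add: ennreal_mult)
      then have "(\<integral>\<^sup>+s\<in>{0..T}. ennreal ((P s \<omega>)\<^sup>2) \<partial>lborel) \<le>
         (\<integral>\<^sup>+s. 2 * (ennreal ((norm (Y0 s \<omega>))\<^sup>2) * indicator {0..T} s) + 2 * (ennreal ((norm (Y1 s \<omega>))\<^sup>2) * indicator {0..T} s) \<partial>lborel)"
        by (intro nn_integral_mono) (auto simp: indicator_def)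
      also have "\<dots> = 2 * a0 \<omega> + 2 * a1 \<omega>"
        using B.interval_section_measurable(2)[OF Y(1) T0 \<omega>] B.interval_section_measurable(2)[OF Y(2) T0 \<omega>]
        unfolding a0_def a1_def by (simp add: nn_integral_add nn_integral_cmult)
      finally show "(\<integral>\<^sup>+s\<in>{0..T}. ennreal ((P s \<omega>)\<^sup>2) \<partial>lborel) \<le> 2 * a0 \<omega> + 2 * a1 \<omega>" .
    qed
    also have "\<dots> = 2 * (\<integral>\<^sup>+\<omega>. a0 \<omega> \<partial>M) + 2 * (\<integral>\<^sup>+\<omega>. a1 \<omega> \<partial>M)"
      using a by (simp add: nn_integral_add nn_integral_cmult)
    also have "\<dots> < \<infinity>"
      using Y2 unfolding a0_def a1_def by (simp add: ennreal_mult_less_top)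
    finally show ?thesis .
  qed
  have "AE \<omega> in M. (\<integral>\<^sup>+s\<in>{0..T}. ennreal ((norm (P s \<omega>))\<^sup>2) \<partial>lborel) \<noteq> \<infinity>"
    using PY B.interval_square_integral_measurable[OF P T0]
    by (intro nn_integral_noteq_infinite) auto
  then have P_fin: "AE \<omega> in M. (\<integral>\<^sup>+s\<in>{t..T}. ennreal ((P s \<omega>)\<^sup>2) \<partial>lborel) < \<infinity>" if "0 \<le> t" for t
  proof eventually_elim
    case (elim \<omega>)
    have "(\<integral>\<^sup>+s\<in>{t..T}. ennreal ((P s \<omega>)\<^sup>2) \<partial>lborel) \<le> (\<integral>\<^sup>+s\<in>{0..T}. ennreal ((norm (P s \<omega>))\<^sup>2) \<partial>lborel)"
      using that by (intro nn_integral_mono) (auto simp: indicator_def)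
    also have "\<dots> < \<infinity>" using elim by (simp add: less_top)
    finally show ?case .
  qed
  \<comment> \<open>The constant of the component estimate at \<open>t = 0\<close>, where it is largest.\<close>
  define C where "C = 3 * exp (L\<^sup>2 * T) * (L\<^sup>2 * T)"
  have C: "0 \<le> C" unfolding C_def using T0 by simp
  have sq: "(P t \<omega>)\<^sup>2 = (\<Sum>i\<in>UNIV. (max 0 (Y0 t \<omega> $ i - Y1 t \<omega> $ i))\<^sup>2)" for t \<omega>
    using positive_part_norm_square[of "Y0 t \<omega> - Y1 t \<omega>"] unfolding P_def by simp
  \<comment> \<open>The time \<open>t = T\<close> is discarded as a null set, since the estimates need \<open>t < T\<close>.\<close>
  have "AE t in lborel. t \<in> {0..T} \<longrightarrow> u t \<le> ennreal (real CARD('n) * C) * (\<integral>\<^sup>+s\<in>{t..T}. u s \<partial>lborel)"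
    using sol0[unfolded bsvie_adapted_solution_def, THEN conjunct2]
      sol1[unfolded bsvie_adapted_solution_def, THEN conjunct2] AE_lborel_singleton[of T]
  proof eventually_elim
    case (elim t)
    show ?case
    proof
      assume t: "t \<in> {0..T}"
      then have t': "0 \<le> t" "t < T" using elim(3) by auto
      obtain I0 where I0: "has_ito_integral M F W t T (Z0 t) I0" and eq0: "AE \<omega> in M.
          set_integrable lborel {t..T} (\<lambda>s. g0 t s (Y0 s \<omega>) (Z0 t s \<omega>) \<omega>) \<and>
          Y0 t \<omega> = \<psi>0 t \<omega> + (LBINT s:{t..T}. g0 t s (Y0 s \<omega>) (Z0 t s \<omega>) \<omega>) - I0 \<omega>"
        using elim(1) t by blast
      obtain I1 where I1: "has_ito_integral M F W t T (Z1 t) I1" and eq1: "AE \<omega> in M.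
          set_integrable lborel {t..T} (\<lambda>s. g1 t s (Y1 s \<omega>) (Z1 t s \<omega>) \<omega>) \<and>
          Y1 t \<omega> = \<psi>1 t \<omega> + (LBINT s:{t..T}. g1 t s (Y1 s \<omega>) (Z1 t s \<omega>) \<omega>) - I1 \<omega>"
        using elim(2) t by blast
      have sub: "{t..T} \<subseteq> {0..T}" using t by auto
      have bound: "(\<integral>\<^sup>+\<omega>. ennreal ((max 0 (Y0 t \<omega> $ i - Y1 t \<omega> $ i))\<^sup>2) \<partial>M) \<le> ennreal C * (\<integral>\<^sup>+s\<in>{t..T}. u s \<partial>lborel)" for i
      proof -
        have "(\<integral>\<^sup>+\<omega>. ennreal ((max 0 (Y0 t \<omega> $ i - Y1 t \<omega> $ i))\<^sup>2) \<partial>M) \<le>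
          ennreal (3 * exp (L\<^sup>2 * (T - t)) * (L\<^sup>2 * (T - t))) * (\<integral>\<^sup>+\<omega>. (\<integral>\<^sup>+s\<in>{t..T}. ennreal ((P s \<omega>)\<^sup>2) \<partial>lborel) \<partial>M)"
          unfolding P_def
        proof (rule B.bsvie_component_estimate[where ?g0.0 = g0 and ?g1.0 = g1, OF t' g0[unfolded F] g1[unfolded F]])
          show "AE \<omega> in M. \<forall>y0 y1 z0 z1. g0 t s y0 z0 \<omega> $ i - g1 t s y1 z1 \<omega> $ i
              \<le> L * norm (\<chi> j. max 0 (y0 $ j - y1 $ j)) + L * \<bar>z0 $ i - z1 $ i\<bar>" if "s \<in> {t..T}" for s
            using that t by (intro cmp) (auto simp: time_triangle_def)
          show "AE \<omega> in M. (\<integral>\<^sup>+s\<in>{t..T}. ennreal ((norm (\<chi> j. max 0 (Y0 s \<omega> $ j - Y1 s \<omega> $ j)))\<^sup>2) \<partial>lborel) < \<infinity>"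
            using P_fin[OF t'(1)] unfolding P_def .
          show "AE \<omega> in M. \<psi>0 t \<omega> \<le> \<psi>1 t \<omega>" using assms(16) t by blast
        qed (use borel_measurable_subinterval[OF Y(1) sub] borel_measurable_subinterval[OF Y(2) sub]
              Yt[OF t] I0 I1 eq0 eq1 F in auto)
        also have "\<dots> \<le> ennreal C * (\<integral>\<^sup>+\<omega>. (\<integral>\<^sup>+s\<in>{t..T}. ennreal ((P s \<omega>)\<^sup>2) \<partial>lborel) \<partial>M)"
          unfolding C_def using t by (intro mult_right_mono ennreal_leI mult_mono) (auto intro!: mult_left_mono)
        finally show ?thesis unfolding fubini[OF t'(1)] .
      qed
      have "u t = (\<integral>\<^sup>+\<omega>. (\<Sum>i\<in>UNIV. ennreal ((max 0 (Y0 t \<omega> $ i - Y1 t \<omega> $ i))\<^sup>2)) \<partial>M)"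
        unfolding u_def using t by (simp add: sq sum_ennreal)
      also have "\<dots> = (\<Sum>i\<in>UNIV. \<integral>\<^sup>+\<omega>. ennreal ((max 0 (Y0 t \<omega> $ i - Y1 t \<omega> $ i))\<^sup>2) \<partial>M)"
      proof (rule nn_integral_sum)
        fix i :: 'n
        have "(\<lambda>\<omega>. Y0 t \<omega> $ i - Y1 t \<omega> $ i) \<in> borel_measurable M"
          using Yt[OF t] unfolding F by (intro borel_measurable_diff borel_measurable_vec_nth B.measurable_filtrationD)
        then show "(\<lambda>\<omega>. ennreal ((max 0 (Y0 t \<omega> $ i - Y1 t \<omega> $ i))\<^sup>2)) \<in> borel_measurable M"
          by measurable
      qed
      also have "\<dots> \<le> (\<Sum>i\<in>(UNIV :: 'n set). ennreal C * (\<integral>\<^sup>+s\<in>{t..T}. u s \<partial>lborel))"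
        by (rule sum_mono) (rule bound)
      also have "\<dots> = ennreal (real CARD('n) * C) * (\<integral>\<^sup>+s\<in>{t..T}. u s \<partial>lborel)"
        using C by (simp add: ennreal_mult mult.assoc ennreal_of_nat_eq_real_of_nat)
      finally show "u t \<le> ennreal (real CARD('n) * C) * (\<integral>\<^sup>+s\<in>{t..T}. u s \<partial>lborel)" .
    qed
  qed
  then have "AE t in lborel. t \<in> {0..T} \<longrightarrow> u t = 0"
    using PY C unfolding fubini[OF order_refl]
    by (intro volterra_inequality_imp_AE_zero[OF u]) auto
  then show ?thesis
  proof eventually_elim
    case (elim t)
    show ?case
    proof
      assume t: "t \<in> {0..T}"
      have "P t \<in> borel_measurable M"
        unfolding P_def using Yt[OF t] unfolding F by (intro positive_part_norm_measurable B.measurable_filtrationD)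
      then have "AE \<omega> in M. ennreal ((P t \<omega>)\<^sup>2) = 0"
        using elim t unfolding u_def by (subst (asm) nn_integral_0_iff_AE) auto
      then show "AE \<omega> in M. Y0 t \<omega> \<le> Y1 t \<omega>"
      proof eventually_elim
        case (elim \<omega>)
        then have "(\<chi> j. max 0 (Y0 t \<omega> $ j - Y1 t \<omega> $ j)) = 0"
          unfolding P_def by simp
        then show ?case
          unfolding less_eq_vec_def vec_eq_iff by (simp add: max.absorb_iff1[symmetric])
      qed
    qed
  qed
qed

end
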